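(* Let $p,q,r\ge 0$ be integers, at most one of which is $0$. The graph $\theta(p,q,r)$ is determined by its Laplacian permanental polynomial; that is, for every graph $H$, if $\pi(L(H);x)=\pi(L(\theta(p,q,r));x)$ then $H$ is isomorphic to $\theta(p,q,r)$.
   Context: All graphs are finite, simple and undirected (not necessarily connected). For a graph $G$ with vertices $v_1,\dots,v_n$, let $A(G)$ be its $(0,1)$-adjacency matrix, $D(G)=\mathrm{diag}(d(v_1),\dots,d(v_n))$ the diagonal matrix of vertex degrees, and $L(G)=D(G)-A(G)$ the Laplacian matrix. The permanent of an $n\times n$ matrix $X=(x_{ij})$ is $\mathrm{per}(X)=\sum_{\sigma}\prod_{i=1}^n x_{i\sigma(i)}$, the sum being over all permutations $\sigma$ of $\{1,\dots,n\}$. The Laplacian permanental polynomial of $G$ is $\pi(L(G);x)=\mathrm{per}(xI-L(G))$, where $I$ is the $n\times n$ identity matrix. The graph $\theta(p,q,r)$, on $n=p+q+r+2$ vertices, consists of two given distinct vertices $u,v$ joined by three internally disjoint paths having respectively $p$, $q$ and $r$ interior vertices (a path with $0$ interior vertices is the single edge $uv$), where $p,q,r\ge 0$ and at most one of them is $0$. *)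

theory Defs
  imports
    "HOL-Computational_Algebra.Polynomial"
    "HOL-Combinatorics.Permutations"
    "Graph_Theory.Graph_Theory"
begin

text \<open>
  A finite simple undirected graph is a \<open>pair_graph\<close>: a finite, loop-free, symmetric relation
  \<open>parcs G\<close> on the vertex set \<open>pverts G\<close>, so an edge \<open>{u, v}\<close> is the pair of arcs \<open>(u, v)\<close>, \<open>(v, u)\<close>.
  Isomorphism is \<open>digraph_iso\<close>, after embedding by \<open>with_proj\<close>.
\<close>

lemma digraph_iso_with_proj_iff:
  assumes "pair_wf_digraph G" "pair_wf_digraph H"
  shows "digraph_iso (with_proj G) (with_proj H) \<longleftrightarrow>
    (\<exists>f. bij_betw f (pverts G) (pverts H) \<and>
      (\<forall>u\<in>pverts G. \<forall>v\<in>pverts G. (u, v) \<in> parcs G \<longleftrightarrow> (f u, f v) \<in> parcs H))"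
    (is "?L \<longleftrightarrow> ?R")
proof
  assume ?L
  then obtain h where h: "pre_digraph.digraph_isomorphism (with_proj G) h"
    and H: "with_proj H = app_iso h (with_proj G)"
    unfolding digraph_iso_def by blast
  let ?f = "iso_verts h"
  have pv: "pverts H = ?f ` pverts G" and pa: "parcs H = iso_arcs h ` parcs G"
    and tl: "iso_tail h = fst" and hd: "iso_head h = snd"
    using arg_cong[OF H, of verts] arg_cong[OF H, of arcs]
      arg_cong[OF H, of tail] arg_cong[OF H, of head] by simp_all
  have inj: "inj_on ?f (pverts G)"
    using h by (simp add: pre_digraph.digraph_isomorphism_def)
  have ia: "iso_arcs h e = (?f (fst e), ?f (snd e))" if "e \<in> parcs G" for e
    using h that by (simp add: pre_digraph.digraph_isomorphism_def tl hd prod_eq_iff)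
  have "(u, v) \<in> parcs G \<longleftrightarrow> (?f u, ?f v) \<in> parcs H" if uv: "u \<in> pverts G" "v \<in> pverts G" for u v
  proof
    assume "(u, v) \<in> parcs G"
    then show "(?f u, ?f v) \<in> parcs H" unfolding pa using ia by force
  next
    assume "(?f u, ?f v) \<in> parcs H"
    then obtain e where e: "e \<in> parcs G" "(?f u, ?f v) = (?f (fst e), ?f (snd e))"
      unfolding pa using ia by force
    moreover have "fst e \<in> pverts G" "snd e \<in> pverts G"
      using pair_wf_digraph.arc_fst_in_verts[OF assms(1) e(1)] pair_wf_digraph.arc_snd_in_verts[OF assms(1) e(1)] .
    ultimately have "fst e = u" "snd e = v" using uv inj by (auto dest: inj_onD)
    then show "(u, v) \<in> parcs G" using e by (metis prod.collapse)
  qed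
  then show ?R using inj pv by (auto simp: bij_betw_def)
next
  assume ?R
  then obtain f where f: "bij_betw f (pverts G) (pverts H)"
    "\<And>u v. u \<in> pverts G \<Longrightarrow> v \<in> pverts G \<Longrightarrow> (u, v) \<in> parcs G \<longleftrightarrow> (f u, f v) \<in> parcs H"
    by blast
  have inj: "inj_on f (pverts G)" and im: "pverts H = f ` pverts G"
    using f(1) by (auto simp: bij_betw_def)
  have wG: "fst e \<in> pverts G" "snd e \<in> pverts G" if "e \<in> parcs G" for e
    using pair_wf_digraph.arc_fst_in_verts[OF assms(1) that] pair_wf_digraph.arc_snd_in_verts[OF assms(1) that] .
  have wH: "fst e \<in> pverts H" "snd e \<in> pverts H" if "e \<in> parcs H" for e
    using pair_wf_digraph.arc_fst_in_verts[OF assms(2) that] pair_wf_digraph.arc_snd_in_verts[OF assms(2) that] .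
  define h where "h = \<lparr>iso_verts = f, iso_arcs = map_prod f f,
    iso_head = (snd :: 'b \<times> 'b \<Rightarrow> 'b), iso_tail = fst\<rparr>"
  have pa: "parcs H = map_prod f f ` parcs G"
  proof
    show "map_prod f f ` parcs G \<subseteq> parcs H"
    proof
      fix e assume "e \<in> map_prod f f ` parcs G"
      then obtain u v where uv: "(u, v) \<in> parcs G" "e = (f u, f v)" by auto
      then show "e \<in> parcs H" using f(2)[of u v] wG[OF uv(1)] by simp
    qed
    show "parcs H \<subseteq> map_prod f f ` parcs G"
    proof
      fix e assume e: "e \<in> parcs H"
      obtain u v where uv: "u \<in> pverts G" "v \<in> pverts G" "e = (f u, f v)"
        using wH[OF e] unfolding im by (cases e) auto
      then have "(u, v) \<in> parcs G" using e f(2) by simp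
      then show "e \<in> map_prod f f ` parcs G" using uv(3) by (simp add: rev_image_eqI)
    qed
  qed
  have "inj_on (map_prod f f) (parcs G)"
    by (rule inj_on_subset[OF map_prod_inj_on[OF inj inj]]) (auto dest: wG)
  then have "pre_digraph.digraph_isomorphism (with_proj G) h"
    using inj assms(1) wf_digraph_wp_iff[of G]
    by (simp add: pre_digraph.digraph_isomorphism_def h_def)
  moreover have "with_proj H = app_iso h (with_proj G)"
    by (simp add: with_proj_def app_iso_def h_def pa im)
  ultimately show ?L unfolding digraph_iso_def by blast
qed

text \<open>
  Square matrices are indexed by the vertices themselves: a matrix is a function
  \<open>'a \<Rightarrow> 'a \<Rightarrow> _\<close>, of which only the entries with both indices in the index set matter.
  The permanent does not depend on a numbering of the indices.
\<close>

definition permanent :: "'a set \<Rightarrow> ('a \<Rightarrow> 'a \<Rightarrow> 'b::comm_semiring_1) \<Rightarrow> 'b" where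
  "permanent V X = (\<Sum>\<sigma> | \<sigma> permutes V. \<Prod>v\<in>V. X v (\<sigma> v))"

definition adjacency_matrix :: "'a pair_pre_digraph \<Rightarrow> 'a \<Rightarrow> 'a \<Rightarrow> int" where
  "adjacency_matrix G u v = (if (u, v) \<in> parcs G then 1 else 0)"

text \<open>In a symmetric digraph the degree of a vertex of the undirected graph is its out-degree.\<close>

definition degree_matrix :: "'a pair_pre_digraph \<Rightarrow> 'a \<Rightarrow> 'a \<Rightarrow> int" where
  "degree_matrix G u v = (if u = v then int (out_degree (with_proj G) u) else 0)"

definition laplacian_matrix :: "'a pair_pre_digraph \<Rightarrow> 'a \<Rightarrow> 'a \<Rightarrow> int" where
  "laplacian_matrix G u v = degree_matrix G u v - adjacency_matrix G u v"

definition laplacian_permanental_poly :: "'a pair_pre_digraph \<Rightarrow> int poly" where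
  "laplacian_permanental_poly G =
    permanent (pverts G) (\<lambda>u v. (if u = v then [:0, 1:] else 0) - [:laplacian_matrix G u v:])"

definition path_edges :: "'a list \<Rightarrow> 'a rel" where
  "path_edges xs = set (zip xs (tl xs)) \<union> (set (zip xs (tl xs)))\<inverse>"

text \<open>The two end vertices of \<open>\<theta>(p, q, r)\<close> are \<open>0\<close> and \<open>1\<close>.\<close>

definition theta_graph :: "nat \<Rightarrow> nat \<Rightarrow> nat \<Rightarrow> nat pair_pre_digraph" where
  "theta_graph p q r = \<lparr>
    pverts = {0..<p + q + r + 2},
    parcs = path_edges ([0] @ [2..<p + 2] @ [1])
      \<union> path_edges ([0] @ [p + 2..<p + q + 2] @ [1])
      \<union> path_edges ([0] @ [p + q + 2..<p + q + r + 2] @ [1])\<rparr>"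

lemma path_edges_wf:
  assumes "distinct xs" "(u, v) \<in> path_edges xs"
  shows "u \<in> set xs \<and> v \<in> set xs \<and> u \<noteq> v"
proof -
  have "a \<in> set xs \<and> b \<in> set xs \<and> a \<noteq> b" if ab: "(a, b) \<in> set (zip xs (tl xs))" for a b
  proof -
    obtain i where "Suc i < length xs" "a = xs ! i" "b = xs ! Suc i"
      using ab by (auto simp: set_zip nth_tl less_diff_conv)
    then show ?thesis using assms(1) by (simp add: nth_eq_iff_index_eq)
  qed
  then show ?thesis using assms(2) unfolding path_edges_def by blast
qed

lemma pair_graph_theta_graph: "pair_graph (theta_graph p q r)"
proof -
  have d: "distinct ([0] @ [a + 2..<b + 2] @ [1])" for a b :: nat by auto
  have *: "u < p + q + r + 2 \<and> v < p + q + r + 2 \<and> u \<noteq> v"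
    if "(u, v) \<in> path_edges ([0] @ [a + 2..<b + 2] @ [1])" "b \<le> p + q + r" for u v a b
    using path_edges_wf[OF d that(1)] that(2) by auto
  have **: "u < p + q + r + 2 \<and> v < p + q + r + 2 \<and> u \<noteq> v"
    if uv: "(u, v) \<in> parcs (theta_graph p q r)" for u v
  proof -
    consider "(u, v) \<in> path_edges ([0] @ [0 + 2..<p + 2] @ [1])"
      | "(u, v) \<in> path_edges ([0] @ [p + 2..<p + q + 2] @ [1])"
      | "(u, v) \<in> path_edges ([0] @ [p + q + 2..<p + q + r + 2] @ [1])"
      using uv unfolding theta_graph_def pair_pre_digraph.simps add_0 Un_iff by argo
    then show ?thesis by cases (erule *, linarith)+
  qed
  have pv: "pverts (theta_graph p q r) = {0..<p + q + r + 2}"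
    by (simp add: theta_graph_def)
  show ?thesis
  proof unfold_locales
    show "finite (pverts (theta_graph p q r))" by (simp add: theta_graph_def)
    show "finite (parcs (theta_graph p q r))" by (simp add: theta_graph_def path_edges_def)
    show "symmetric (with_proj (theta_graph p q r))"
      by (auto simp: symmetric_def theta_graph_def path_edges_def intro!: symI)
  next
    fix e assume "e \<in> parcs (theta_graph p q r)"
    then have "(fst e, snd e) \<in> parcs (theta_graph p q r)" by simp
    from **[OF this] show "fst e \<in> pverts (theta_graph p q r)"
      "snd e \<in> pverts (theta_graph p q r)" "fst e \<noteq> snd e"
      unfolding pv by simp_all
  qed
qed

end

theory Submission
  imports Defs "HOL-Library.FuncSet"
begin

text \<open>
  Write \<open>y = x - 2\<close>. As \<open>x I - L = (x I - D) + A\<close>, the three top coefficients of the polynomial give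
  the number of vertices and the first two moments of the degree sequence, so \<open>H\<close> has two vertices
  \<open>u\<close>, \<open>v\<close> of degree 3 (diagonal entry \<open>y - 1\<close>) and all others of degree 2 (diagonal entry \<open>y\<close>).
  Hence \<open>H\<close> is the disjoint union of cycles with either a theta graph or a dumbbell (two cycles
  joined by a path), and its polynomial is a product of explicit expressions in the continuants
  \<open>F k\<close> with \<open>F (k + 2) = y F (k + 1) + F k\<close>.

  These expressions are compared in two ways. The coefficients of \<open>y\<^sup>0\<close> and \<open>y\<^sup>1\<close> show that if \<open>H\<close>
  has a dumbbell or at least one additional cycle, then all path lengths are even. In that case the
  polynomial of the theta graph has no negative real root, which excludes odd cycles; after the
  substitution \<open>y = 1 / s - s\<close>, where \<open>F k\<close> becomes explicit, the signs of its coefficients at odd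
  powers of \<open>s\<close> exclude even cycles and dumbbells. Finally, the lowest coefficient in \<open>s\<close> at which two
  theta graphs with the same number of edges differ shows that the three path lengths are determined.
\<close>

section \<open>Rectangular permanents\<close>

text \<open>A cycle of a permutation that runs through a path of degree-2 vertices from
  \<open>u\<close> to \<open>v\<close> uses up the row of \<open>u\<close> and the column of
  \<open>v\<close> in the rest of the graph. Eliminating such paths one by one therefore leads to
  minors whose row set differs from their column set.

  The degree moments do not see connectedness, so cycle factors have to be excluded by the
  polynomial itself. Its coefficients at low powers of \<open>y\<close> fail to do so exactly when
  all path lengths are even, since the constant coefficient of the theta polynomial is then 0. But
  in that case every exponent of \<open>s\<close> contributed by a length is even, so odd powers of
  \<open>s\<close> only see the odd parts of a few fixed factors. For a theta graph with
  \<open>N\<close> edges these are \<open>- 2 s - 4 s\<^sup>3\<close>, followed by nonnegative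
  coefficients below \<open>s ^ (2 N)\<close>, whereas the shortest additional cycle or dumbbell
  cycle, of length \<open>m\<close>, forces a negative coefficient at \<open>s ^ (m + 1)\<close> or
  \<open>s ^ (m + 3)\<close>.\<close>

definition minor_permanent :: "('a \<Rightarrow> 'a \<Rightarrow> 'b::comm_ring_1) \<Rightarrow> 'a set \<Rightarrow> 'a set \<Rightarrow> 'b" where
  "minor_permanent M R C = (\<Sum>\<sigma> | \<sigma> \<in> R \<rightarrow>\<^sub>E C \<and> bij_betw \<sigma> R C. \<Prod>r\<in>R. M r (\<sigma> r))"

text \<open>Two encodings of the same bijections: \<open>permutes\<close> is the identity outside
  \<open>V\<close>, while extensional functions are \<open>undefined\<close> there. The second one
  also makes sense for different row and column sets.\<close>

lemma permanent_eq_minor_permanent: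
  "permanent V M = minor_permanent M V V"
  unfolding permanent_def minor_permanent_def
proof (rule sum.reindex_bij_witness[where i = "\<lambda>\<sigma> x. if x \<in> V then \<sigma> x else x"
      and j = "\<lambda>\<sigma>. restrict \<sigma> V"])
  fix \<sigma> assume "\<sigma> \<in> {\<sigma>. \<sigma> permutes V}"
  then have s: "\<sigma> permutes V" by simp
  show "(\<lambda>x. if x \<in> V then restrict \<sigma> V x else x) = \<sigma>"
    using s by (auto simp: permutes_def)
  show "restrict \<sigma> V \<in> {\<sigma> \<in> V \<rightarrow>\<^sub>E V. bij_betw \<sigma> V V}"
    using permutes_imp_bij[OF s] by (auto simp: bij_betw_def inj_on_def)
  show "(\<Prod>r\<in>V. M r (restrict \<sigma> V r)) = (\<Prod>v\<in>V. M v (\<sigma> v))"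
    by (rule prod.cong) auto
next
  fix \<sigma> assume s: "\<sigma> \<in> {\<sigma> \<in> V \<rightarrow>\<^sub>E V. bij_betw \<sigma> V V}"
  then show "restrict (\<lambda>x. if x \<in> V then \<sigma> x else x) V = \<sigma>"
    by (auto simp: fun_eq_iff PiE_iff extensional_def)
  have "bij_betw (\<lambda>x. if x \<in> V then \<sigma> x else x) V V"
    using s by (subst bij_betw_cong[of V _ \<sigma>]) auto
  then show "(\<lambda>x. if x \<in> V then \<sigma> x else x) \<in> {\<sigma>. \<sigma> permutes V}"
    by (auto intro: bij_imp_permutes)
qed

lemma minor_permanent_empty [simp]:
  fixes M :: "'a \<Rightarrow> 'a \<Rightarrow> 'b::comm_ring_1"
  shows "minor_permanent M {} {} = 1"
proof -
  have "{\<sigma>. \<sigma> \<in> {} \<rightarrow>\<^sub>E {} \<and> bij_betw \<sigma> {} {}} = {\<lambda>_::'a. undefined::'a}"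
    (is "?B = _") by (auto simp: bij_betw_def)
  then have "(\<Sum>\<sigma>\<in>?B. \<Prod>r\<in>{}. M r (\<sigma> r)) = 1" by (simp only: prod.empty sum.insert) simp
  then show ?thesis by (simp only: minor_permanent_def)
qed

lemma minor_permanent_row:
  assumes "finite R" "finite C" "r \<notin> R"
  shows "minor_permanent M (insert r R) C =
    (\<Sum>c\<in>C. M r c * minor_permanent M R (C - {c}))"
proof -
  let ?B = "\<lambda>R C. {\<sigma>. \<sigma> \<in> R \<rightarrow>\<^sub>E C \<and> bij_betw \<sigma> R C}"
  have fin: "finite (?B R D)" if "finite D" for D
    using finite_PiE[of R "\<lambda>_. D"] assms(1) that by (auto intro: finite_subset[rotated])
  have "(\<Sum>c\<in>C. M r c * minor_permanent M R (C - {c}))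
      = (\<Sum>c\<in>C. \<Sum>\<sigma>\<in>?B R (C - {c}). M r c * (\<Prod>x\<in>R. M x (\<sigma> x)))"
    unfolding minor_permanent_def by (simp add: sum_distrib_left)
  also have "\<dots> = (\<Sum>(c, \<sigma>)\<in>Sigma C (\<lambda>c. ?B R (C - {c})). M r c * (\<Prod>x\<in>R. M x (\<sigma> x)))"
    using assms(2) fin by (subst sum.Sigma) auto
  also have "\<dots> = minor_permanent M (insert r R) C"
    unfolding minor_permanent_def
  \<comment> \<open>Resetting the value at \<open>r\<close> to \<open>undefined\<close> restores
    extensionality on \<open>R\<close>, which makes the splitting into \<open>\<sigma> r\<close> and
    the rest invertible.\<close>
  proof (rule sum.reindex_bij_witness[where i = "\<lambda>\<sigma>. (\<sigma> r, \<sigma>(r := undefined))"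
        and j = "\<lambda>(c, \<sigma>). \<sigma>(r := c)"])
    fix p assume p: "p \<in> Sigma C (\<lambda>c. ?B R (C - {c}))"
    then obtain c \<sigma> where pc: "p = (c, \<sigma>)" "c \<in> C" "\<sigma> \<in> R \<rightarrow>\<^sub>E C - {c}" "bij_betw \<sigma> R (C - {c})"
      by auto
    have "\<sigma> r = undefined" using pc(3) assms(3) by (auto simp: PiE_iff extensional_def)
    then show "(\<lambda>\<sigma>. (\<sigma> r, \<sigma>(r := undefined))) ((\<lambda>(c, \<sigma>). \<sigma>(r := c)) p) = p"
      using pc(1) by (auto simp: fun_eq_iff)
    have "bij_betw (\<sigma>(r := c)) R (C - {c})"
      using pc(4) assms(3) by (subst bij_betw_cong[of R _ \<sigma>]) auto
    then have "bij_betw (\<sigma>(r := c)) (insert r R) (insert ((\<sigma>(r := c)) r) (C - {c}))"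
      using assms(3) by (subst notIn_Un_bij_betw3[where A = R, simplified, symmetric]) auto
    then have "bij_betw (\<sigma>(r := c)) (insert r R) C" using pc(2) by (simp add: insert_absorb)
    moreover have "\<sigma>(r := c) \<in> insert r R \<rightarrow>\<^sub>E C"
      using pc by (auto simp: PiE_iff extensional_def)
    ultimately show "(\<lambda>(c, \<sigma>). \<sigma>(r := c)) p \<in> ?B (insert r R) C"
      using pc(1) by simp
    have "(\<Prod>x\<in>R. M x ((\<sigma>(r := c)) x)) = (\<Prod>x\<in>R. M x (\<sigma> x))"
      using assms(3) by (intro prod.cong) auto
    then show "(\<Prod>x\<in>insert r R. M x ((\<lambda>(c, \<sigma>). \<sigma>(r := c)) p x))
      = (case p of (c, \<sigma>) \<Rightarrow> M r c * (\<Prod>x\<in>R. M x (\<sigma> x)))"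
      using assms(1,3) pc(1) by simp
  next
    fix \<sigma> assume "\<sigma> \<in> ?B (insert r R) C"
    then have s: "\<sigma> \<in> insert r R \<rightarrow>\<^sub>E C" "bij_betw \<sigma> (insert r R) C" by auto
    show "(\<lambda>(c, \<sigma>). \<sigma>(r := c)) (\<sigma> r, \<sigma>(r := undefined)) = \<sigma>" by simp
    have "bij_betw \<sigma> R (C - {\<sigma> r})"
      using s(2) assms(3) by (auto simp: bij_betw_def inj_on_def)
    moreover have "bij_betw (\<sigma>(r := undefined)) R D \<longleftrightarrow> bij_betw \<sigma> R D" for D
      using assms(3) by (intro bij_betw_cong) auto
    ultimately have "bij_betw (\<sigma>(r := undefined)) R (C - {\<sigma> r})" by simp
    moreover have "\<sigma>(r := undefined) \<in> R \<rightarrow>\<^sub>E C - {\<sigma> r}"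
    proof -
      have "\<sigma> x \<noteq> \<sigma> r" if "x \<in> R" for x
        using s(2) that assms(3) unfolding bij_betw_def inj_on_def by blast
      then show ?thesis using s(1) assms(3) by (auto simp: PiE_iff extensional_def)
    qed
    moreover have "\<sigma> r \<in> C" using s(1) by auto
    ultimately show "(\<sigma> r, \<sigma>(r := undefined)) \<in> Sigma C (\<lambda>c. ?B R (C - {c}))"
      by simp
  qed
  finally show ?thesis ..
qed

lemma minor_permanent_card:
  assumes "finite R" "finite C" "card R \<noteq> card C"
  shows "minor_permanent M R C = 0"
proof -
  have "{\<sigma>. \<sigma> \<in> R \<rightarrow>\<^sub>E C \<and> bij_betw \<sigma> R C} = {}" using assms(3) bij_betw_same_card by blast
  then show ?thesis by (simp only: minor_permanent_def sum.empty)
qed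

text \<open>Derived from row expansion, without inverting bijections: the first row takes either
  column \<open>c\<close> or another column, and in the second case the induction hypothesis finds
  the row that takes \<open>c\<close>.\<close>

lemma minor_permanent_col:
  assumes "finite R" "finite C" "c \<notin> C"
  shows "minor_permanent M R (insert c C) =
    (\<Sum>r\<in>R. M r c * minor_permanent M (R - {r}) C)"
  using assms
proof (induction R arbitrary: C rule: finite_induct)
  case empty
  then show ?case by (simp add: minor_permanent_card)
next
  case (insert r R)
  note fin = \<open>finite R\<close> \<open>r \<notin> R\<close> \<open>finite C\<close> \<open>c \<notin> C\<close>
  have IH: "minor_permanent M R (insert c (C - {c'})) =
      (\<Sum>r'\<in>R. M r' c * minor_permanent M (R - {r'}) (C - {c'}))" for c'
    using fin by (intro insert.IH) auto
  have "minor_permanent M (insert r R) (insert c C) =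
      M r c * minor_permanent M R C
      + (\<Sum>c'\<in>C. M r c' * minor_permanent M R (insert c C - {c'}))"
    using fin by (simp add: minor_permanent_row)
  also have "(\<Sum>c'\<in>C. M r c' * minor_permanent M R (insert c C - {c'}))
      = (\<Sum>c'\<in>C. M r c' * minor_permanent M R (insert c (C - {c'})))"
    using fin by (intro sum.cong refl arg_cong2[where f = "(*)"] arg_cong[where f = "minor_permanent M R"]) auto
  also have "\<dots> = (\<Sum>r'\<in>R. \<Sum>c'\<in>C. M r c' * (M r' c * minor_permanent M (R - {r'}) (C - {c'})))"
    unfolding IH sum_distrib_left by (rule sum.swap)
  also have "\<dots> = (\<Sum>r'\<in>R. M r' c * minor_permanent M (insert r R - {r'}) C)"
  proof (intro sum.cong refl)
    fix r' assume "r' \<in> R"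
    then have "insert r R - {r'} = insert r (R - {r'})" using fin by auto
    then show "(\<Sum>c'\<in>C. M r c' * (M r' c * minor_permanent M (R - {r'}) (C - {c'})))
        = M r' c * minor_permanent M (insert r R - {r'}) C"
      using fin by (simp add: minor_permanent_row sum_distrib_left mult.left_commute)
  qed
  finally show ?case using fin by simp
qed

text \<open>Rows in \<open>R1\<close> can only use columns in \<open>C1\<close>. The bound
  \<open>card C1 \<le> card R1\<close> then leaves no column of \<open>C1\<close> for
  \<open>R2\<close>; if it is strict, both sides vanish.\<close>

lemma minor_permanent_block:
  assumes "finite R1" "finite R2" "finite C1" "finite C2" "R1 \<inter> R2 = {}" "C1 \<inter> C2 = {}"
    and "card C1 \<le> card R1" and "\<And>r c. r \<in> R1 \<Longrightarrow> c \<in> C2 \<Longrightarrow> M r c = 0"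
  shows "minor_permanent M (R1 \<union> R2) (C1 \<union> C2) = minor_permanent M R1 C1 * minor_permanent M R2 C2"
  using assms
proof (induction R1 arbitrary: C1 rule: finite_induct)
  case empty
  then show ?case by simp
next
  case (insert r R1)
  have "minor_permanent M (insert r R1 \<union> R2) (C1 \<union> C2)
      = (\<Sum>c\<in>C1 \<union> C2. M r c * minor_permanent M (R1 \<union> R2) (C1 \<union> C2 - {c}))"
    using insert.hyps insert.prems by (simp add: minor_permanent_row)
  also have "\<dots> = (\<Sum>c\<in>C1. M r c * minor_permanent M (R1 \<union> R2) (C1 \<union> C2 - {c}))"
    using insert.prems by (intro sum.mono_neutral_right) auto
  also have "\<dots> = (\<Sum>c\<in>C1. M r c * (minor_permanent M R1 (C1 - {c}) * minor_permanent M R2 C2))"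
  proof (intro sum.cong refl)
    fix c assume c: "c \<in> C1"
    have "minor_permanent M (R1 \<union> R2) ((C1 - {c}) \<union> C2)
        = minor_permanent M R1 (C1 - {c}) * minor_permanent M R2 C2"
      using insert.hyps insert.prems c by (intro insert.IH) auto
    moreover have "C1 \<union> C2 - {c} = (C1 - {c}) \<union> C2" using c insert.prems by auto
    ultimately show "M r c * minor_permanent M (R1 \<union> R2) (C1 \<union> C2 - {c})
        = M r c * (minor_permanent M R1 (C1 - {c}) * minor_permanent M R2 C2)" by simp
  qed
  also have "\<dots> = minor_permanent M (insert r R1) C1 * minor_permanent M R2 C2"
    using insert.hyps insert.prems by (simp add: minor_permanent_row sum_distrib_right mult.assoc)
  finally show ?case .
qed

section \<open>Permanents of graphs with threads of vertices of degree 2\<close>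

text \<open>The Fibonacci polynomials. A path of \<open>k\<close> vertices with diagonal entry
  \<open>y\<close> has permanent \<open>continuant y (Suc k)\<close>, so the index counts edges once
  the path is attached at both ends. The plus sign in the recursion, a minus for determinants, is
  due to the permanent.\<close>

fun continuant :: "'b::comm_ring_1 \<Rightarrow> nat \<Rightarrow> 'b" where
  "continuant y 0 = 0"
| "continuant y (Suc 0) = 1"
| "continuant y (Suc (Suc k)) = y * continuant y (Suc k) + continuant y k"

text \<open>The list holds the interior vertices of a path from \<open>u\<close> to
  \<open>v\<close>, each having exactly its two neighbors on the path. The further neighbors of
  \<open>u\<close> and \<open>v\<close> are left open, and \<open>u = v\<close> is allowed, so that
  cycles hanging at a vertex are covered.\<close>

fun thread :: "('a \<Rightarrow> 'a set) \<Rightarrow> 'a \<Rightarrow> 'a list \<Rightarrow> 'a \<Rightarrow> bool" where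
  "thread N u [] v \<longleftrightarrow> v \<in> N u"
| "thread N u (a # as) v \<longleftrightarrow> N a = {u, hd (as @ [v])} \<and> thread N a as v"

locale neighborhood =
  fixes N :: "'a \<Rightarrow> 'a set"
  assumes sym: "w \<in> N u \<Longrightarrow> u \<in> N w" and irrefl: "u \<notin> N u" and finite_N: "finite (N u)"
begin

definition matrix :: "('a \<Rightarrow> 'b::comm_ring_1) \<Rightarrow> 'a \<Rightarrow> 'a \<Rightarrow> 'b" where
  "matrix d u w = (if u = w then d u else if w \<in> N u then 1 else 0)"

definition pm :: "('a \<Rightarrow> 'b::comm_ring_1) \<Rightarrow> 'a set \<Rightarrow> 'a set \<Rightarrow> 'b" where
  "pm d = minor_permanent (matrix d)"

text \<open>The value 0 for an absent row or column makes the elimination formulas uniform: they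
  hold whether or not \<open>x\<close> and \<open>w\<close> belong to \<open>R\<close> and
  \<open>C\<close>.\<close>

definition del :: "('a \<Rightarrow> 'b::comm_ring_1) \<Rightarrow> 'a set \<Rightarrow> 'a set \<Rightarrow> 'a \<Rightarrow> 'a \<Rightarrow> 'b" where
  "del d R C x w = (if x \<in> R \<and> w \<in> C then pm d (R - {x}) (C - {w}) else 0)"

definition del2 :: "('a \<Rightarrow> 'b::comm_ring_1) \<Rightarrow> 'a set \<Rightarrow> 'a set \<Rightarrow> 'a \<Rightarrow> 'a \<Rightarrow> 'b" where
  "del2 d R C x w =
    (if {x, w} \<subseteq> R \<and> {x, w} \<subseteq> C then pm d (R - {x, w}) (C - {x, w}) else 0)"

lemma pm_empty [simp]: "pm d {} {} = 1"
  by (simp add: pm_def)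

lemma pm_row:
  assumes "finite R" "finite C" "a \<notin> R"
  shows "pm d (insert a R) C = (if a \<in> C then d a * pm d R (C - {a}) else 0)
    + (\<Sum>c\<in>N a. if c \<in> C then pm d R (C - {c}) else 0)"
proof -
  let ?X = "\<lambda>c. pm d R (C - {c})"
  have eq: "matrix d a c * ?X c = (if c = a then d a * ?X a else 0) + (if c \<in> N a then ?X c else 0)" for c
    using irrefl by (auto simp: matrix_def)
  have "pm d (insert a R) C = (\<Sum>c\<in>C. matrix d a c * ?X c)"
    using assms by (simp add: pm_def minor_permanent_row)
  also have "\<dots> = (\<Sum>c\<in>C. if c = a then d a * ?X a else 0) + (\<Sum>c\<in>C. if c \<in> N a then ?X c else 0)"
    unfolding eq sum.distrib ..
  also have "(\<Sum>c\<in>C. if c \<in> N a then ?X c else 0) = (\<Sum>c\<in>N a. if c \<in> C then ?X c else 0)"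
    using assms finite_N by (simp add: sum.inter_restrict[symmetric] Int_commute)
  finally show ?thesis using assms by (simp add: sum.delta')
qed

lemma pm_col:
  assumes "finite R" "finite C" "a \<notin> C"
  shows "pm d R (insert a C) = (if a \<in> R then d a * pm d (R - {a}) C else 0)
    + (\<Sum>c\<in>N a. if c \<in> R then pm d (R - {c}) C else 0)"
proof -
  let ?X = "\<lambda>c. pm d (R - {c}) C"
  have eq: "matrix d c a * ?X c = (if c = a then d a * ?X a else 0) + (if c \<in> N a then ?X c else 0)" for c
    using irrefl sym by (auto simp: matrix_def)
  have "pm d R (insert a C) = (\<Sum>c\<in>R. matrix d c a * ?X c)"
    using assms by (simp add: pm_def minor_permanent_col)
  also have "\<dots> = (\<Sum>c\<in>R. if c = a then d a * ?X a else 0) + (\<Sum>c\<in>R. if c \<in> N a then ?X c else 0)"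
    unfolding eq sum.distrib ..
  also have "(\<Sum>c\<in>R. if c \<in> N a then ?X c else 0) = (\<Sum>c\<in>N a. if c \<in> R then ?X c else 0)"
    using assms finite_N by (simp add: sum.inter_restrict[symmetric] Int_commute)
  finally show ?thesis using assms by (simp add: sum.delta')
qed

text \<open>Row \<open>a\<close> takes column \<open>a\<close>, \<open>u\<close> or
  \<open>b\<close>; in the last two cases column \<open>a\<close> is in turn taken by row
  \<open>u\<close> or \<open>b\<close>.\<close>

lemma pm_vertex:
  assumes "finite R" "finite C" "a \<notin> R" "a \<notin> C" "N a = {u, b}" "u \<noteq> b"
  shows "pm d (insert a R) (insert a C) = d a * pm d R C
    + del d R C u u + del d R C u b + del d R C b u + del d R C b b"
proof -
  have ne: "u \<noteq> a" "b \<noteq> a" using irrefl[of a] assms(5) by auto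
  have dif: "insert a C - {u} = insert a (C - {u})" "insert a C - {b} = insert a (C - {b})"
    using ne by auto
  have "pm d (insert a R) (insert a C) = d a * pm d R C
    + ((if u \<in> C then pm d R (insert a (C - {u})) else 0)
    + (if b \<in> C then pm d R (insert a (C - {b})) else 0))"
    using assms ne by (simp add: pm_row dif)
  moreover have "pm d R (insert a (C - {x})) = (if u \<in> R then pm d (R - {u}) (C - {x}) else 0)
    + (if b \<in> R then pm d (R - {b}) (C - {x}) else 0)" for x
    using assms by (simp add: pm_col)
  ultimately show ?thesis by (simp add: del_def)
qed

text \<open>The terms list what a permutation can do on the thread: stay inside; transpose
  \<open>u\<close> or \<open>v\<close>, or both, with the adjacent interior vertex, which shortens
  the free part of the path by one or two; or run through the whole thread in one of the two
  directions, where all entries are 1.\<close>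

lemma pm_thread:
  assumes "thread N u as v" "as \<noteq> []" "u \<noteq> v" "distinct as" "u \<notin> set as" "v \<notin> set as"
    and "set as \<inter> R = {}" "set as \<inter> C = {}" "finite R" "finite C" "\<And>a. a \<in> set as \<Longrightarrow> d a = y"
  shows "pm d (set as \<union> R) (set as \<union> C) =
    continuant y (Suc (length as)) * pm d R C
    + continuant y (length as) * (del d R C u u + del d R C v v)
    + continuant y (length as - 1) * del2 d R C u v + del d R C u v + del d R C v u"
  using assms
proof (induction as arbitrary: u R C)
  case Nil
  then show ?case by simp
next
  case (Cons a bs)
  have a: "a \<notin> R" "a \<notin> C" "d a = y" "a \<noteq> v" "a \<noteq> u" using Cons.prems by auto
  show ?case
  proof (cases bs)
    case Nil
    then have "N a = {u, v}" using Cons.prems by simp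
    then show ?thesis
      using pm_vertex[of R C a u v d] a Cons.prems Nil by (simp add: algebra_simps)
  next
    case (Cons b bs')
    have Na: "N a = {u, b}" "u \<noteq> b" "b \<notin> R" "b \<notin> C"
      using Cons.prems unfolding Cons by auto
    obtain m where m: "length bs = Suc m" using Cons by simp
    \<comment> \<open>The vertex \<open>a\<close> joins \<open>R\<close> and \<open>C\<close> and
      becomes the end of the shorter thread. The minors that arise are then expanded at
      \<open>a\<close>, whose only possible neighbor among the remaining rows and columns is
      \<open>u\<close>.\<close>
    let ?R = "insert a R" and ?C = "insert a C"
    have "pm d (set bs \<union> ?R) (set bs \<union> ?C) =
      continuant y (Suc (length bs)) * pm d ?R ?C
      + continuant y (length bs) * (del d ?R ?C a a + del d ?R ?C v v)
      + continuant y (length bs - 1) * del2 d ?R ?C a v + del d ?R ?C a v + del d ?R ?C v a"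
      using Cons.prems a Cons by (intro Cons.IH) auto
    moreover have "del d ?R ?C a a = pm d R C" using a by (simp add: del_def)
    moreover have "pm d ?R ?C = y * pm d R C + del d R C u u"
      using pm_vertex[of R C a u b d] Na a Cons.prems by (simp add: del_def)
    moreover have "del d ?R ?C v v = y * del d R C v v + del2 d R C u v"
    proof -
      have dif: "insert a R - {v} = insert a (R - {v})" "insert a C - {v} = insert a (C - {v})"
        using a by auto
      have d2: "R - {u, v} = R - {v} - {u}" "C - {u, v} = C - {v} - {u}" by auto
      show ?thesis
        using pm_vertex[of "R - {v}" "C - {v}" a u b d] Na a Cons.prems
        by (auto simp: del_def del2_def dif d2)
    qed
    moreover have "del2 d ?R ?C a v = del d R C v v"
    proof -
      have "insert a R - {a, v} = R - {v}" "insert a C - {a, v} = C - {v}" using a by auto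
      then show ?thesis using a by (auto simp: del_def del2_def)
    qed
    moreover have "del d ?R ?C a v = del d R C u v"
    proof -
      have "insert a C - {v} = insert a (C - {v})" using a by auto
      then show ?thesis
        using pm_col[of R "C - {v}" a d] Na a Cons.prems by (auto simp: del_def)
    qed
    moreover have "del d ?R ?C v a = del d R C v u"
    proof -
      have "insert a R - {v} = insert a (R - {v})" using a by auto
      then show ?thesis
        using pm_row[of "R - {v}" C a d] Na a Cons.prems by (auto simp: del_def)
    qed
    ultimately show ?thesis using m by (simp add: algebra_simps)
  qed
qed

lemma thread_snoc:
  "thread N u (bs @ [b]) w \<Longrightarrow> thread N u bs b \<and> N b = {last (u # bs), w}"
proof (induction bs arbitrary: u)
  case Nil
  then have "N b = {u, w}" by simp
  then show ?case using sym[of u b] by simp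
next
  case (Cons a bs)
  have "hd ((bs @ [b]) @ [w]) = hd (bs @ [b])" by (cases bs) auto
  then show ?case using Cons.IH[of a] Cons.prems by simp
qed

text \<open>Both ends coincide, which \<open>pm_thread\<close> excludes; the last interior vertex
  \<open>b\<close> therefore serves as second end and is eliminated afterwards. In the coefficient
  of the minor without \<open>u\<close>, \<open>2 * continuant y (length as)\<close> stems from
  transposing \<open>u\<close> with either of its two neighbors on the cycle, and 2 from the two
  orientations of the cycle.\<close>

lemma pm_loop:
  assumes "thread N u as u" "2 \<le> length as" "distinct as" "u \<notin> set as"
    and "set as \<inter> R = {}" "finite R" "u \<in> R" "\<And>a. a \<in> set as \<Longrightarrow> d a = y"
  shows "pm d (set as \<union> R) (set as \<union> R) = continuant y (Suc (length as)) * pm d R R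
    + (2 * continuant y (length as) + 2) * pm d (R - {u}) (R - {u})"
proof -
  obtain bs b where as: "as = bs @ [b]" using assms(2) by (cases as rule: rev_cases) auto
  with assms(2) have "bs \<noteq> []" by auto
  have b: "thread N u bs b" "N b = {last bs, u}" "last bs \<noteq> u" "last bs \<notin> R"
    "last bs \<noteq> b" "b \<notin> R" "b \<noteq> u" "d b = y"
    using thread_snoc[of u bs b u] assms \<open>bs \<noteq> []\<close> unfolding as
    by (auto dest: last_in_set)
  let ?R = "insert b R" and ?S = "R - {u}"
  have uS: "insert b R - {u} = insert b ?S" "insert b R - {b} = R" "insert b R - {u, b} = ?S"
    using b by auto
  have "pm d (set bs \<union> ?R) (set bs \<union> ?R) =
    continuant y (Suc (length bs)) * pm d ?R ?R
    + continuant y (length bs) * (del d ?R ?R u u + del d ?R ?R b b)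
    + continuant y (length bs - 1) * del2 d ?R ?R u b + del d ?R ?R u b + del d ?R ?R b u"
    using assms b(1) \<open>bs \<noteq> []\<close> unfolding as by (intro pm_thread) auto
  moreover have "pm d ?R ?R = y * pm d R R + pm d ?S ?S"
    using pm_vertex[of R R b "last bs" u d] b assms(6,7) by (simp add: del_def)
  moreover have "del d ?R ?R u u = y * pm d ?S ?S"
    using pm_vertex[of ?S ?S b "last bs" u d] b assms(6,7) by (simp add: del_def uS)
  moreover have "del d ?R ?R b b = pm d R R" "del2 d ?R ?R u b = pm d ?S ?S"
    using assms(7) by (simp_all add: del_def del2_def uS)
  moreover have "del d ?R ?R u b = pm d ?S ?S"
    using pm_row[of ?S R b d] b assms(6,7) by (simp add: del_def uS)
  moreover have "del d ?R ?R b u = pm d ?S ?S"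
    using pm_col[of R ?S b d] b assms(6,7) by (simp add: del_def uS)
  moreover obtain m where "length bs = Suc m" using \<open>bs \<noteq> []\<close> by (cases bs) auto
  moreover have "set as \<union> R = set bs \<union> ?R" using as by auto
  ultimately show ?thesis using as by (simp add: algebra_simps)
qed

lemma pm_block:
  assumes "finite R1" "finite R2" "R1 \<inter> R2 = {}" "\<And>r. r \<in> R1 \<Longrightarrow> N r \<inter> R2 = {}"
  shows "pm d (R1 \<union> R2) (R1 \<union> R2) = pm d R1 R1 * pm d R2 R2"
  unfolding pm_def using assms by (intro minor_permanent_block) (auto simp: matrix_def)

end

text \<open>The arguments \<open>P\<close>, \<open>Q\<close>, \<open>R\<close> (and \<open>A\<close>, \<open>B\<close>, \<open>K\<close> below) are numbers of edges of paths and cycles;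
  \<open>z\<close> is the diagonal entry at the two vertices of degree 3.\<close>

definition theta_val :: "'b::comm_ring_1 \<Rightarrow> 'b \<Rightarrow> nat \<Rightarrow> nat \<Rightarrow> nat \<Rightarrow> 'b" where
  "theta_val y z P Q R =
    (let F = continuant y; E = (\<lambda>k. F (k - 1)); G = (\<lambda>k. F k - y * F (k - 1)) in
      z\<^sup>2 * (F P * F Q * F R)
      + 2 * z * (E P * F Q * F R + F P * E Q * F R + F P * F Q * E R)
      + (G P * F Q * F R + F P * G Q * F R + F P * F Q * G R)
      + 2 * (E P * E Q * F R + E P * F Q * E R + F P * E Q * E R)
      + 2 * (F P + F Q + F R))"

definition dumbbell_val :: "'b::comm_ring_1 \<Rightarrow> 'b \<Rightarrow> nat \<Rightarrow> nat \<Rightarrow> nat \<Rightarrow> 'b" where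
  "dumbbell_val y z A B K =
    (let F = continuant y; E = (\<lambda>k. F (k - 1)); L = (\<lambda>k. 2 * E k + 2) in
      F A * F B * (z\<^sup>2 * F K + 2 * z * E K + (F K - y * E K))
      + (F A * L B + L A * F B) * (z * F K + E K) + L A * L B * F K)"

definition cycle_val :: "'b::comm_ring_1 \<Rightarrow> nat \<Rightarrow> 'b" where
  "cycle_val y c = y * continuant y c + 2 * continuant y (c - 1) + 2"

context neighborhood
begin

text \<open>The values of these six minors after adding a thread depend only on the same six minors
  for \<open>S\<close>. So threads between the same two ends can be added one after another.\<close>

lemma pm_parallel:
  assumes "thread N u as v" "as \<noteq> []" "u \<noteq> v" "distinct as" "u \<notin> set as" "v \<notin> set as"
    and "set as \<inter> S = {}" "finite S" "u \<notin> S" "v \<notin> S" "\<And>a. a \<in> set as \<Longrightarrow> d a = y"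
  defines "F \<equiv> continuant y (Suc (length as))" and "E \<equiv> continuant y (length as)"
    and "G \<equiv> continuant y (length as - 1)"
  shows "pm d (set as \<union> S) (set as \<union> S) = F * pm d S S"
    and "pm d (insert u (set as \<union> S)) (insert u (set as \<union> S))
      = F * pm d (insert u S) (insert u S) + E * pm d S S"
    and "pm d (insert v (set as \<union> S)) (insert v (set as \<union> S))
      = F * pm d (insert v S) (insert v S) + E * pm d S S"
    and "pm d (insert u (insert v (set as \<union> S))) (insert u (insert v (set as \<union> S)))
      = F * pm d (insert u (insert v S)) (insert u (insert v S))
        + E * (pm d (insert u S) (insert u S) + pm d (insert v S) (insert v S)) + G * pm d S S
        + pm d (insert u S) (insert v S) + pm d (insert v S) (insert u S)"
    and "pm d (insert u (set as \<union> S)) (insert v (set as \<union> S))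
      = F * pm d (insert u S) (insert v S) + pm d S S"
    and "pm d (insert v (set as \<union> S)) (insert u (set as \<union> S))
      = F * pm d (insert v S) (insert u S) + pm d S S"
proof -
  have *: "pm d (set as \<union> R) (set as \<union> C) =
    F * pm d R C + E * (del d R C u u + del d R C v v)
    + G * del2 d R C u v + del d R C u v + del d R C v u"
    if "R \<subseteq> {u, v} \<union> S" "C \<subseteq> {u, v} \<union> S" for R C
    unfolding F_def E_def G_def using assms that finite_subset[OF that(1)] finite_subset[OF that(2)]
    by (intro pm_thread) auto
  have S: "insert u S - {u} = S" "insert v S - {v} = S" "insert u (insert v S) - {u} = insert v S"
    "insert u (insert v S) - {v} = insert u S" "insert u (insert v S) - {u, v} = S"
    using assms by auto
  note simps = del_def del2_def S assms(3,9,10) assms(3)[symmetric]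
  show "pm d (set as \<union> S) (set as \<union> S) = F * pm d S S"
    using *[of S S] by (auto simp: simps)
  show "pm d (insert u (set as \<union> S)) (insert u (set as \<union> S))
      = F * pm d (insert u S) (insert u S) + E * pm d S S"
    using *[of "insert u S" "insert u S"] by (auto simp: simps)
  show "pm d (insert v (set as \<union> S)) (insert v (set as \<union> S))
      = F * pm d (insert v S) (insert v S) + E * pm d S S"
    using *[of "insert v S" "insert v S"] by (auto simp: simps)
  show "pm d (insert u (insert v (set as \<union> S))) (insert u (insert v (set as \<union> S)))
      = F * pm d (insert u (insert v S)) (insert u (insert v S))
        + E * (pm d (insert u S) (insert u S) + pm d (insert v S) (insert v S)) + G * pm d S S
        + pm d (insert u S) (insert v S) + pm d (insert v S) (insert u S)"
    using *[of "insert u (insert v S)" "insert u (insert v S)"] by (auto simp: simps add.commute)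
  show "pm d (insert u (set as \<union> S)) (insert v (set as \<union> S))
      = F * pm d (insert u S) (insert v S) + pm d S S"
    using *[of "insert u S" "insert v S"] by (auto simp: simps)
  show "pm d (insert v (set as \<union> S)) (insert u (set as \<union> S))
      = F * pm d (insert v S) (insert u S) + pm d S S"
    using *[of "insert v S" "insert u S"] by (auto simp: simps)
qed

lemma pm_pair:
  assumes "u \<noteq> v"
  shows "pm d {u} {u} = d u" "pm d {u} {v} = (if v \<in> N u then 1 else 0)"
    "pm d {u, v} {u, v} = d u * d v + (if v \<in> N u then 1 else 0)"
proof -
  have 1: "pm d {u} {v} = (if v \<in> N u then 1 else 0)" if "u \<noteq> v" for u v :: 'a
  proof -
    have "pm d {u} {v} = (\<Sum>c\<in>N u. if c = v then 1 else 0)"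
      using pm_row[of "{}" "{v}" u d] that by (auto intro!: sum.cong)
    then show ?thesis using finite_N by (simp add: sum.delta)
  qed
  have 2: "pm d {u} {u} = d u" for u :: 'a
    using pm_row[of "{}" "{u}" u d] irrefl[of u] finite_N
    by (auto intro!: sum.neutral)
  have "(\<Sum>c\<in>N u. if c \<in> {u, v} then pm d {v} ({u, v} - {c}) else 0)
      = (\<Sum>c\<in>N u. if c = v then pm d {v} {u} else 0)"
    using irrefl assms by (intro sum.cong) (auto simp: insert_Diff_if)
  also have "\<dots> = (if v \<in> N u then 1 else 0)"
    using finite_N 1[of v u] assms sym[of v u] by (simp add: sum.delta)
  moreover have "{u, v} - {u} = {v}" using assms by auto
  ultimately show "pm d {u, v} {u, v} = d u * d v + (if v \<in> N u then 1 else 0)"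
    using pm_row[of "{v}" "{u, v}" u d] assms 2 by simp
  show "pm d {u} {u} = d u" "pm d {u} {v} = (if v \<in> N u then 1 else 0)"
    using 1 2 assms by auto
qed

text \<open>A single path supplies the starting values for \<open>pm_parallel\<close>. For a
  nonempty thread \<open>F - y * E\<close> is the continuant two steps below \<open>F\<close>; for
  the empty one it is 1 and accounts for the transposition of \<open>u\<close> and \<open>v\<close>
  along their edge. This lets the edge \<open>uv\<close> count as a path of length 1.\<close>

lemma pm_path:
  assumes "thread N u as v" "u \<noteq> v" "distinct as" "u \<notin> set as" "v \<notin> set as"
    and "as = [] \<or> v \<notin> N u" "\<And>a. a \<in> set as \<Longrightarrow> d a = y" "d u = z" "d v = z"
  defines "F \<equiv> continuant y (Suc (length as))" and "E \<equiv> continuant y (length as)"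
  shows "pm d (set as) (set as) = F"
    and "pm d (insert u (set as)) (insert u (set as)) = z * F + E"
    and "pm d (insert v (set as)) (insert v (set as)) = z * F + E"
    and "pm d (insert u (insert v (set as))) (insert u (insert v (set as)))
      = z\<^sup>2 * F + 2 * z * E + (F - y * E)"
    and "pm d (insert u (set as)) (insert v (set as)) = 1"
    and "pm d (insert v (set as)) (insert u (set as)) = 1"
proof -
  have N: "u \<in> N v \<longleftrightarrow> v \<in> N u" using sym by blast
  have G: "continuant y (length as - Suc 0) = F - y * E" if "as \<noteq> []"
    using that unfolding F_def E_def by (cases as) auto
  note pair = pm_pair[OF assms(2), of d] pm_pair[OF assms(2)[symmetric], of d]
  have ins: "{v, u} = {u, v}" by auto
  note par = pm_parallel[of u as v "{}" d y, folded F_def E_def]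
  show "pm d (set as) (set as) = F"
    using par(1) assms by (cases "as = []") auto
  show "pm d (insert u (set as)) (insert u (set as)) = z * F + E"
    using par(2) assms pair by (cases "as = []") auto
  show "pm d (insert v (set as)) (insert v (set as)) = z * F + E"
    using par(3) assms pair by (cases "as = []") auto
  show "pm d (insert u (set as)) (insert v (set as)) = 1"
    using par(5) assms pair by (cases "as = []") auto
  show "pm d (insert v (set as)) (insert u (set as)) = 1"
    using par(6) assms pair N by (cases "as = []") auto
  show "pm d (insert u (insert v (set as))) (insert u (insert v (set as)))
      = z\<^sup>2 * F + 2 * z * E + (F - y * E)"
    using par(4) G assms pair N by (cases "as = []") (auto simp: power2_eq_square algebra_simps)
qed

lemma pm_theta:
  assumes "thread N u ps v" "thread N u qs v" "thread N u rs v"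
    and "distinct (u # v # ps @ qs @ rs)" "qs \<noteq> []" "rs \<noteq> []" "ps = [] \<or> v \<notin> N u"
    and "\<And>a. a \<in> set (ps @ qs @ rs) \<Longrightarrow> d a = y" "d u = z" "d v = z"
  shows "pm d (set (u # v # ps @ qs @ rs)) (set (u # v # ps @ qs @ rs))
    = theta_val y z (Suc (length ps)) (Suc (length qs)) (Suc (length rs))"
proof -
  let ?S = "set qs \<union> set ps"
  have 1: "set (u # v # ps @ qs @ rs) = insert u (insert v (set rs \<union> ?S))" by auto
  have G: "continuant y (length as - Suc 0) = continuant y (Suc (length as)) - y * continuant y (length as)"
    if "as \<noteq> []" for as :: "'a list" using that by (cases as) auto
  have fin: "finite (set ps)" "finite ?S" by auto
  have disj: "u \<noteq> v" "distinct ps" "u \<notin> set ps" "v \<notin> set ps" "distinct qs" "u \<notin> set qs" "v \<notin> set qs"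
    "distinct rs" "u \<notin> set rs" "v \<notin> set rs" "set qs \<inter> set ps = {}" "set rs \<inter> ?S = {}"
    "u \<notin> ?S" "v \<notin> ?S"
    using assms(4) by auto
  have d: "\<And>a. a \<in> set ps \<Longrightarrow> d a = y" "\<And>a. a \<in> set qs \<Longrightarrow> d a = y" "\<And>a. a \<in> set rs \<Longrightarrow> d a = y"
    using assms(8) by auto
  \<comment> \<open>\<open>ps\<close> is the path that may be the single edge \<open>uv\<close>, so
    it provides the starting values; the nonempty threads \<open>qs\<close> and \<open>rs\<close>
    are then added in parallel.\<close>
  note path = pm_path[OF assms(1) disj(1-4) assms(7) d(1) assms(9,10)]
  note q = pm_parallel[OF assms(2,5) disj(1,5-7,11) fin(1) disj(3,4) d(2)]
  note r = pm_parallel[OF assms(3,6) disj(1,8-10,12) fin(2) disj(13,14) d(3)]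
  show ?thesis unfolding 1 theta_val_def Let_def
    by (simp add: path q r G[OF assms(5)] G[OF assms(6)] power2_eq_square algebra_simps)
qed

lemma pm_dumbbell:
  assumes "thread N u ks v" "thread N u as u" "thread N v bs v"
    and "distinct (u # v # ks @ as @ bs)" "2 \<le> length as" "2 \<le> length bs" "ks = [] \<or> v \<notin> N u"
    and "\<And>a. a \<in> set (ks @ as @ bs) \<Longrightarrow> d a = y" "d u = z" "d v = z"
  shows "pm d (set (u # v # ks @ as @ bs)) (set (u # v # ks @ as @ bs))
    = dumbbell_val y z (Suc (length as)) (Suc (length bs)) (Suc (length ks))"
proof -
  let ?K = "insert u (insert v (set ks))"
  have 1: "set (u # v # ks @ as @ bs) = set bs \<union> (set as \<union> ?K)" by auto
  have 2: "(set as \<union> ?K) - {v} = set as \<union> insert u (set ks)" "?K - {u} = insert v (set ks)"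
    "insert u (set ks) - {u} = set ks"
    using assms(4) by auto
  note path = pm_path[of u ks v d y z]
  have "pm d (set bs \<union> (set as \<union> ?K)) (set bs \<union> (set as \<union> ?K)) =
      continuant y (Suc (length bs)) * pm d (set as \<union> ?K) (set as \<union> ?K)
    + (2 * continuant y (length bs) + 2) * pm d (set as \<union> ?K - {v}) (set as \<union> ?K - {v})"
    using assms by (intro pm_loop) auto
  moreover have "pm d (set as \<union> ?K) (set as \<union> ?K) =
      continuant y (Suc (length as)) * pm d ?K ?K
    + (2 * continuant y (length as) + 2) * pm d (?K - {u}) (?K - {u})"
    using assms by (intro pm_loop) auto
  moreover have "pm d (set as \<union> insert u (set ks)) (set as \<union> insert u (set ks)) =
      continuant y (Suc (length as)) * pm d (insert u (set ks)) (insert u (set ks))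
    + (2 * continuant y (length as) + 2) * pm d (insert u (set ks) - {u}) (insert u (set ks) - {u})"
    using assms by (intro pm_loop) auto
  ultimately show ?thesis unfolding 1 dumbbell_val_def Let_def 2 using assms
    by (simp add: path power2_eq_square algebra_simps)
qed

lemma pm_cycle:
  assumes "thread N x as x" "distinct (x # as)" "2 \<le> length as" "\<And>a. a \<in> set (x # as) \<Longrightarrow> d a = y"
  shows "pm d (set (x # as)) (set (x # as)) = cycle_val y (Suc (length as))"
proof -
  have 1: "set (x # as) = set as \<union> {x}" by auto
  have "pm d {x} {x} = y" using assms(4) pm_row[of "{}" "{x}" x d] irrefl[of x] finite_N
    by (auto intro!: sum.neutral)
  then show ?thesis using pm_loop[of x as "{x}" d y] assms
    by (simp add: 1 cycle_val_def algebra_simps)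
qed

end

section \<open>Graphs with two vertices of degree 3 and all others of degree 2\<close>

definition is_theta :: "('a \<Rightarrow> 'a set) \<Rightarrow> 'a \<Rightarrow> 'a \<Rightarrow> 'a list \<Rightarrow> 'a list \<Rightarrow> 'a list \<Rightarrow> bool" where
  "is_theta N u v ps qs rs \<longleftrightarrow> distinct (u # v # ps @ qs @ rs)
    \<and> thread N u ps v \<and> thread N u qs v \<and> thread N u rs v
    \<and> N u = {hd (ps @ [v]), hd (qs @ [v]), hd (rs @ [v])}
    \<and> N v = {last (u # ps), last (u # qs), last (u # rs)}
    \<and> \<not> (ps = [] \<and> qs = []) \<and> \<not> (ps = [] \<and> rs = []) \<and> \<not> (qs = [] \<and> rs = [])"

text \<open>\<open>ks\<close> joins the two cycles, \<open>as\<close> and \<open>bs\<close> close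
  them up at \<open>u\<close> and \<open>v\<close>. Dumbbells enter only through their permanents,
  whereas \<open>is_theta\<close> fixes all neighborhoods, since an isomorphism is built from
  it.\<close>

definition is_dumbbell :: "('a \<Rightarrow> 'a set) \<Rightarrow> 'a \<Rightarrow> 'a \<Rightarrow> 'a list \<Rightarrow> 'a list \<Rightarrow> 'a list \<Rightarrow> bool" where
  "is_dumbbell N u v as bs ks \<longleftrightarrow> distinct (u # v # ks @ as @ bs)
    \<and> thread N u ks v \<and> thread N u as u \<and> thread N v bs v \<and> 2 \<le> length as \<and> 2 \<le> length bs
    \<and> (ks = [] \<or> v \<notin> N u)"

lemma thread_end:
  "thread N u as v \<Longrightarrow> a \<in> set as \<Longrightarrow> x \<in> N a \<Longrightarrow> x \<notin> set as \<Longrightarrow>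
    x = u \<and> a = hd as \<or> x = v \<and> a = last as"
proof (induction as arbitrary: u)
  case (Cons b bs)
  then show ?case by (cases bs) auto
qed simp

context neighborhood
begin

lemma thread_ends:
  assumes "thread N u as v"
  shows "last (u # as) \<in> N v" "hd (as @ [v]) \<in> N u"
proof -
  show "last (u # as) \<in> N v"
    using assms thread_snoc[of u "butlast as" "last as" v] sym by (cases "as = []") auto
  show "hd (as @ [v]) \<in> N u"
    using assms sym by (cases as) auto
qed

lemma thread_loop:
  assumes "thread N u as u" "distinct as" "\<And>a. a \<in> set as \<Longrightarrow> card (N a) = 2"
  shows "2 \<le> length as" "hd as \<noteq> last as"
proof -
  obtain a b bs where "as = a # b # bs"
    using assms irrefl[of u] by (cases as; cases "tl as") auto
  then show "2 \<le> length as" "hd as \<noteq> last as" using assms(2) by (auto dest: last_in_set)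
qed

lemma walk:
  assumes "finite I" "x \<notin> I" "a \<in> N x" "\<And>i. i \<in> I \<Longrightarrow> card (N i) = 2"
  obtains as w where "thread N x as w" "distinct as" "set as \<subseteq> I" "w \<notin> I" "hd (as @ [w]) = a"
proof -
  have "\<exists>as w. thread N x as w \<and> distinct as \<and> set as \<subseteq> I \<and> w \<notin> I \<and> hd (as @ [w]) = a"
    using assms
  proof (induction I arbitrary: x a rule: finite_psubset_induct)
    case (psubset I)
    show ?case
    proof (cases "a \<in> I")
      case False
      then have "thread N x [] a" using psubset.prems by simp
      then show ?thesis using False by (intro exI[of _ "[]"] exI[of _ a]) simp
    next
      case True
      have "x \<in> N a" "card (N a) = 2" using sym psubset.prems True by auto
      then obtain b where b: "N a = {x, b}" "b \<noteq> x"
        by (metis card_2_iff insert_iff insert_commute singletonD)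
      have "I - {a} \<subset> I" "b \<in> N a" using True b by auto
      then obtain as w where as: "thread N a as w" "distinct as" "set as \<subseteq> I - {a}"
        "w \<notin> I - {a}" "hd (as @ [w]) = b"
        using psubset.IH[of "I - {a}" a b] psubset.prems by blast
      \<comment> \<open>A walk returning to \<open>a\<close> would arrive from a neighbor of
        \<open>a\<close> other than \<open>b\<close>, hence from \<open>x\<close>, which lies
        outside \<open>I\<close>.\<close>
      have "w \<noteq> a"
      proof
        assume "w = a"
        then have loop: "2 \<le> length as" "hd as \<noteq> last as"
          using thread_loop[of a as] as psubset.prems by auto
        then have "as \<noteq> []" by auto
        then have "last as \<in> N a" "last as \<in> I"
          using thread_ends(1)[OF as(1)] \<open>w = a\<close> as(3) by (auto dest: last_in_set)
        then show False using loop as(5) b psubset.prems(1) by (cases as) auto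
      qed
      then have "thread N x (a # as) w \<and> distinct (a # as) \<and> set (a # as) \<subseteq> I \<and> w \<notin> I
          \<and> hd ((a # as) @ [w]) = a"
        using as b True by auto
      then show ?thesis by blast
    qed
  qed
  then show ?thesis using that by blast
qed

end

locale cubic_pair = neighborhood +
  fixes V :: "'a set" and u v :: 'a
  assumes finite_V: "finite V" and N_V: "\<And>x. x \<in> V \<Longrightarrow> N x \<subseteq> V"
    and uv: "u \<in> V" "v \<in> V" "u \<noteq> v" "card (N u) = 3" "card (N v) = 3"
    and deg2: "\<And>x. x \<in> V - {u, v} \<Longrightarrow> card (N x) = 2"
begin

text \<open>\<open>U\<close> is a union of interiors of threads found so far; none of its vertices can be entered
  from outside \<open>U \<union> {u, v}\<close>.\<close>

lemma walk_avoiding: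
  assumes x: "x \<in> {u, v}" "a \<in> N x" "a \<notin> U" "U \<subseteq> V - {u, v}"
    and closed: "\<And>y. y \<in> U \<Longrightarrow> N y \<subseteq> U \<union> {u, v}"
  shows "\<exists>as w. thread N x as w \<and> distinct as \<and> set as \<subseteq> V - {u, v} - U \<and> w \<in> {u, v}
    \<and> hd (as @ [w]) = a"
proof -
  let ?I = "V - {u, v} - U"
  obtain as w where as: "thread N x as w" "distinct as" "set as \<subseteq> ?I" "w \<notin> ?I" "hd (as @ [w]) = a"
    using walk[of ?I x a thesis] x finite_V deg2 by auto
  have l: "last (x # as) \<in> N w" using thread_ends(1)[OF as(1)] .
  have "last (x # as) \<in> V" using as(3) x(1) uv by (cases "as = []") (auto dest!: last_in_set)
  then have "w \<in> V" using N_V sym[OF l] by blast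
  moreover have "w \<notin> U"
  proof
    assume "w \<in> U"
    then have "as \<noteq> []" using as(5) x(3) by auto
    then have "last as \<in> ?I" using as(3) last_in_set by blast
    then show False using closed[OF \<open>w \<in> U\<close>] l \<open>as \<noteq> []\<close> by auto
  qed
  ultimately have "w \<in> {u, v}" using as(4) by auto
  then show ?thesis using as by blast
qed

lemma uv_in: "u \<in> {u, v}" "v \<in> {u, v}"
  by simp_all

lemma closed_thread:
  assumes "thread N x as w" "x \<in> {u, v}" "w \<in> {u, v}" "y \<in> set as"
  shows "N y \<subseteq> set as \<union> {u, v}"
  using thread_end[OF assms(1,4)] assms(2,3) by blast

text \<open>A thread that returns to \<open>u\<close> occupies two of its three neighbors, so the
  walk through the third neighbor cannot return as well and must end at \<open>v\<close>.\<close>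

lemma connecting_thread:
  obtains ks where "thread N u ks v" "distinct ks" "set ks \<subseteq> V - {u, v}"
proof -
  have "N u \<noteq> {}" using uv by auto
  then obtain a where a: "a \<in> N u" by blast
  obtain as w where as: "thread N u as w" "distinct as" "set as \<subseteq> V - {u, v} - {}" "w \<in> {u, v}"
    "hd (as @ [w]) = a"
    using walk_avoiding[OF uv_in(1) a, of "{}"] by auto
  show ?thesis
  proof (cases "w = v")
    case True
    then show ?thesis using that as by auto
  next
    case False
    then have w: "w = u" using as by auto
    have loop: "2 \<le> length as" "hd as \<noteq> last as"
      using thread_loop[of u as] as w deg2 by auto
    then have "as \<noteq> []" by auto
    then have l: "last as \<in> N u" "hd as \<in> N u" using thread_ends[OF as(1)] w by auto
    have "card (N u - {hd as, last as}) = 1"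
      using uv l loop finite_N by (subst card_Diff_subset) auto
    then obtain c where c: "N u - {hd as, last as} = {c}" by (auto simp: card_1_singleton_iff)
    have u: "u \<notin> set as" using as by auto
    have c_out: "c \<notin> set as"
      using thread_end[OF as(1)] sym[of c u] c u w by blast
    have c_in: "c \<in> N u" using c by blast
    have sub: "set as \<subseteq> V - {u, v}" using as by simp
    obtain cs w' where cs: "thread N u cs w'" "distinct cs" "set cs \<subseteq> V - {u, v} - set as"
      "w' \<in> {u, v}" "hd (cs @ [w']) = c"
      using walk_avoiding[OF uv_in(1) c_in c_out sub closed_thread[OF as(1) uv_in(1) as(4)]] by blast
    have "w' \<noteq> u"
    proof
      assume "w' = u"
      then have l: "2 \<le> length cs" "hd cs \<noteq> last cs"
        using thread_loop[of u cs] cs deg2 by auto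
      then have ne: "cs \<noteq> []" by auto
      then have "last cs \<in> N u" using thread_ends(1)[OF cs(1)] \<open>w' = u\<close> by auto
      moreover have "last cs \<notin> set as" using cs(3) last_in_set[OF ne] by blast
      moreover have "hd as \<in> set as" "last as \<in> set as" using \<open>as \<noteq> []\<close> by auto
      ultimately have "last cs \<in> N u - {hd as, last as}" by (metis Diff_iff empty_iff insert_iff)
      then have "last cs = c" using c by simp
      moreover have "hd cs = c" using cs(5) ne by simp
      ultimately show False using l by simp
    qed
    then show ?thesis using that cs by auto
  qed
qed

lemma card3_eq:
  assumes "finite A" "card A = 3" "a \<in> A" "b \<in> A" "c \<in> A" "a \<noteq> b" "a \<noteq> c" "b \<noteq> c"
  shows "A = {a, b, c}"
  using assms card_subset_eq[of A "{a, b, c}"] by auto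

theorem theta_or_dumbbell:
  "(\<exists>ps qs rs. is_theta N u v ps qs rs \<and> set (u # v # ps @ qs @ rs) \<subseteq> V
      \<and> (\<forall>x\<in>set (u # v # ps @ qs @ rs). N x \<subseteq> set (u # v # ps @ qs @ rs)))
   \<or> (\<exists>as bs ks. is_dumbbell N u v as bs ks \<and> set (u # v # ks @ as @ bs) \<subseteq> V
      \<and> (\<forall>x\<in>set (u # v # ks @ as @ bs). N x \<subseteq> set (u # v # ks @ as @ bs)))"
proof -
  obtain ks where ks: "thread N u ks v" "distinct ks" "set ks \<subseteq> V - {u, v}"
    using connecting_thread .
  define e where "e = hd (ks @ [v])"
  have e: "e \<in> N u" using thread_ends(2)[OF ks(1)] by (simp add: e_def)
  have "card (N u - {e}) = 2" using uv e finite_N by simp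
  then obtain b c where bc: "N u - {e} = {b, c}" "b \<noteq> c" by (auto simp: card_2_iff)
  have Nu: "N u = {e, b, c}" "e \<noteq> b" "e \<noteq> c" using bc e by auto
  have e_in: "e \<in> insert v (set ks)" by (cases ks) (auto simp: e_def)
  have out: "x \<notin> set ks" if "x \<in> N u" "x \<noteq> e" for x
  proof
    assume "x \<in> set ks"
    then have "x = hd ks" using thread_end[OF ks(1) _ sym[OF that(1)]] ks(3) uv by auto
    then show False using that \<open>x \<in> set ks\<close> by (cases ks) (auto simp: e_def)
  qed
  have b_in: "b \<in> N u" and b_out: "b \<notin> set ks" and c_in: "c \<in> N u" and c_out: "c \<notin> set ks"
    using Nu out by auto
  obtain as w where as: "thread N u as w" "distinct as" "set as \<subseteq> V - {u, v} - set ks"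
    "w \<in> {u, v}" "hd (as @ [w]) = b"
    using walk_avoiding[OF uv_in(1) b_in b_out ks(3) closed_thread[OF ks(1) uv_in]] by blast
  have closed: "N y \<subseteq> set ks \<union> set as \<union> {u, v}" if "y \<in> set ks \<union> set as" for y
    using that closed_thread[OF ks(1) uv_in, of y] closed_thread[OF as(1) uv_in(1) as(4), of y] by blast
  have sub: "set ks \<union> set as \<subseteq> V - {u, v}" using ks(3) as(3) by blast
  \<comment> \<open>With \<open>ks\<close> fixed, the walk from \<open>u\<close> through a second
    neighbor \<open>b\<close> decides: ending at \<open>v\<close> it yields a theta graph, returning
    to \<open>u\<close> a dumbbell.\<close>
  show ?thesis
  proof (cases "w = v")
    case True
    have b_as: "b \<in> insert v (set as)" using as(5) True by (cases as) auto
    have "c \<notin> set as"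
    proof
      assume "c \<in> set as"
      then have "c = hd as" using thread_end[OF as(1) _ sym[of c u]] as(3) uv Nu True by auto
      then show False using as(5) \<open>c \<in> set as\<close> bc(2) by (cases as) auto
    qed
    then have c_out': "c \<notin> set ks \<union> set as" using c_out by simp
    obtain cs w' where cs: "thread N u cs w'" "distinct cs"
      "set cs \<subseteq> V - {u, v} - (set ks \<union> set as)" "w' \<in> {u, v}" "hd (cs @ [w']) = c"
      using walk_avoiding[OF uv_in(1) c_in c_out' sub closed] by blast
    \<comment> \<open>The neighbors of \<open>u\<close> other than \<open>c\<close> lie on
      \<open>ks\<close> or \<open>as\<close>, or equal \<open>v\<close>, so this walk has no vertex
      through which it could come back to \<open>u\<close>.\<close>
    have "w' \<noteq> u"
    proof
      assume "w' = u"
      then have l: "2 \<le> length cs" "hd cs \<noteq> last cs"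
        using thread_loop[of u cs] cs deg2 by auto
      then have ne: "cs \<noteq> []" by auto
      then have "last cs \<in> N u" using thread_ends(1)[OF cs(1)] \<open>w' = u\<close> by auto
      moreover have "hd cs = c" "last cs \<in> set cs" using cs ne by auto
      ultimately show False using Nu l e_in b_as cs(3) by auto
    qed
    then have w': "w' = v" using cs by auto
    have hds: "hd (ks @ [v]) = e" "hd (as @ [v]) = b" "hd (cs @ [v]) = c"
      using as cs True w' by (auto simp: e_def)
    have dist: "distinct (u # v # ks @ as @ cs)" using ks as cs uv by auto
    have ne: "\<not> (ks = [] \<and> as = [])" "\<not> (ks = [] \<and> cs = [])" "\<not> (as = [] \<and> cs = [])"
      using hds Nu bc by auto
    have "N v = {last (u # ks), last (u # as), last (u # cs)}"
    proof (rule card3_eq)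
      have last: "ks \<noteq> [] \<Longrightarrow> last ks \<in> set ks" "as \<noteq> [] \<Longrightarrow> last as \<in> set as"
        "cs \<noteq> [] \<Longrightarrow> last cs \<in> set cs" by simp_all
      have disj: "set ks \<inter> set as = {}" "set ks \<inter> set cs = {}" "set as \<inter> set cs = {}"
        "u \<notin> set ks" "u \<notin> set as" "u \<notin> set cs" using dist by auto
      show "last (u # ks) \<noteq> last (u # as)" using ne(1) disj last
        by (metis disjoint_iff last_ConsL last_ConsR)
      show "last (u # ks) \<noteq> last (u # cs)" using ne(2) disj last
        by (metis disjoint_iff last_ConsL last_ConsR)
      show "last (u # as) \<noteq> last (u # cs)" using ne(3) disj last
        by (metis disjoint_iff last_ConsL last_ConsR)
    qed (use finite_N uv thread_ends(1) ks(1) as(1) cs(1) True w' in auto)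
    then have th: "is_theta N u v ks as cs"
      using ks as cs True w' hds Nu dist ne by (simp add: is_theta_def)
    have cl: "N x \<subseteq> set (u # v # ks @ as @ cs)" if "x \<in> set (u # v # ks @ as @ cs)" for x
    proof -
      have "N u \<subseteq> set (u # v # ks @ as @ cs)"
        using Nu e_in b_as cs(5) w' by (cases cs) auto
      moreover have "N v \<subseteq> set (u # v # ks @ as @ cs)"
        using \<open>N v = _\<close> by (auto dest: last_in_set)
      moreover have "N x \<subseteq> set cs \<union> {u, v}" if "x \<in> set cs"
        using closed_thread[OF cs(1) _ _ that] w' by auto
      ultimately show ?thesis using that closed[of x] by auto
    qed
    have "set (u # v # ks @ as @ cs) \<subseteq> V" using ks(3) as(3) cs(3) uv by auto
    then show ?thesis using th cl
      by (intro disjI1 exI[of _ ks] exI[of _ as] exI[of _ cs] conjI ballI)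
  next
    case False
    then have w: "w = u" using as by auto
    have loop: "2 \<le> length as" "hd as \<noteq> last as"
      using thread_loop[of u as] as w deg2 by auto
    then have ne: "as \<noteq> []" by auto
    then have "hd as = b" "last as \<in> N u" "last as \<in> set as" "hd as \<in> set as"
      using thread_ends[OF as(1)] as(5) w by auto
    then have Nu': "N u = {e, hd as, last as}" "last as = c"
      using Nu loop e_in as(3) by auto
    define f where "f = last (u # ks)"
    have f: "f \<in> N v" using thread_ends(1)[OF ks(1)] by (simp add: f_def)
    have "card (N v - {f}) = 2" using uv f finite_N by simp
    then obtain b' c' where bc': "N v - {f} = {b', c'}" "b' \<noteq> c'" by (auto simp: card_2_iff)
    have b': "b' \<in> N v" "b' \<noteq> f" using bc' by auto
    have "b' \<noteq> u"
    proof
      assume "b' = u"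
      then have "v \<in> N u" using sym[OF b'(1)] by simp
      then have "v = e" using Nu' as(3) \<open>hd as \<in> set as\<close> \<open>last as \<in> set as\<close> by auto
      then have "ks = []" using ks(3) by (cases ks) (auto simp: e_def)
      then show False using b' \<open>b' = u\<close> by (simp add: f_def)
    qed
    have "b' \<notin> set ks"
    proof
      assume "b' \<in> set ks"
      then have "b' = last ks" using thread_end[OF ks(1) _ sym[OF b'(1)]] ks(3) uv by auto
      then show False using b' \<open>b' \<in> set ks\<close> by (auto simp: f_def split: if_splits)
    qed
    moreover have "b' \<notin> set as"
      using thread_end[OF as(1) _ sym[OF b'(1)]] as(3) w uv by auto
    ultimately have b'_out: "b' \<notin> set ks \<union> set as" by simp
    obtain bs w' where bs: "thread N v bs w'" "distinct bs"
      "set bs \<subseteq> V - {u, v} - (set ks \<union> set as)" "w' \<in> {u, v}" "hd (bs @ [w']) = b'"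
      using walk_avoiding[OF uv_in(2) b'(1) b'_out sub closed] by blast
    have "w' \<noteq> u"
    proof
      assume "w' = u"
      then have ne: "bs \<noteq> []" using bs(5) \<open>b' \<noteq> u\<close> by auto
      then have "last bs \<in> N u" "last bs \<in> set bs"
        using thread_ends(1)[OF bs(1)] \<open>w' = u\<close> by auto
      then show False
        using Nu' e_in bs(3) \<open>last as \<in> set as\<close> \<open>hd as \<in> set as\<close> by auto
    qed
    then have w': "w' = v" using bs by auto
    have loop': "2 \<le> length bs" "hd bs \<noteq> last bs"
      using thread_loop[of v bs] bs w' deg2 by auto
    then have "bs \<noteq> []" by auto
    then have "hd bs \<in> N v" "last bs \<in> N v" "hd bs \<in> set bs" "last bs \<in> set bs"
      using thread_ends[OF bs(1)] w' by auto
    moreover have f_in: "f \<in> insert u (set ks)" by (auto simp: f_def)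
    moreover have "f \<notin> set bs" using calculation(5) bs(3) by auto
    ultimately have Nv: "N v = {f, hd bs, last bs}"
      using f loop' uv finite_N by (intro card3_eq) auto
    have "ks = [] \<or> v \<notin> N u"
      using Nu' as(3) ks(3) \<open>last as \<in> set as\<close> \<open>hd as \<in> set as\<close> e_in by (cases ks) (auto simp: e_def)
    then have db: "is_dumbbell N u v as bs ks"
      using ks as bs w w' uv loop loop' by (auto simp: is_dumbbell_def)
    have cl: "N x \<subseteq> set (u # v # ks @ as @ bs)" if "x \<in> set (u # v # ks @ as @ bs)" for x
    proof -
      have "N u \<subseteq> set (u # v # ks @ as @ bs)"
        using Nu' e_in \<open>last as \<in> set as\<close> \<open>hd as \<in> set as\<close> by auto
      moreover have "N v \<subseteq> set (u # v # ks @ as @ bs)"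
        using Nv f_in \<open>hd bs \<in> set bs\<close> \<open>last bs \<in> set bs\<close> by auto
      moreover have "N x \<subseteq> set bs \<union> {u, v}" if "x \<in> set bs"
        using closed_thread[OF bs(1) _ _ that] w' by auto
      ultimately show ?thesis using that closed[of x] by auto
    qed
    have "set (u # v # ks @ as @ bs) \<subseteq> V" using ks(3) as(3) bs(3) uv by auto
    then show ?thesis using db cl
      by (intro disjI2 exI[of _ ks] exI[of _ as] exI[of _ bs] conjI ballI)
  qed
qed

end

context neighborhood
begin

text \<open>A walk from any vertex \<open>x\<close> stops only on returning to \<open>x\<close>. The
  cycle found in this way is closed under neighbors, so the permanent splits off one cycle at a
  time.\<close>

lemma pm_two_regular:
  assumes "finite V" "\<And>x. x \<in> V \<Longrightarrow> N x \<subseteq> V" "\<And>x. x \<in> V \<Longrightarrow> card (N x) = 2"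
    and "\<And>x. x \<in> V \<Longrightarrow> d x = y"
  shows "\<exists>cs. (\<forall>c\<in>set cs. 3 \<le> c) \<and> sum_list cs = card V
    \<and> pm d V V = prod_list (map (cycle_val y) cs)"
  using assms
proof (induction V rule: finite_psubset_induct)
  case (psubset V)
  show ?case
  proof (cases "V = {}")
    case True
    then show ?thesis by (intro exI[of _ "[]"]) simp
  next
    case False
    then obtain x where x: "x \<in> V" by blast
    then have "N x \<noteq> {}" using psubset.prems(2)[of x] by auto
    then obtain a where a: "a \<in> N x" by blast
    obtain as w where as: "thread N x as w" "distinct as" "set as \<subseteq> V - {x}" "w \<notin> V - {x}"
      using walk[of "V - {x}" x a thesis] psubset.hyps psubset.prems(2) a by auto
    have "last (x # as) \<in> V" using as(3) x by (cases "as = []") (auto dest!: last_in_set)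
    then have "w \<in> V" using psubset.prems(1) sym[OF thread_ends(1)[OF as(1)]] by blast
    then have w: "w = x" using as by auto
    have loop: "2 \<le> length as" "hd as \<noteq> last as"
      using thread_loop[of x as] as w psubset.prems by auto
    let ?C = "set (x # as)"
    have "as \<noteq> []" using loop by auto
    then have ends: "hd as \<in> N x" "last as \<in> N x" "hd as \<in> set as" "last as \<in> set as"
      using thread_ends[OF as(1)] w by auto
    then have "N x = {hd as, last as}"
      using loop psubset.prems(2)[OF x] finite_N card_subset_eq[of "N x" "{hd as, last as}"] by auto
    then have closed: "N y \<subseteq> ?C" if "y \<in> ?C" for y
      using that ends thread_end[OF as(1), of y] w by auto
    have C: "?C \<subseteq> V" using as x by auto
    have "N y \<subseteq> V - ?C" if "y \<in> V - ?C" for y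
      using that psubset.prems(1)[of y] closed sym by blast
    moreover have "V - ?C \<subset> V" using x by auto
    ultimately obtain cs where cs: "\<forall>c\<in>set cs. 3 \<le> c" "sum_list cs = card (V - ?C)"
      "pm d (V - ?C) (V - ?C) = prod_list (map (cycle_val y) cs)"
      using psubset.IH[of "V - ?C"] psubset.prems by blast
    have "pm d (?C \<union> (V - ?C)) (?C \<union> (V - ?C)) = pm d ?C ?C * pm d (V - ?C) (V - ?C)"
      using psubset.hyps closed by (intro pm_block) auto
    moreover have "?C \<union> (V - ?C) = V" using C by auto
    moreover have "pm d ?C ?C = cycle_val y (Suc (length as))"
      using as w loop psubset.prems C by (intro pm_cycle) auto
    moreover have "card ?C = Suc (length as)" using as by (subst distinct_card) auto
    moreover have "card V = card ?C + card (V - ?C)"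
      using C psubset.hyps card_mono[OF psubset.hyps C] by (simp add: card_Diff_subset)
    ultimately show ?thesis using cs loop by (intro exI[of _ "Suc (length as) # cs"]) auto
  qed
qed

end

section \<open>Coefficients at low powers of \<open>y\<close>\<close>

text \<open>The explicit values occur as polynomials in \<open>x\<close>, as polynomials in
  \<open>y\<close>, and at real points. Being built from ring operations, they commute with all the
  homomorphisms between these rings.\<close>

locale unital_ring_hom =
  fixes h :: "'a::comm_ring_1 \<Rightarrow> 'b::comm_ring_1"
  assumes hom_add: "h (x + y) = h x + h y" and hom_mult: "h (x * y) = h x * h y"
    and hom_one: "h 1 = 1"
begin

lemma hom_zero: "h 0 = 0"
  using hom_add[of 0 0] by simp

lemma hom_uminus: "h (- x) = - h x"
  using hom_add[of x "- x"] hom_zero by (simp add: eq_neg_iff_add_eq_0 add.commute)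

lemma hom_diff: "h (x - y) = h x - h y"
  using hom_add[of x "- y"] hom_uminus by simp

lemma hom_two: "h 2 = 2"
  using hom_add[of 1 1] by (simp add: hom_one)

lemma hom_power2: "h (x\<^sup>2) = (h x)\<^sup>2"
  by (simp add: power2_eq_square hom_mult)

lemmas hom_simps = hom_add hom_mult hom_one hom_zero hom_uminus hom_diff hom_two hom_power2

lemma hom_continuant: "h (continuant y k) = continuant (h y) k"
  by (induction k rule: induct_nat_012) (auto simp: hom_simps)

lemma hom_theta_val: "h (theta_val y z P Q R) = theta_val (h y) (h z) P Q R"
  by (simp add: theta_val_def Let_def hom_simps hom_continuant)

lemma hom_dumbbell_val: "h (dumbbell_val y z A B K) = dumbbell_val (h y) (h z) A B K"
  by (simp add: dumbbell_val_def Let_def hom_simps hom_continuant)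

lemma hom_cycle_val: "h (cycle_val y c) = cycle_val (h y) c"
  unfolding cycle_val_def by (simp only: hom_simps hom_continuant)

lemma hom_cycle_vals:
  "h (prod_list (map (cycle_val y) cs)) = prod_list (map (cycle_val (h y)) cs)"
  by (induction cs) (auto simp: hom_one hom_mult hom_cycle_val)

end

lemma theta_val_swap12: "theta_val y z P Q R = theta_val y z Q P R"
  by (simp add: theta_val_def Let_def algebra_simps)

lemma theta_val_swap23: "theta_val y z P Q R = theta_val y z P R Q"
  by (simp add: theta_val_def Let_def algebra_simps)

lemma dumbbell_val_swap: "dumbbell_val y z A B K = dumbbell_val y z B A K"
  by (simp add: dumbbell_val_def Let_def algebra_simps)

abbreviation X :: "int poly" where "X \<equiv> [:0, 1:]"
abbreviation theta_poly :: "nat \<Rightarrow> nat \<Rightarrow> nat \<Rightarrow> int poly" where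
  "theta_poly \<equiv> theta_val X (X - 1)"
abbreviation dumbbell_poly :: "nat \<Rightarrow> nat \<Rightarrow> nat \<Rightarrow> int poly" where
  "dumbbell_poly \<equiv> dumbbell_val X (X - 1)"
abbreviation cycles_poly :: "nat list \<Rightarrow> int poly" where
  "cycles_poly cs \<equiv> prod_list (map (cycle_val X) cs)"

lemma coeff_mult_01:
  "coeff (p * q) 0 = coeff p 0 * coeff q 0"
  "coeff (p * q) (Suc 0) = coeff p 0 * coeff q (Suc 0) + coeff p (Suc 0) * coeff q 0"
  by (simp_all add: coeff_mult)

lemma coeff_continuant_01:
  "coeff (continuant X k) 0 = (if odd k then 1 else 0)"
  "coeff (continuant X k) (Suc 0) = (if odd k then 0 else int (k div 2))"
  by (induction k rule: induct_nat_012) (auto simp: coeff_mult_01)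

lemma coeff_numeral_01: "coeff (2 :: int poly) 0 = 2" "coeff (2 :: int poly) (Suc 0) = 0"
  by (simp_all add: numeral_poly)

lemmas coeff_01 = coeff_mult_01 coeff_continuant_01 coeff_numeral_01 power2_eq_square

lemma coeff_theta_odd_odd_odd:
  assumes "odd P" "odd Q" "odd R"
  shows "coeff (theta_poly P Q R) 0 = 10"
  using assms by (auto simp: theta_val_def Let_def coeff_01)

lemma coeff_theta_even_odd_odd:
  assumes "even P" "odd Q" "odd R" "0 < P"
  shows "coeff (theta_poly P Q R) 0 = 2"
    and "coeff (theta_poly P Q R) (Suc 0) = int (P + Q + R) + 2 * int P - 1"
  using assms by (auto simp: theta_val_def Let_def coeff_01 elim!: oddE evenE)

lemma coeff_theta_odd_even_even:
  assumes "odd P" "even Q" "even R" "0 < Q" "0 < R"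
  shows "coeff (theta_poly P Q R) 0 = 4" and "coeff (theta_poly P Q R) (Suc 0) = 0"
  using assms by (auto simp: theta_val_def Let_def coeff_01 elim!: oddE evenE)

lemma coeff_theta_even_even_even:
  assumes "even P" "even Q" "even R"
  shows "coeff (theta_poly P Q R) 0 = 0"
  using assms by (auto simp: theta_val_def Let_def coeff_01)

lemma coeff_dumbbell_odd_odd:
  assumes "odd A" "odd B" "0 < K"
  shows "coeff (dumbbell_poly A B K) 0 = 2"
    and "coeff (dumbbell_poly A B K) (Suc 0) = int (A + B + K) - 1"
  using assms by (cases "odd K"; auto simp: dumbbell_val_def Let_def coeff_01 elim!: oddE evenE)+

lemma coeff_dumbbell_even_odd:
  assumes "even A" "odd B" "0 < A" "0 < K"
  shows "coeff (dumbbell_poly A B K) 0 = 4" and "coeff (dumbbell_poly A B K) (Suc 0) > 0"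
  using assms by (cases "odd K"; auto simp: dumbbell_val_def Let_def coeff_01 elim!: oddE evenE)+

lemma coeff_dumbbell_even_even:
  assumes "even A" "even B" "0 < A" "0 < B" "0 < K"
  shows "coeff (dumbbell_poly A B K) 0 = (if odd K then 16 else 0)"
  using assms by (auto simp: dumbbell_val_def Let_def coeff_01 elim!: oddE evenE)

lemma coeff_cycle_01:
  assumes "0 < c"
  shows "coeff (cycle_val X c) 0 = (if odd c then 2 else 4)"
    and "coeff (cycle_val X c) (Suc 0) = (if odd c then int c else 0)"
  using assms by (auto simp: cycle_val_def coeff_01 elim!: oddE evenE)

lemma coeff_cycles_01:
  assumes "\<forall>c\<in>set cs. 3 \<le> c"
  shows "0 < coeff (cycles_poly cs) 0" "0 \<le> coeff (cycles_poly cs) (Suc 0)"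
    "cs \<noteq> [] \<Longrightarrow> even (coeff (cycles_poly cs) 0)"
  using assms
proof (induction cs)
  case (Cons c cs)
  { case 1 then show ?case using Cons by (simp add: coeff_01 coeff_cycle_01) }
  { case 2 then show ?case using Cons by (simp add: coeff_01 coeff_cycle_01) }
  { case 3 then show ?case using Cons by (simp add: coeff_01 coeff_cycle_01) }
qed simp_all

text \<open>Up to order only the number of even lengths matters: none, one (then \<open>k\<close> is
  that length), two, or three.\<close>

lemma coeff_theta_cases:
  assumes "0 < P" "0 < Q" "0 < R"
  obtains "coeff (theta_poly P Q R) 0 = 10"
  | k where "coeff (theta_poly P Q R) 0 = 2" "coeff (theta_poly P Q R) (Suc 0) = int (P + Q + R) + 2 * int k - 1"
    "0 < k"
  | "coeff (theta_poly P Q R) 0 = 4" "coeff (theta_poly P Q R) (Suc 0) = 0"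
  | "coeff (theta_poly P Q R) 0 = 0" "even P" "even Q" "even R"
proof -
  have p: "theta_poly P Q R = theta_poly Q P R" "theta_poly P Q R = theta_poly R P Q"
    using theta_val_swap12 theta_val_swap23 by metis+
  consider "odd P" "odd Q" "odd R" | "even P" "even Q" "even R"
    | "even P" "odd Q" "odd R" | "even Q" "odd P" "odd R" | "even R" "odd P" "odd Q"
    | "odd P" "even Q" "even R" | "odd Q" "even P" "even R" | "odd R" "even P" "even Q"
    by blast
  then show ?thesis
  proof cases
    case 1
    then show ?thesis by (intro that(1) coeff_theta_odd_odd_odd)
  next
    case 2
    then show ?thesis by (intro that(4) coeff_theta_even_even_even)
  next
    case 3
    then show ?thesis using assms coeff_theta_even_odd_odd[of P Q R] by (intro that(2)[of P]) auto
  next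
    case 4
    then show ?thesis using assms coeff_theta_even_odd_odd[of Q P R, folded p(1)]
      by (intro that(2)[of Q]) auto
  next
    case 5
    then show ?thesis using assms coeff_theta_even_odd_odd[of R P Q, folded p(2)]
      by (intro that(2)[of R]) auto
  next
    case 6
    then show ?thesis using assms coeff_theta_odd_even_even[of P Q R] by (intro that(3)) auto
  next
    case 7
    then show ?thesis using assms coeff_theta_odd_even_even[of Q P R, folded p(1)]
      by (intro that(3)) auto
  next
    case 8
    then show ?thesis using assms coeff_theta_odd_even_even[of R P Q, folded p(2)]
      by (intro that(3)) auto
  qed
qed

lemma coeff_dumbbell_cases:
  assumes "0 < A" "0 < B" "0 < K"
  obtains "coeff (dumbbell_poly A B K) 0 = 2" "coeff (dumbbell_poly A B K) (Suc 0) = int (A + B + K) - 1"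
  | "coeff (dumbbell_poly A B K) 0 = 4" "coeff (dumbbell_poly A B K) (Suc 0) > 0"
  | "coeff (dumbbell_poly A B K) 0 = 16"
  | "coeff (dumbbell_poly A B K) 0 = 0" "even A" "even B" "even K"
  using that coeff_dumbbell_odd_odd[of A B K] coeff_dumbbell_even_odd[of A B K]
    coeff_dumbbell_even_odd[of B A K, folded dumbbell_val_swap] coeff_dumbbell_even_even[of A B K] assms
  by (cases "even A"; cases "even B"; cases "even K") simp_all

text \<open>The cycles contribute an even constant coefficient, while that of a theta polynomial is
  0, 2, 4 or 10. The only nonzero product that fits is \<open>4 = 2 * 2\<close>, and there the
  linear coefficients disagree: 0 on the left, positive on the right.\<close>

lemma theta_poly_eq_theta_times_cycles_even:
  assumes pos: "0 < P" "0 < Q" "0 < R" "0 < P'" "0 < Q'" "0 < R'"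
    and cs: "\<forall>c\<in>set cs. 3 \<le> c" "cs \<noteq> []"
    and eq: "theta_poly P Q R = theta_poly P' Q' R' * cycles_poly cs"
  shows "even P \<and> even Q \<and> even R \<and> even P' \<and> even Q' \<and> even R'"
proof -
  note C = coeff_cycles_01[OF cs(1)]
  obtain m where m: "coeff (cycles_poly cs) 0 = 2 * m" using C(3) cs by auto
  have 0: "coeff (theta_poly P Q R) 0 = coeff (theta_poly P' Q' R') 0 * coeff (cycles_poly cs) 0"
    and 1: "coeff (theta_poly P Q R) (Suc 0) = coeff (theta_poly P' Q' R') 0 * coeff (cycles_poly cs) (Suc 0)
      + coeff (theta_poly P' Q' R') (Suc 0) * coeff (cycles_poly cs) 0"
    unfolding eq by (simp_all add: coeff_01)
  show ?thesis
  proof (cases rule: coeff_theta_cases[OF pos(4-6)])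
    case 1
    then have "coeff (theta_poly P Q R) 0 = 20 * m" using 0 m by simp
    then show ?thesis using C(1) m by (cases rule: coeff_theta_cases[OF pos(1-3)]) presburger+
  next
    case (2 k)
    then have *: "coeff (theta_poly P Q R) 0 = 4 * m" using 0 m by simp
    have "coeff (theta_poly P' Q' R') (Suc 0) > 0" using 2 pos by simp
    then have "coeff (theta_poly P Q R) (Suc 0) > 0" using 1 2 C(1,2) by (simp add: add_nonneg_pos)
    then show ?thesis using C(1) m * by (cases rule: coeff_theta_cases[OF pos(1-3)]) presburger+
  next
    case 3
    then have "coeff (theta_poly P Q R) 0 = 8 * m" using 0 m by simp
    then show ?thesis using C(1) m by (cases rule: coeff_theta_cases[OF pos(1-3)]) presburger+
  next
    case 4
    then show ?thesis using 0 by (cases rule: coeff_theta_cases[OF pos(1-3)]) simp_all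
  qed
qed

text \<open>Beyond the arithmetic of constant coefficients there is one borderline case: a dumbbell
  with two odd cycles and a theta graph with exactly one even length \<open>k\<close> both have
  constant coefficient 2. Without further cycles, their linear coefficients differ by
  \<open>2 * k\<close>.\<close>

lemma theta_poly_eq_dumbbell_times_cycles_even:
  assumes pos: "0 < P" "0 < Q" "0 < R" "0 < A" "0 < B" "0 < K"
    and cs: "\<forall>c\<in>set cs. 3 \<le> c"
    and N: "P + Q + R = A + B + K + sum_list cs"
    and eq: "theta_poly P Q R = dumbbell_poly A B K * cycles_poly cs"
  shows "even P \<and> even Q \<and> even R \<and> even A \<and> even B \<and> even K"
proof -
  note C = coeff_cycles_01[OF cs(1)]
  have 0: "coeff (theta_poly P Q R) 0 = coeff (dumbbell_poly A B K) 0 * coeff (cycles_poly cs) 0"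
    and 1: "coeff (theta_poly P Q R) (Suc 0) = coeff (dumbbell_poly A B K) 0 * coeff (cycles_poly cs) (Suc 0)
      + coeff (dumbbell_poly A B K) (Suc 0) * coeff (cycles_poly cs) 0"
    unfolding eq by (simp_all add: coeff_01)
  let ?t = "coeff (theta_poly P Q R)" and ?c = "coeff (cycles_poly cs) 0"
  have t: "?t 0 = 10 \<or> ?t 0 = 2 \<or> ?t 0 = 4 \<and> ?t (Suc 0) = 0 \<or> ?t 0 = 0 \<and> even P \<and> even Q \<and> even R"
    by (cases rule: coeff_theta_cases[OF pos(1-3)]) simp_all
  show ?thesis
  proof (cases rule: coeff_dumbbell_cases[OF pos(4-6)])
    case D: 1
    then have *: "?t (Suc 0) > 0"
      using 1 pos C(1,2) by (simp add: add_nonneg_pos)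
    show ?thesis
    proof (cases "cs = []")
      case True
      then have "?t 0 = 2" "?t (Suc 0) = int (P + Q + R) - 1" using 0 1 D N by simp_all
      then show ?thesis by (cases rule: coeff_theta_cases[OF pos(1-3)]) simp_all
    next
      case False
      then obtain m where "?c = 2 * m" using C(3) by auto
      then have "?t 0 = 4 * m" using 0 D by simp
      then show ?thesis using t * C(1) \<open>?c = 2 * m\<close> by presburger
    qed
  next
    case D: 2
    then have "?t (Suc 0) > 0"
      using 1 C(1,2) by (simp add: add_nonneg_pos)
    moreover have "?t 0 = 4 * ?c" using 0 D by simp
    ultimately show ?thesis using t C(1) by presburger
  next
    case D: 3
    then have "?t 0 = 16 * ?c" using 0 by simp
    then show ?thesis using t C(1) by presburger
  next
    case D: 4
    then have "?t 0 = 0" using 0 by simp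
    then show ?thesis using t D by presburger
  qed
qed

section \<open>The substitution \<open>y = 1 / s - s\<close>\<close>

lemma unital_ring_hom_eval:
  "unital_ring_hom (\<lambda>p. poly (map_poly real_of_int p) x)"
proof
  fix p q :: "int poly"
  have "map_poly real_of_int (p + q) = map_poly real_of_int p + map_poly real_of_int q"
    by (intro poly_eqI) (simp add: coeff_map_poly)
  then show "poly (map_poly real_of_int (p + q)) x
    = poly (map_poly real_of_int p) x + poly (map_poly real_of_int q) x" by simp
  have "map_poly real_of_int (p * q) = map_poly real_of_int p * map_poly real_of_int q"
    by (intro poly_eqI) (simp add: coeff_map_poly coeff_mult)
  then show "poly (map_poly real_of_int (p * q)) x
    = poly (map_poly real_of_int p) x * poly (map_poly real_of_int q) x" by simp
qed simp

lemma eval_X: "poly (map_poly real_of_int X) x = x"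
  by (simp add: map_poly_pCons)

lemma eval_polys:
  fixes x :: real
  shows "poly (map_poly real_of_int (theta_poly P Q R)) x = theta_val x (x - 1) P Q R"
    and "poly (map_poly real_of_int (dumbbell_poly A B K)) x = dumbbell_val x (x - 1) A B K"
    and "poly (map_poly real_of_int (cycles_poly cs)) x = prod_list (map (cycle_val x) cs)"
    and "poly (map_poly real_of_int (p * q)) x
      = poly (map_poly real_of_int p) x * poly (map_poly real_of_int q) x"
proof -
  interpret unital_ring_hom "\<lambda>p. poly (map_poly real_of_int p) x"
    by (rule unital_ring_hom_eval)
  show "poly (map_poly real_of_int (theta_poly P Q R)) x = theta_val x (x - 1) P Q R"
    by (simp only: hom_theta_val hom_diff hom_one eval_X)
  show "poly (map_poly real_of_int (dumbbell_poly A B K)) x = dumbbell_val x (x - 1) A B K"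
    by (simp only: hom_dumbbell_val hom_diff hom_one eval_X)
  show "poly (map_poly real_of_int (cycles_poly cs)) x = prod_list (map (cycle_val x) cs)"
    by (simp only: hom_cycle_vals eval_X)
  show "poly (map_poly real_of_int (p * q)) x
      = poly (map_poly real_of_int p) x * poly (map_poly real_of_int q) x"
    by (rule hom_mult)
qed

lemma continuant_minus: "continuant (- w) k = - ((- 1) ^ k * continuant w k)"
  by (induction k rule: induct_nat_012) (auto simp: algebra_simps)

lemma continuant_nonneg: "0 \<le> w \<Longrightarrow> 0 \<le> continuant (w :: real) k"
  by (induction k rule: induct_nat_012) auto

lemma continuant_ge_1: "0 \<le> w \<Longrightarrow> odd k \<Longrightarrow> 1 \<le> continuant (w :: real) k"
  by (induction k rule: induct_nat_012) (auto simp: continuant_nonneg add_increasing)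

lemma continuant_pos: "0 < w \<Longrightarrow> 0 < k \<Longrightarrow> 0 < continuant (w :: real) k"
  by (induction k rule: induct_nat_012) (auto simp: continuant_nonneg add_pos_nonneg)

lemma continuous_continuant: "continuous_on A (\<lambda>w :: real. continuant w k)"
  by (induction k rule: induct_nat_012) (auto intro!: continuous_intros)

lemma odd_cycle_root:
  assumes "odd c"
  obtains w :: real where "0 < w" "cycle_val (- w) c = 0"
proof -
  have e: "cycle_val (- w) c = 2 - w * continuant w c - 2 * continuant w (c - 1)" for w :: real
    using assms by (auto simp: cycle_val_def continuant_minus elim!: oddE)
  have z: "continuant (0 :: real) (2 * k) = 0" for k
    by (induction k) auto
  let ?f = "\<lambda>w :: real. 2 - w * continuant w c - 2 * continuant w (c - 1)"
  have 0: "?f 0 = 2"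
    using assms z by (auto elim!: oddE)
  \<comment> \<open>The interval ends at 2 because \<open>continuant w c\<close> is at least 1 for
    odd \<open>c\<close>, so that \<open>w * continuant w c\<close> has reached the constant term 2
    there.\<close>
  have 2: "?f 2 \<le> 0"
    using continuant_ge_1[of 2 c] continuant_nonneg[of 2 "c - 1"] assms by simp
  have "\<exists>w \<ge> 0. w \<le> 2 \<and> ?f w = 0"
    using 0 2 by (intro IVT2') (auto intro!: continuous_intros continuous_continuant)
  then obtain w where "0 \<le> w" "?f w = 0" by blast
  then show ?thesis using that[of w] 0 e[of w] by (cases "w = 0") auto
qed

text \<open>At \<open>- w\<close> and for even lengths, the local functions of
  \<open>theta_val\<close> satisfy \<open>F < 0\<close>, \<open>E > 0\<close> and
  \<open>G \<le> 0\<close>, and \<open>z\<close> is negative. Every summand contains an odd number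
  of such nonpositive factors, squares aside.\<close>

lemma theta_val_neg:
  fixes w :: real
  assumes "even P" "even Q" "even R" "0 < P" "0 < Q" "0 < R" "0 < w"
  shows "theta_val (- w) (- w - 1) P Q R < 0"
proof -
  define F where "F = continuant w"
  have F: "continuant (- w) k = - F k" "continuant (- w) (k - Suc 0) = F (k - 1)" if "even k" "0 < k" for k
    using that by (auto simp: continuant_minus F_def elim!: evenE)
  have pos: "0 < F k" "0 < F (k - 1)" "0 \<le> F k - w * F (k - 1)" if "even k" "0 < k" for k
  proof -
    have "2 \<le> k" using that by (auto elim!: evenE)
    then obtain m where "k = 2 + m" using le_Suc_ex by blast
    then have m: "k = Suc (Suc m)" by simp
    show "0 < F k" "0 < F (k - 1)"
      unfolding F_def m by (rule continuant_pos[OF assms(7)]; simp)+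
    show "0 \<le> F k - w * F (k - 1)"
      using continuant_nonneg[of w m] assms(7) by (simp add: F_def m)
  qed
  have "theta_val (- w) (- w - 1) P Q R = -
     ((w + 1)\<^sup>2 * (F P * F Q * F R)
      + 2 * (w + 1) * (F (P - 1) * F Q * F R + F P * F (Q - 1) * F R + F P * F Q * F (R - 1))
      + ((F P - w * F (P - 1)) * F Q * F R + F P * (F Q - w * F (Q - 1)) * F R
        + F P * F Q * (F R - w * F (R - 1)))
      + 2 * (F (P - 1) * F (Q - 1) * F R + F (P - 1) * F Q * F (R - 1) + F P * F (Q - 1) * F (R - 1))
      + 2 * (F P + F Q + F R))"
    using assms by (simp add: theta_val_def Let_def F power2_eq_square algebra_simps)
  also have "\<dots> < 0"
    using pos[OF assms(1,4)] pos[OF assms(2,5)] pos[OF assms(3,6)] assms(7)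
    unfolding neg_less_0_iff_less
    by (intro add_nonneg_pos add_nonneg_nonneg mult_nonneg_nonneg) (auto simp: less_imp_le add_pos_pos)
  finally show ?thesis .
qed

lemma even_cycles:
  assumes "even P" "even Q" "even R" "0 < P" "0 < Q" "0 < R"
    and eq: "theta_poly P Q R = p * cycles_poly cs" and c: "c \<in> set cs"
  shows "even c"
proof (rule ccontr)
  assume "odd c"
  then obtain w :: real where w: "0 < w" "cycle_val (- w) c = 0" by (rule odd_cycle_root)
  have "theta_val (- w) (- w - 1) P Q R
    = poly (map_poly real_of_int p) (- w) * prod_list (map (cycle_val (- w)) cs)"
    using arg_cong[OF eq, of "\<lambda>p. poly (map_poly real_of_int p) (- w)"] by (simp only: eval_polys)
  also have "prod_list (map (cycle_val (- w)) cs) = 0"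
    using w(2) c by (force simp: prod_list_zero_iff)
  finally show False using theta_val_neg[of P Q R w] assms w by simp
qed

text \<open>At \<open>y = 1 / s - s\<close> one has \<open>(1 + s\<^sup>2) s ^ k F k = s (1 - (- s\<^sup>2) ^ k)\<close>, and \<open>epsilon k\<close> is \<open>(- s\<^sup>2) ^ k\<close>.
  The polynomials below are the values at \<open>y\<close> multiplied by \<open>(1 + s\<^sup>2) ^ 3 s ^ (N - 1)\<close> for theta and
  dumbbell, where \<open>N\<close> is the number of edges, and by \<open>s ^ c\<close> for a cycle; \<open>theta_part N P\<close> collects the
  terms of the theta polynomial that depend on \<open>P\<close> when \<open>N\<close> is fixed.\<close>

definition epsilon :: "nat \<Rightarrow> real poly" where "epsilon P = monom ((- 1) ^ P) (2 * P)"

definition theta_part :: "nat \<Rightarrow> nat \<Rightarrow> real poly" where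
  "theta_part N P = monom ((- 1) ^ (N + P)) (2 * (N - P)) * [:1, 2, 1:]
    - monom ((- 1) ^ P) (2 * P + 2) * [:1, -2, 1:]
    + monom 2 (N - P) * [:1, 0, 2, 0, 1:] - monom (2 * (- 1) ^ P) (N + P) * [:1, 0, 2, 0, 1:]"

definition theta_series :: "nat \<Rightarrow> nat \<Rightarrow> nat \<Rightarrow> real poly" where
  "theta_series P Q R = (let N = P + Q + R in
    [:1, -2, 5, -4, 4:] - monom ((- 1) ^ N) (2 * N) * [:4, 4, 5, 2, 1:]
    + theta_part N P + theta_part N Q + theta_part N R)"

definition dumbbell_series :: "nat \<Rightarrow> nat \<Rightarrow> nat \<Rightarrow> real poly" where
  "dumbbell_series A B K =
    (let g = (\<lambda>A. [:1, -1, 2:] + epsilon A * [:1, 1:] + monom 2 A * [:1, 0, 1:]);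
       h = (\<lambda>A. [:0, -1, 1:] + epsilon A * [:2, 1, 1:] + monom 2 A * [:1, 0, 1:])
     in g A * g B - epsilon K * h A * h B)"

definition cycle_series :: "nat \<Rightarrow> real poly" where
  "cycle_series c = 1 + monom 2 c + epsilon c"

text \<open>Binet's formula with denominators cleared: the characteristic equation
  \<open>t\<^sup>2 = y * t + 1\<close> of the recursion has the roots \<open>1 / s\<close> and
  \<open>- s\<close>, which motivates the substitution.\<close>

lemma continuant_subst:
  fixes s :: real
  assumes "s \<noteq> 0"
  defines "y \<equiv> 1 / s - s"
  shows "(1 + s\<^sup>2) * s ^ k * continuant y k = s * (1 - (- 1) ^ k * s ^ (2 * k))"
    and "0 < k \<Longrightarrow> (1 + s\<^sup>2) * s ^ k * continuant y (k - 1) = s\<^sup>2 + (- 1) ^ k * s ^ (2 * k)"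
proof -
  have sy: "s * y = 1 - s\<^sup>2" using assms by (simp add: y_def field_simps power2_eq_square)
  show *: "(1 + s\<^sup>2) * s ^ k * continuant y k = s * (1 - (- 1) ^ k * s ^ (2 * k))" for k
  proof (induction k rule: induct_nat_012)
    case (ge2 k)
    have "(1 + s\<^sup>2) * s ^ Suc (Suc k) * continuant y (Suc (Suc k))
      = (s * y) * ((1 + s\<^sup>2) * s ^ Suc k * continuant y (Suc k))
        + s\<^sup>2 * ((1 + s\<^sup>2) * s ^ k * continuant y k)"
      by (simp add: algebra_simps power2_eq_square)
    also have "\<dots> = (1 - s\<^sup>2) * (s * (1 - (- 1) ^ Suc k * s ^ (2 * Suc k)))
      + s\<^sup>2 * (s * (1 - (- 1) ^ k * s ^ (2 * k)))"
      unfolding sy ge2.IH ..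
    also have "\<dots> = s * (1 - (- 1) ^ Suc (Suc k) * s ^ (2 * Suc (Suc k)))"
      by (simp add: algebra_simps power2_eq_square power_add)
    finally show ?case .
  qed (simp_all add: algebra_simps power2_eq_square)
  show "(1 + s\<^sup>2) * s ^ k * continuant y (k - 1) = s\<^sup>2 + (- 1) ^ k * s ^ (2 * k)" if "0 < k"
  proof -
    obtain m where "k = Suc m" using gr0_implies_Suc[OF \<open>0 < k\<close>] by blast
    then have "(1 + s\<^sup>2) * s ^ k * continuant y (k - 1) = s * ((1 + s\<^sup>2) * s ^ m * continuant y m)"
      by (simp add: mult_ac)
    then show ?thesis unfolding * using \<open>k = Suc m\<close>
      by (simp add: algebra_simps power2_eq_square)
  qed
qed

lemma theta_series_eval:
  fixes s :: real
  assumes s: "s \<noteq> 0" and pos: "0 < P" "0 < Q" "0 < R"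
  defines "y \<equiv> 1 / s - s"
  shows "(1 + s\<^sup>2) ^ 3 * s ^ (P + Q + R) * theta_val y (y - 1) P Q R = s * poly (theta_series P Q R) s"
proof -
  define u where "u = 1 + s\<^sup>2"
  define a b c where "a = s ^ P" and "b = s ^ Q" and "c = s ^ R"
  define e f g :: real where "e = (- 1) ^ P" and "f = (- 1) ^ Q" and "g = (- 1) ^ R"
  define p q r where "p = continuant y P" and "q = continuant y Q" and "r = continuant y R"
  define p' q' r' where "p' = continuant y (P - 1)" and "q' = continuant y (Q - 1)" and "r' = continuant y (R - 1)"
  have e2: "e * e = 1" "f * f = 1" "g * g = 1"
    by (simp_all add: e_def f_def g_def flip: power_add mult_2)
  have F: "u * a * p = s * (1 - e * a\<^sup>2)" "u * b * q = s * (1 - f * b\<^sup>2)" "u * c * r = s * (1 - g * c\<^sup>2)"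
    "u * a * p' = s\<^sup>2 + e * a\<^sup>2" "u * b * q' = s\<^sup>2 + f * b\<^sup>2" "u * c * r' = s\<^sup>2 + g * c\<^sup>2"
    using continuant_subst[OF s] pos
    unfolding u_def a_def b_def c_def e_def f_def g_def p_def q_def r_def p'_def q'_def r'_def y_def
    by (simp_all add: mult.commute flip: power_mult)
  have sy: "y = (1 - s\<^sup>2) / s" using s by (simp add: y_def field_simps power2_eq_square)
  \<comment> \<open>The factors are distributed so that each continuant meets one factor
    \<open>u\<close> and its own power of \<open>s\<close>, as \<open>F\<close> requires; the terms
    with a single continuant keep \<open>u\<^sup>2\<close>.\<close>
  have "(1 + s\<^sup>2) ^ 3 * s ^ (P + Q + R) * theta_val y (y - 1) P Q R =
      (y - 1)\<^sup>2 * ((u * a * p) * (u * b * q) * (u * c * r))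
      + 2 * (y - 1) * ((u * a * p') * (u * b * q) * (u * c * r) + (u * a * p) * (u * b * q') * (u * c * r)
        + (u * a * p) * (u * b * q) * (u * c * r'))
      + ((u * a * p - y * (u * a * p')) * (u * b * q) * (u * c * r)
        + (u * a * p) * (u * b * q - y * (u * b * q')) * (u * c * r)
        + (u * a * p) * (u * b * q) * (u * c * r - y * (u * c * r')))
      + 2 * ((u * a * p') * (u * b * q') * (u * c * r) + (u * a * p') * (u * b * q) * (u * c * r')
        + (u * a * p) * (u * b * q') * (u * c * r'))
      + 2 * u\<^sup>2 * (b * c * (u * a * p) + a * c * (u * b * q) + a * b * (u * c * r))"
    unfolding theta_val_def Let_def power_add u_def[symmetric] a_def[symmetric] b_def[symmetric]
      c_def[symmetric] p_def[symmetric] q_def[symmetric] r_def[symmetric] p'_def[symmetric]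
      q'_def[symmetric] r'_def[symmetric]
    by (simp add: algebra_simps power2_eq_square power3_eq_cube)
  also have "\<dots> = s * ((1 - s + 2 * s\<^sup>2)\<^sup>2 - s\<^sup>2 * (1 - s)\<^sup>2 * (e * a\<^sup>2 + f * b\<^sup>2 + g * c\<^sup>2)
      + (1 + s)\<^sup>2 * (e * f * (a * b)\<^sup>2 + e * g * (a * c)\<^sup>2 + f * g * (b * c)\<^sup>2)
      - (2 + s + s\<^sup>2)\<^sup>2 * (e * f * g * (a * b * c)\<^sup>2)
      + 2 * u\<^sup>2 * (b * c * (1 - e * a\<^sup>2) + a * c * (1 - f * b\<^sup>2) + a * b * (1 - g * c\<^sup>2)))"
    unfolding F unfolding sy u_def using s
    by (simp add: field_simps power2_eq_square)
  \<comment> \<open>The coefficient lists in \<open>theta_series\<close> and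
    \<open>theta_part\<close> are the expanded squares of \<open>1 - s + 2 * s\<^sup>2\<close>,
    \<open>2 + s + s\<^sup>2\<close>, \<open>1 + s\<close>, \<open>1 - s\<close> and
    \<open>1 + s\<^sup>2\<close>.\<close>
  also have "(1 - s + 2 * s\<^sup>2)\<^sup>2 - s\<^sup>2 * (1 - s)\<^sup>2 * (e * a\<^sup>2 + f * b\<^sup>2 + g * c\<^sup>2)
      + (1 + s)\<^sup>2 * (e * f * (a * b)\<^sup>2 + e * g * (a * c)\<^sup>2 + f * g * (b * c)\<^sup>2)
      - (2 + s + s\<^sup>2)\<^sup>2 * (e * f * g * (a * b * c)\<^sup>2)
      + 2 * u\<^sup>2 * (b * c * (1 - e * a\<^sup>2) + a * c * (1 - f * b\<^sup>2) + a * b * (1 - g * c\<^sup>2))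
      = poly (theta_series P Q R) s"
  proof -
    have sub: "P + Q + R - P = Q + R" "P + Q + R - Q = P + R" "P + Q + R - R = P + Q" by auto
    have sg: "(- 1 :: real) ^ (P + Q + R) = e * f * g" "(- 1 :: real) ^ (P + Q + R + P) = f * g"
      "(- 1 :: real) ^ (P + Q + R + Q) = e * g" "(- 1 :: real) ^ (P + Q + R + R) = e * f"
      using e2 by (simp_all add: power_add e_def f_def g_def)
    have sq: "s ^ (2 * k) = s ^ k * s ^ k" "s ^ (k * 2) = s ^ k * s ^ k" for k
      by (simp_all add: mult_2 mult_2_right power_add)
    show ?thesis
      unfolding theta_series_def theta_part_def Let_def sub sg
      by (simp add: poly_monom sq power_add a_def[symmetric] b_def[symmetric] c_def[symmetric]
          e_def[symmetric] f_def[symmetric] g_def[symmetric] u_def algebra_simps power2_eq_square)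
  qed
  finally show ?thesis .
qed

text \<open>After the substitution, the terms free of \<open>epsilon K\<close> and those containing
  it each split into one factor per cycle.\<close>

lemma dumbbell_series_eval:
  fixes s :: real
  assumes s: "s \<noteq> 0" and pos: "0 < A" "0 < B" "0 < K"
  defines "y \<equiv> 1 / s - s"
  shows "(1 + s\<^sup>2) ^ 3 * s ^ (A + B + K) * dumbbell_val y (y - 1) A B K
    = s * poly (dumbbell_series A B K) s"
proof -
  define u where "u = 1 + s\<^sup>2"
  define a b c where "a = s ^ A" and "b = s ^ B" and "c = s ^ K"
  define e f g :: real where "e = (- 1) ^ A" and "f = (- 1) ^ B" and "g = (- 1) ^ K"
  define p q r where "p = continuant y A" and "q = continuant y B" and "r = continuant y K"
  define p' q' r' where "p' = continuant y (A - 1)" and "q' = continuant y (B - 1)" and "r' = continuant y (K - 1)"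
  have F: "u * a * p = s * (1 - e * a\<^sup>2)" "u * b * q = s * (1 - f * b\<^sup>2)" "u * c * r = s * (1 - g * c\<^sup>2)"
    "u * a * p' = s\<^sup>2 + e * a\<^sup>2" "u * b * q' = s\<^sup>2 + f * b\<^sup>2" "u * c * r' = s\<^sup>2 + g * c\<^sup>2"
    using continuant_subst[OF s] pos
    unfolding u_def a_def b_def c_def e_def f_def g_def p_def q_def r_def p'_def q'_def r'_def y_def
    by (simp_all add: mult.commute flip: power_mult)
  have sy: "y = (1 - s\<^sup>2) / s" using s by (simp add: y_def field_simps power2_eq_square)
  have "(1 + s\<^sup>2) ^ 3 * s ^ (A + B + K) * dumbbell_val y (y - 1) A B K =
      (u * a * p) * (u * b * q) * ((y - 1)\<^sup>2 * (u * c * r) + 2 * (y - 1) * (u * c * r')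
        + (u * c * r - y * (u * c * r')))
      + ((u * a * p) * (2 * (u * b * q') + 2 * u * b) + (2 * (u * a * p') + 2 * u * a) * (u * b * q))
        * ((y - 1) * (u * c * r) + u * c * r')
      + (2 * (u * a * p') + 2 * u * a) * (2 * (u * b * q') + 2 * u * b) * (u * c * r)"
    unfolding dumbbell_val_def Let_def power_add u_def[symmetric] a_def[symmetric] b_def[symmetric]
      c_def[symmetric] p_def[symmetric] q_def[symmetric] r_def[symmetric] p'_def[symmetric]
      q'_def[symmetric] r'_def[symmetric]
    by (simp add: algebra_simps power2_eq_square power3_eq_cube)
  also have "\<dots> = s * ((1 - s + 2 * s\<^sup>2 + e * a\<^sup>2 * (1 + s) + 2 * a * (1 + s\<^sup>2))
        * (1 - s + 2 * s\<^sup>2 + f * b\<^sup>2 * (1 + s) + 2 * b * (1 + s\<^sup>2))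
      - g * c\<^sup>2 * (s\<^sup>2 - s + e * a\<^sup>2 * (2 + s + s\<^sup>2) + 2 * a * (1 + s\<^sup>2))
        * (s\<^sup>2 - s + f * b\<^sup>2 * (2 + s + s\<^sup>2) + 2 * b * (1 + s\<^sup>2)))"
    unfolding F unfolding sy u_def using s
    by (simp add: field_simps power2_eq_square)
  also have "(1 - s + 2 * s\<^sup>2 + e * a\<^sup>2 * (1 + s) + 2 * a * (1 + s\<^sup>2))
        * (1 - s + 2 * s\<^sup>2 + f * b\<^sup>2 * (1 + s) + 2 * b * (1 + s\<^sup>2))
      - g * c\<^sup>2 * (s\<^sup>2 - s + e * a\<^sup>2 * (2 + s + s\<^sup>2) + 2 * a * (1 + s\<^sup>2))
        * (s\<^sup>2 - s + f * b\<^sup>2 * (2 + s + s\<^sup>2) + 2 * b * (1 + s\<^sup>2))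
      = poly (dumbbell_series A B K) s"
  proof -
    have sq: "s ^ (2 * k) = s ^ k * s ^ k" "s ^ (k * 2) = s ^ k * s ^ k" for k
      by (simp_all add: mult_2 mult_2_right power_add)
    show ?thesis
      unfolding dumbbell_series_def Let_def epsilon_def
      by (simp add: poly_monom sq a_def[symmetric] b_def[symmetric] c_def[symmetric]
          e_def[symmetric] f_def[symmetric] g_def[symmetric] algebra_simps power2_eq_square)
  qed
  finally show ?thesis .
qed

lemma cycle_series_eval:
  fixes s :: real
  assumes s: "s \<noteq> 0" and "0 < c"
  shows "s ^ c * cycle_val (1 / s - s) c = poly (cycle_series c) s"
proof -
  define y where "y = 1 / s - s"
  have "(1 + s\<^sup>2) * (s ^ c * cycle_val y c) = y * ((1 + s\<^sup>2) * s ^ c * continuant y c)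
     + 2 * ((1 + s\<^sup>2) * s ^ c * continuant y (c - 1)) + 2 * (1 + s\<^sup>2) * s ^ c"
    by (simp add: cycle_val_def algebra_simps)
  also have "\<dots> = (1 + s\<^sup>2) * poly (cycle_series c) s"
    unfolding y_def continuant_subst(1)[OF s] continuant_subst(2)[OF s assms(2)] using s
    by (simp add: cycle_series_def epsilon_def poly_monom field_simps power2_eq_square)
  finally show ?thesis
    using s by (simp add: y_def add_pos_nonneg[THEN less_imp_neq, THEN not_sym])
qed

lemma cycles_series_eval:
  fixes s :: real
  assumes s: "s \<noteq> 0" and "\<forall>c\<in>set cs. 3 \<le> c"
  shows "s ^ sum_list cs * prod_list (map (cycle_val (1 / s - s)) cs)
    = poly (prod_list (map cycle_series cs)) s"
  using assms(2)
proof (induction cs)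
  case (Cons c cs)
  then have c: "0 < c" by auto
  have "s ^ sum_list (c # cs) * prod_list (map (cycle_val (1 / s - s)) (c # cs))
    = (s ^ c * cycle_val (1 / s - s) c) * (s ^ sum_list cs * prod_list (map (cycle_val (1 / s - s)) cs))"
    by (simp add: power_add)
  also have "\<dots> = poly (cycle_series c) s * poly (prod_list (map cycle_series cs)) s"
    unfolding cycle_series_eval[OF s c] using Cons by simp
  finally show ?case by simp
qed simp

text \<open>The substitution makes no sense at \<open>s = 0\<close>, but agreement on an interval
  already exceeds the finitely many roots of a nonzero polynomial.\<close>

lemma poly_eqI_nonzero:
  fixes p q :: "real poly"
  assumes "\<And>s. s \<noteq> 0 \<Longrightarrow> poly p s = poly q s"
  shows "p = q"
proof (rule ccontr)
  assume "p \<noteq> q"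
  then have "finite {s. poly (p - q) s = 0}" by (intro poly_roots_finite) simp
  moreover have "{0<..<1} \<subseteq> {s. poly (p - q) s = 0}" using assms by auto
  ultimately have "finite {0<..<1 :: real}" by (rule finite_subset[rotated])
  then show False using infinite_Ioo[of 0 "1 :: real"] by simp
qed

text \<open>The edge count \<open>N\<close> makes the powers of \<open>s\<close> match, and
  \<open>(1 + s\<^sup>2) ^ 3\<close> occurs once on each side because the cycles carry no such
  factor.\<close>

lemma theta_series_eq_theta_times_cycles:
  assumes pos: "0 < P" "0 < Q" "0 < R" "0 < P'" "0 < Q'" "0 < R'"
    and cs: "\<forall>c\<in>set cs. 3 \<le> c" and N: "P + Q + R = P' + Q' + R' + sum_list cs"
    and eq: "theta_poly P Q R = theta_poly P' Q' R' * cycles_poly cs"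
  shows "theta_series P Q R = theta_series P' Q' R' * prod_list (map cycle_series cs)"
proof (rule poly_eqI_nonzero)
  fix s :: real assume s: "s \<noteq> 0"
  define y where "y = 1 / s - s"
  have "theta_val y (y - 1) P Q R = theta_val y (y - 1) P' Q' R' * prod_list (map (cycle_val y) cs)"
    using arg_cong[OF eq, of "\<lambda>p. poly (map_poly real_of_int p) y"] by (simp only: eval_polys)
  then have "s * poly (theta_series P Q R) s
    = ((1 + s\<^sup>2) ^ 3 * s ^ (P' + Q' + R') * theta_val y (y - 1) P' Q' R')
      * (s ^ sum_list cs * prod_list (map (cycle_val y) cs))"
    unfolding theta_series_eval[OF s pos(1-3), folded y_def, symmetric] N by (simp add: power_add)
  also have "\<dots> = s * poly (theta_series P' Q' R' * prod_list (map cycle_series cs)) s"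
    unfolding y_def theta_series_eval[OF s pos(4-6)] cycles_series_eval[OF s cs] by simp
  finally show "poly (theta_series P Q R) s
    = poly (theta_series P' Q' R' * prod_list (map cycle_series cs)) s" using s by simp
qed

lemma theta_series_eq_dumbbell_times_cycles:
  assumes pos: "0 < P" "0 < Q" "0 < R" "0 < A" "0 < B" "0 < K"
    and cs: "\<forall>c\<in>set cs. 3 \<le> c" and N: "P + Q + R = A + B + K + sum_list cs"
    and eq: "theta_poly P Q R = dumbbell_poly A B K * cycles_poly cs"
  shows "theta_series P Q R = dumbbell_series A B K * prod_list (map cycle_series cs)"
proof (rule poly_eqI_nonzero)
  fix s :: real assume s: "s \<noteq> 0"
  define y where "y = 1 / s - s"
  have "theta_val y (y - 1) P Q R = dumbbell_val y (y - 1) A B K * prod_list (map (cycle_val y) cs)"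
    using arg_cong[OF eq, of "\<lambda>p. poly (map_poly real_of_int p) y"] by (simp only: eval_polys)
  then have "s * poly (theta_series P Q R) s
    = ((1 + s\<^sup>2) ^ 3 * s ^ (A + B + K) * dumbbell_val y (y - 1) A B K)
      * (s ^ sum_list cs * prod_list (map (cycle_val y) cs))"
    unfolding theta_series_eval[OF s pos(1-3), folded y_def, symmetric] N by (simp add: power_add)
  also have "\<dots> = s * poly (dumbbell_series A B K * prod_list (map cycle_series cs)) s"
    unfolding y_def dumbbell_series_eval[OF s pos(4-6)] cycles_series_eval[OF s cs] by simp
  finally show "poly (theta_series P Q R) s
    = poly (dumbbell_series A B K * prod_list (map cycle_series cs)) s" using s by simp
qed

section \<open>Coefficients at low powers of \<open>s\<close>\<close>

text \<open>The first and the last of the four summands start above \<open>n\<close>, and of the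
  other two at most the constant coefficients of the fixed factors are reached.\<close>

lemma coeff_theta_part_low:
  assumes "0 < P" "P < N" "n \<le> 2 * P + 2" "n \<le> N - P"
  shows "coeff (theta_part N P) n
    = (if n = 2 * P + 2 then - ((- 1) ^ P) else 0) + (if n = N - P then 2 else 0)"
proof -
  have "n < 2 * (N - P)" "n < N + P" "n - (2 * P + 2) = 0" "n - (N - P) = 0"
    "n < 2 * P + 2 \<longleftrightarrow> n \<noteq> 2 * P + 2" "n < N - P \<longleftrightarrow> n \<noteq> N - P"
    using assms by auto
  then show ?thesis
    unfolding theta_part_def coeff_add coeff_diff coeff_monom_mult by (simp only: coeff_pCons_0) simp
qed

text \<open>Compare the two sides at the lowest exponent coming from a length that is not common to
  both triples: the smallest such length \<open>P\<close> contributes there with sign \<open>\<plusminus> 1\<close> at \<open>2 P + 2\<close>, the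
  largest one \<open>M\<close> contributes \<open>2\<close> at \<open>N - M\<close>.\<close>

lemma theta_parts_not_less:
  assumes pos: "0 < P" "0 < P'" and sorted: "P \<le> Q" "Q \<le> R" "P' \<le> Q'" "Q' \<le> R'"
    and N: "P + Q + R = N" "P' + Q' + R' = N"
    and eq: "theta_part N P + theta_part N Q + theta_part N R
      = theta_part N P' + theta_part N Q' + theta_part N R'"
  shows "\<not> P < P'" and "P = P' \<Longrightarrow> \<not> Q < Q'"
proof -
  have c: "coeff (theta_part N P) n + coeff (theta_part N Q) n + coeff (theta_part N R) n
      = coeff (theta_part N P') n + coeff (theta_part N Q') n + coeff (theta_part N R') n" for n
    using arg_cong[OF eq, of "\<lambda>p. coeff p n"] by simp
  have sg: "(- 1 :: real) ^ i = 1 \<or> (- 1 :: real) ^ i = - 1" for i :: nat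
    using neg_one_even_power neg_one_odd_power by blast
  \<comment> \<open>To be used with \<open>m\<close> and \<open>M\<close> the smallest and the
    largest length not common to both triples: a length \<open>i\<close> strictly between them
    contributes nothing at this exponent.\<close>
  have L: "coeff (theta_part N i) (min (2 * m + 2) (N - M))
      = (if i = m \<and> 2 * m + 2 \<le> N - M then - ((- 1) ^ m) else 0)
      + (if i = M \<and> N - M \<le> 2 * m + 2 then 2 else 0)"
    if "0 < m" "m \<le> i" "i \<le> M" "M < N" for i m M
    using that coeff_theta_part_low[of i N "min (2 * m + 2) (N - M)"] by (auto simp: min_def)
  have b: "Q < N" "R < N" "R' < N" using pos sorted N by auto
  show "\<not> P < P'"
  proof
    assume lt: "P < P'"
    then have P': "P \<le> P'" "P \<le> Q'" "P \<le> R'" "P' \<noteq> P" "Q' \<noteq> P" "R' \<noteq> P" and PR: "P \<le> R"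
      using sorted by auto
    consider "R = R'" | "R < R'" | "R' < R" by linarith
    then show False
    proof cases
      case 1
      then have Q: "P' \<le> Q" "Q' \<le> Q" "P' \<noteq> Q" "Q' \<noteq> Q" "Q \<noteq> P" using lt N sorted by auto
      note L' = L[OF pos(1) _ _ b(1)]
      have "coeff (theta_part N P) (min (2 * P + 2) (N - Q)) + coeff (theta_part N Q) (min (2 * P + 2) (N - Q))
        = coeff (theta_part N P') (min (2 * P + 2) (N - Q)) + coeff (theta_part N Q') (min (2 * P + 2) (N - Q))"
        using c[of "min (2 * P + 2) (N - Q)"] 1 by simp
      then show False
        unfolding L'[OF order_refl sorted(1)] L'[OF sorted(1) order_refl] L'[OF P'(1) Q(1)] L'[OF P'(2) Q(2)]
        using P' Q sg[of P] by (cases "2 * P + 2 \<le> N - Q"; cases "N - Q \<le> 2 * P + 2") auto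
    next
      case 2
      then have R: "P \<le> R'" "Q \<le> R'" "R \<le> R'" "P \<noteq> R'" "Q \<noteq> R'" "R \<noteq> R'" "Q' \<le> R'" "P' \<le> R'"
        using lt N sorted by auto
      define x y where "x \<longleftrightarrow> 2 * P + 2 \<le> N - R'" and "y \<longleftrightarrow> N - R' \<le> 2 * P + 2"
      \<comment> \<open>For \<open>Q = P\<close> two contributions of size 1 could add up to the 2
        on the other side; comparing the sums of the lengths excludes this coincidence.\<close>
      have ne: "\<not> (Q = P \<and> x \<and> y)" "R \<noteq> P" using 2 N pos lt sorted by (auto simp: x_def y_def)
      have xy: "x \<or> y" by (auto simp: x_def y_def)
      note L' = L[OF pos(1) _ _ b(3), folded x_def y_def]
      have "(if x then - ((- 1) ^ P) else 0) + (if Q = P \<and> x then - ((- 1) ^ P) else 0) =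
        (if P' = R' \<and> y then 2 else 0) + (if Q' = R' \<and> y then 2 else 0) + (if y then 2 else (0 :: real))"
        using c[of "min (2 * P + 2) (N - R')"]
        unfolding L'[OF order_refl R(1)] L'[OF sorted(1) R(2)] L'[OF PR R(3)]
          L'[OF P'(1) R(8)] L'[OF P'(2) R(7)] L'[OF P'(3) order_refl]
        by (simp only: P' R(4-6) ne simp_thms if_True if_False add_0_left add_0_right)
      then show False
        using ne(1) xy sg[of P] by (auto split: if_splits)
    next
      case 3
      then have R: "P' \<le> R" "Q' \<le> R" "R' \<le> R" "P' \<noteq> R" "Q' \<noteq> R" "R' \<noteq> R"
        using lt N sorted by auto
      define x y where "x \<longleftrightarrow> 2 * P + 2 \<le> N - R" and "y \<longleftrightarrow> N - R \<le> 2 * P + 2"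
      \<comment> \<open>All contributions are now on the left. Only \<open>Q = P\<close> could turn
        the terms of size 1 into \<open>- 2\<close>, but then \<open>N - R = 2 * P\<close> lies
        below \<open>2 * P + 2\<close>.\<close>
      have ne: "\<not> (Q = P \<and> x)" "R \<noteq> P" "P \<noteq> R" using 3 N pos lt sorted by (auto simp: x_def)
      have xy: "x \<or> y" by (auto simp: x_def y_def)
      note L' = L[OF pos(1) _ _ b(2), folded x_def y_def]
      have "(if x then - ((- 1) ^ P) else 0) + ((if Q = P \<and> x then - ((- 1) ^ P) else 0)
          + (if Q = R \<and> y then 2 else 0)) + (if y then 2 else (0 :: real)) = 0"
        using c[of "min (2 * P + 2) (N - R)"]
        unfolding L'[OF order_refl PR] L'[OF sorted(1,2)] L'[OF PR order_refl]
          L'[OF P'(1) R(1)] L'[OF P'(2) R(2)] L'[OF P'(3) R(3)]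
        by (simp only: P' R(4-6) ne simp_thms if_True if_False add_0_left add_0_right)
      then show False
        using ne(1) xy sg[of P] by (auto split: if_splits)
    qed
  qed
  show "\<not> Q < Q'" if "P = P'"
  proof
    assume lt: "Q < Q'"
    then have R: "Q \<le> Q'" "Q \<le> R'" "Q' \<le> R" "R' \<le> R" "Q' \<noteq> Q" "R' \<noteq> Q" "Q' \<noteq> R" "R' \<noteq> R" "Q \<noteq> R"
      using N that sorted by auto
    have "0 < Q" using pos sorted by simp
    define x y where "x \<longleftrightarrow> 2 * Q + 2 \<le> N - R" and "y \<longleftrightarrow> N - R \<le> 2 * Q + 2"
    have xy: "x \<or> y" by (auto simp: x_def y_def)
    note L' = L[OF \<open>0 < Q\<close> _ _ b(2), folded x_def y_def]
    have "coeff (theta_part N Q) (min (2 * Q + 2) (N - R)) + coeff (theta_part N R) (min (2 * Q + 2) (N - R))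
      = coeff (theta_part N Q') (min (2 * Q + 2) (N - R)) + coeff (theta_part N R') (min (2 * Q + 2) (N - R))"
      using c[of "min (2 * Q + 2) (N - R)"] that by simp
    then have "(if x then - ((- 1) ^ Q) else 0) + (if y then 2 else (0 :: real)) = 0"
      unfolding L'[OF order_refl sorted(2)] L'[OF sorted(2) order_refl] L'[OF R(1,3)] L'[OF R(2,4)]
      by (simp only: R(5-) R(9)[symmetric] simp_thms if_True if_False add_0_left add_0_right)
    then show False using xy sg[of Q] by (auto split: if_splits)
  qed
qed

lemma theta_series_inj:
  assumes pos: "0 < P" "0 < P'" and sorted: "P \<le> Q" "Q \<le> R" "P' \<le> Q'" "Q' \<le> R'"
    and N: "P + Q + R = P' + Q' + R'"
    and eq: "theta_series P Q R = theta_series P' Q' R'"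
  shows "P = P' \<and> Q = Q' \<and> R = R'"
proof -
  define N where "N = P + Q + R"
  have N': "P' + Q' + R' = N" using assms(7) by (simp add: N_def)
  have e: "theta_part N P + theta_part N Q + theta_part N R
      = theta_part N P' + theta_part N Q' + theta_part N R'"
    using eq unfolding theta_series_def Let_def N' N_def[symmetric]
    by (simp only: add.assoc add_left_cancel)
  note less = theta_parts_not_less[OF pos sorted N_def[symmetric] N' e]
    theta_parts_not_less[OF pos(2,1) sorted(3,4,1,2) N' N_def[symmetric] e[symmetric]]
  have "P = P'" using less(1,3) by simp
  moreover have "Q = Q'" using less(2,4) calculation by simp
  ultimately show ?thesis using N by simp
qed

section \<open>Odd powers of \<open>s\<close> when all lengths are even\<close>

lemma coeff_odd:
  fixes a0 a1 a2 a3 a4 :: real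
  assumes "odd k"
  shows "coeff [:a0, a1, a2:] k = (if k = 1 then a1 else 0)"
    and "coeff [:a0, a1, a2, a3, a4:] k = (if k = 1 then a1 else if k = 3 then a3 else 0)"
proof -
  obtain j where "k = Suc (2 * j)" using assms by (auto elim!: oddE)
  then show "coeff [:a0, a1, a2:] k = (if k = 1 then a1 else 0)"
    "coeff [:a0, a1, a2, a3, a4:] k = (if k = 1 then a1 else if k = 3 then a3 else 0)"
    by (cases j; cases "j - 1"; simp add: numeral_3_eq_3)+
qed

lemma coeff_monom_mult_odd:
  fixes a a0 a1 a2 a3 a4 :: real
  assumes "odd n" "even m"
  shows "coeff (monom a m * [:a0, a1, a2:]) n = (if n = m + 1 then a * a1 else 0)"
    and "coeff (monom a m * [:a0, a1, a2, a3, a4:]) n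
      = (if n = m + 1 then a * a1 else if n = m + 3 then a * a3 else 0)"
  unfolding coeff_monom_mult using assms
  by (auto simp: coeff_odd simp del: coeff_pCons coeff_pCons_Suc)

text \<open>All monomials have even exponents, so only odd coefficients of the fixed factors
  survive. The quartic \<open>(1 + s\<^sup>2)\<^sup>2\<close> has none, and the linear terms of
  \<open>(1 + s)\<^sup>2\<close> and of \<open>- (1 - s)\<^sup>2\<close> are both
  \<open>2 * s\<close>; hence no negative contributions.\<close>

lemma coeff_theta_part_odd:
  assumes "even P" "even N" "P < N" "odd n"
  shows "coeff (theta_part N P) n
    = (if n = 2 * P + 3 then 2 else 0) + (if n = 2 * (N - P) + 1 then 2 else 0)"
proof -
  have ev: "even (2 * P + 2)" "even (2 * (N - P))" "even (N - P)" "even (N + P)" using assms by auto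
  have n: "2 * P + 2 + 1 = 2 * P + 3" by simp
  show ?thesis
    unfolding theta_part_def coeff_add coeff_diff coeff_monom_mult_odd(1)[OF assms(4) ev(1)]
      coeff_monom_mult_odd(1)[OF assms(4) ev(2)] coeff_monom_mult_odd(2)[OF assms(4) ev(3)]
      coeff_monom_mult_odd(2)[OF assms(4) ev(4)] neg_one_even_power[OF assms(1)]
      neg_one_even_power[OF ev(4)] mult_zero_right if_cancel n
    by (simp only: mult_1 diff_0_right add_0_right if_distrib[of uminus] split: if_split) simp
qed

lemma coeff_theta_series_odd:
  assumes "even P" "even Q" "even R" "0 < P" "0 < Q" "0 < R" "odd n"
  defines "N \<equiv> P + Q + R"
  defines "c \<equiv> \<lambda>P. (if n = 2 * P + 3 then 2 else 0) + (if n = 2 * (N - P) + 1 then 2 else 0)"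
  shows "coeff (theta_series P Q R) n = (if n = 1 then -2 else if n = 3 then -4 else 0)
    - (if n = 2 * N + 1 then 4 else if n = 2 * N + 3 then 2 else 0) + c P + c Q + c R"
proof -
  have N: "even N" "P < N" "Q < N" "R < N" "even (2 * N)" using assms by (auto simp: N_def)
  show ?thesis
    unfolding theta_series_def Let_def N_def[symmetric] coeff_add coeff_diff c_def
      coeff_theta_part_odd[OF assms(1) N(1,2) assms(7)] coeff_theta_part_odd[OF assms(2) N(1,3) assms(7)]
      coeff_theta_part_odd[OF assms(3) N(1,4) assms(7)]
    by (simp only: coeff_monom_mult_odd[OF assms(7) N(5)] coeff_odd[OF assms(7)]) (use N in simp)
qed

lemma coeff_theta_series_odd_bounds:
  assumes "even P" "even Q" "even R" "0 < P" "0 < Q" "0 < R" "odd n"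
  shows "coeff (theta_series P Q R) n \<le> 6"
    and "5 \<le> n \<Longrightarrow> n < 2 * (P + Q + R) \<Longrightarrow> 0 \<le> coeff (theta_series P Q R) n"
    and "coeff (theta_series P Q R) 1 = -2" "coeff (theta_series P Q R) 3 = -4"
proof -
  let ?N = "P + Q + R"
  define f g :: "nat \<Rightarrow> real" where "f S = (if n = 2 * S + 3 then 2 else 0)"
    and "g S = (if n = 2 * (?N - S) + 1 then 2 else 0)" for S
  have f: "0 \<le> f S" "f S \<le> 2" and g: "0 \<le> g S" "g S \<le> 2" for S
    by (simp_all add: f_def g_def)
  \<comment> \<open>Modulo 4 the two exponents are 3 and 1, because \<open>S\<close> and
    \<open>?N - T\<close> are even. So at most three of the six possible contributions of 2 occur
    together, which gives the bound 6.\<close>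
  have fg: "f S = 0 \<or> g T = 0" if "even S" "even T" for S T
  proof -
    have "even (?N - T)" using assms that by simp
    then have "n \<noteq> 2 * S + 3 \<or> n \<noteq> 2 * (?N - T) + 1" using that by presburger
    then show ?thesis unfolding f_def g_def by argo
  qed
  have c: "coeff (theta_series P Q R) n = (if n = 1 then -2 else if n = 3 then -4 else 0)
    - (if n = 2 * ?N + 1 then 4 else if n = 2 * ?N + 3 then 2 else 0)
    + (f P + g P) + (f Q + g Q) + (f R + g R)"
    unfolding f_def g_def by (rule coeff_theta_series_odd[OF assms])
  have le: "(if n = 1 then -2 else if n = 3 then -4 else 0)
    - (if n = 2 * ?N + 1 then 4 else if n = 2 * ?N + 3 then 2 else 0) \<le> (0 :: real)" by simp
  show "coeff (theta_series P Q R) n \<le> 6"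
  proof (cases "f P = 0 \<and> f Q = 0 \<and> f R = 0")
    case True
    then show ?thesis unfolding c using le g[of P] g[of Q] g[of R] by linarith
  next
    case False
    then have "g P = 0" "g Q = 0" "g R = 0" using fg assms by blast+
    then show ?thesis unfolding c using le f[of P] f[of Q] f[of R] by linarith
  qed
  show "0 \<le> coeff (theta_series P Q R) n" if "5 \<le> n" "n < 2 * ?N"
  proof -
    have "n \<noteq> 1" "n \<noteq> 3" "n \<noteq> 2 * ?N + 1" "n \<noteq> 2 * ?N + 3" using that by auto
    then show ?thesis unfolding c using f g by (simp add: add_nonneg_nonneg)
  qed
  have "2 \<le> P" "2 \<le> Q" "2 \<le> R" using assms(1-6) by (auto elim!: evenE)
  then show "coeff (theta_series P Q R) 1 = -2" "coeff (theta_series P Q R) 3 = -4"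
    using coeff_theta_series_odd[OF assms(1-6), of 1] coeff_theta_series_odd[OF assms(1-6), of 3]
    by simp_all
qed

lemma coeff_cycle_series_mult:
  assumes "even c"
  shows "coeff (cycle_series c * p) n = coeff p n + (if c \<le> n then 2 * coeff p (n - c) else 0)
    + (if 2 * c \<le> n then coeff p (n - 2 * c) else 0)"
  unfolding cycle_series_def epsilon_def distrib_right coeff_add coeff_monom_mult using assms by simp

text \<open>Below \<open>m + 4 \<le> 2 * m\<close> neither products of terms from two cycles nor the
  terms \<open>epsilon c\<close> are visible, so each cycle of length \<open>n\<close> just adds
  2.\<close>

lemma coeff_cycles_series_low:
  assumes "\<forall>c\<in>set cs. even c \<and> m \<le> c" "even m" "4 \<le> m" "n < m + 4"
  shows "coeff (prod_list (map cycle_series cs)) n = (if n = 0 then 1 else 2 * real (count_list cs n))"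
  using assms(1,4)
proof (induction cs arbitrary: n)
  case Nil
  then show ?case by (simp add: coeff_1)
next
  case (Cons c cs)
  let ?p = "prod_list (map cycle_series cs)"
  have c: "even c" "m \<le> c" using Cons.prems by auto
  have IH: "coeff ?p k = (if k = 0 then 1 else 2 * real (count_list cs k))" if "k < m + 4" for k
    using Cons.IH[of k] Cons.prems that by simp
  have cnt: "count_list cs k = 0" if "k < m" for k
    using Cons.prems(1) that by (intro count_notin) auto
  have "coeff ?p (n - c) = (if n = c then 1 else 0)" if "c \<le> n"
    using IH[of "n - c"] cnt[of "n - c"] that Cons.prems(2) c assms(3) by auto
  then show ?case
    using IH[of n] c Cons.prems(2) assms(3)
    by (auto simp: coeff_cycle_series_mult)
qed

lemma coeff_mult_low:
  fixes p q :: "real poly"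
  assumes "coeff q 0 = 1" "\<forall>j. 0 < j \<and> j < m \<longrightarrow> coeff q j = 0" "coeff q (m + 1) = 0" "coeff q (m + 3) = 0"
    and "0 < m"
  shows "coeff (p * q) (m + 1) = coeff p (m + 1) + coeff q m * coeff p 1"
    and "coeff (p * q) (m + 3) = coeff p (m + 3) + coeff q m * coeff p 3 + coeff q (m + 2) * coeff p 1"
proof -
  have "coeff (p * q) (m + 1) = (\<Sum>j\<le>m + 1. coeff q j * coeff p (m + 1 - j))"
    by (simp add: mult.commute[of p] coeff_mult)
  also have "\<dots> = (\<Sum>j\<in>{0, m}. coeff q j * coeff p (m + 1 - j))"
    using assms by (intro sum.mono_neutral_right) (auto simp: le_Suc_eq)
  finally show "coeff (p * q) (m + 1) = coeff p (m + 1) + coeff q m * coeff p 1"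
    using assms by simp
  have "coeff (p * q) (m + 3) = (\<Sum>j\<le>m + 3. coeff q j * coeff p (m + 3 - j))"
    by (simp add: mult.commute[of p] coeff_mult)
  also have "\<dots> = (\<Sum>j\<in>{0, m, m + 2}. coeff q j * coeff p (m + 3 - j))"
  proof (intro sum.mono_neutral_right ballI)
    fix j assume j: "j \<in> {..m + 3} - {0, m, m + 2}"
    then have "0 < j \<and> j < m \<or> j = m + 1 \<or> j = m + 3" by auto
    then show "coeff q j * coeff p (m + 3 - j) = 0" using assms by auto
  qed auto
  finally show "coeff (p * q) (m + 3) = coeff p (m + 3) + coeff q m * coeff p 3 + coeff q (m + 2) * coeff p 1"
    using assms by simp
qed

lemma coeff_times_cycles_low:
  assumes "\<forall>c\<in>set cs. even c \<and> m \<le> c" "even m" "4 \<le> m"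
  defines "q \<equiv> prod_list (map cycle_series cs)"
  shows "coeff (p * q) (m + 1) = coeff p (m + 1) + 2 * real (count_list cs m) * coeff p 1"
    and "coeff (p * q) (m + 3) = coeff p (m + 3) + 2 * real (count_list cs m) * coeff p 3
      + 2 * real (count_list cs (m + 2)) * coeff p 1"
proof -
  have q: "coeff q n = (if n = 0 then 1 else 2 * real (count_list cs n))" if "n < m + 4" for n
    unfolding q_def using coeff_cycles_series_low[OF assms(1-3) that] .
  have "count_list cs j = 0" if "j < m \<or> odd j" for j
    using assms(1,2) that by (intro count_notin) auto
  have "coeff q 0 = 1" "\<forall>j. 0 < j \<and> j < m \<longrightarrow> coeff q j = 0" "coeff q (m + 1) = 0" "coeff q (m + 3) = 0"
    "0 < m"
    using q \<open>\<And>j. j < m \<or> odd j \<Longrightarrow> count_list cs j = 0\<close> assms(2,3) by simp_all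
  note low = coeff_mult_low[OF this, of p]
  show "coeff (p * q) (m + 1) = coeff p (m + 1) + 2 * real (count_list cs m) * coeff p 1"
    "coeff (p * q) (m + 3) = coeff p (m + 3) + 2 * real (count_list cs m) * coeff p 3
      + 2 * real (count_list cs (m + 2)) * coeff p 1"
    unfolding low using q[of m] q[of "m + 2"] assms(3) by simp_all
qed

text \<open>A calculation modulo \<open>s ^ (m + 4)\<close>: as \<open>4 \<le> m\<close>, everything
  of order \<open>s ^ (2 * m)\<close> disappears, and so do the products of
  \<open>epsilon K\<close>, which is divisible by \<open>s ^ 4\<close>, with terms of order
  \<open>s ^ m\<close>. What remains is \<open>?low\<close>.\<close>

lemma coeff_dumbbell_series_low:
  assumes ev: "even A" "even B" "even K" "0 < K" and m: "m \<le> A" "m \<le> B" "4 \<le> m" "even m"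
    and n: "n < m + 4" "odd n"
  shows "coeff (dumbbell_series A B K) n = (if n = 1 then -2 else if n = 3 then -4 else 0)
    + (if n = A + 1 \<or> n = A + 3 then -2 else 0) + (if n = B + 1 \<or> n = B + 3 then -2 else 0)
    + (if n = 2 * K + 3 then 2 else 0)"
proof -
  let ?d = "monom 1 (m + 4) :: real poly"
  let ?low = "[:1, -2, 5, -4, 4:] + monom 2 A * [:1, -1, 3, -1, 2:] + monom 2 B * [:1, -1, 3, -1, 2:]
    - monom 1 (2 * K + 2) * [:1, -2, 1:] :: real poly"
  let ?u = "\<lambda>A. epsilon A * [:1, 1:] + monom 2 A * [:1, 0, 1:]"
  let ?h = "\<lambda>A. epsilon A * [:2, 1, 1:] + monom 2 A * [:1, 0, 1:]"
  have dm: "?d dvd monom a k" if "m + 4 \<le> k" for a k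
    using that by (intro dvdI[of _ _ "monom a (k - (m + 4))"]) (simp add: mult_monom)
  have de: "?d dvd epsilon A" "?d dvd epsilon B"
    unfolding epsilon_def using m by (intro dm; simp)+
  have da: "monom 1 m dvd monom a k" if "m \<le> k" for a :: real and k
    using that by (intro dvdI[of _ _ "monom a (k - m)"]) (simp add: mult_monom)
  have da': "monom 1 m dvd epsilon S" "(monom 1 m :: real poly) dvd monom 2 S" if "m \<le> S" for S
    unfolding epsilon_def using that by (intro da; simp)+
  have m1: "(monom 1 m :: real poly) dvd ?u A" "(monom 1 m :: real poly) dvd ?u B"
    "(monom 1 m :: real poly) dvd ?h A" "(monom 1 m :: real poly) dvd ?h B"
    by (intro dvd_add dvd_mult2 da' m(1,2))+
  have d4: "?d dvd monom 1 m * monom 1 m" using m by (simp add: mult_monom dm)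
  have uu: "?d dvd ?u A * ?u B" using mult_dvd_mono[OF m1(1,2)] d4 dvd_trans by blast
  have "2 \<le> K" using ev(3,4) by (auto elim!: evenE)
  have ev2K: "even (2 * K + 2)" by simp
  have "(monom 1 4 :: real poly) dvd epsilon K"
    unfolding epsilon_def using \<open>2 \<le> K\<close>
    by (intro dvdI[of _ _ "monom ((-1) ^ K) (2 * K - 4)"]) (simp add: mult_monom)
  then have eK: "?d dvd epsilon K * p" if "monom 1 m dvd p" for p
  proof -
    have "?d = monom 1 4 * monom 1 m" by (simp add: mult_monom add.commute)
    then show ?thesis using mult_dvd_mono[OF \<open>monom 1 4 dvd epsilon K\<close> that] by simp
  qed
  have "dumbbell_series A B K - ?low =
      [:1, -1, 2:] * (epsilon A * [:1, 1:]) + [:1, -1, 2:] * (epsilon B * [:1, 1:])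
      + ?u A * ?u B - epsilon K * ([:0, -1, 1:] * ?h A + [:0, -1, 1:] * ?h B + ?h A * ?h B)"
  proof -
    have e: "[:1, -2, 5, -4, 4:] = [:1, -1, 2:] * [:1, -1, 2 :: real:]"
      "[:1, -1, 3, -1, 2:] = [:1, -1, 2:] * [:1, 0, 1 :: real:]" by simp_all
    have eps: "monom 1 (2 * K + 2) * [:1, -2, 1:] = epsilon K * ([:0, -1, 1:] * [:0, -1, 1 :: real:])"
    proof -
      have "monom 1 (2 * K + 2) = epsilon K * (monom 1 2 :: real poly)"
        using ev by (simp add: epsilon_def mult_monom)
      moreover have "monom 1 2 * [:1, -2, 1:] = [:0, -1, 1:] * [:0, -1, 1 :: real:]"
        by (simp add: monom_altdef power2_eq_square)
      ultimately show ?thesis by (metis mult.assoc)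
    qed
    show ?thesis unfolding dumbbell_series_def Let_def e eps
      by (simp only: algebra_simps)
  qed
  moreover have "?d dvd \<dots>"
    by (intro dvd_add dvd_diff uu eK dvd_mult[OF dvd_mult2[OF de(1)]] dvd_mult[OF dvd_mult2[OF de(2)]]
        dvd_mult[OF m1(3)] dvd_mult[OF m1(4)])
  ultimately obtain w where "dumbbell_series A B K = ?low + ?d * w"
    by (metis add.commute diff_add_cancel dvdE)
  then have "coeff (dumbbell_series A B K) n = coeff ?low n"
    unfolding \<open>dumbbell_series A B K = _\<close> coeff_add[of _ "?d * w"] coeff_monom_mult[of _ _ w]
    using n(1) by simp
  also have "\<dots> = (if n = 1 then -2 else if n = 3 then -4 else 0)
    + (if n = A + 1 \<or> n = A + 3 then -2 else 0) + (if n = B + 1 \<or> n = B + 3 then -2 else 0)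
    + (if n = 2 * K + 3 then 2 else 0)"
    unfolding coeff_add coeff_diff coeff_odd(2)[OF n(2)] coeff_monom_mult_odd(2)[OF n(2) ev(1)]
      coeff_monom_mult_odd(2)[OF n(2) ev(2)] coeff_monom_mult_odd(1)[OF n(2) ev2K] by auto
  finally show ?thesis .
qed

theorem theta_poly_eq_theta_times_cycles:
  assumes pos: "0 < P" "0 < P'" and sorted: "P \<le> Q" "Q \<le> R" "P' \<le> Q'" "Q' \<le> R'"
    and cs: "\<forall>c\<in>set cs. 3 \<le> c" and N: "P + Q + R = P' + Q' + R' + sum_list cs"
    and eq: "theta_poly P Q R = theta_poly P' Q' R' * cycles_poly cs"
  shows "cs = [] \<and> P = P' \<and> Q = Q' \<and> R = R'"
proof -
  have pos': "0 < P" "0 < Q" "0 < R" "0 < P'" "0 < Q'" "0 < R'" using pos sorted by auto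
  note series = theta_series_eq_theta_times_cycles[OF pos' cs N eq]
  have "cs = []"
  proof (rule ccontr)
    assume ne: "cs \<noteq> []"
    have ev: "even P" "even Q" "even R" "even P'" "even Q'" "even R'"
      using theta_poly_eq_theta_times_cycles_even[OF pos' cs ne eq] by auto
    have even_cs: "even c" if "c \<in> set cs" for c
      using even_cycles[OF ev(1-3) pos'(1-3) eq that] .
    define m where "m = Min (set cs)"
    have m: "m \<in> set cs" "\<And>c. c \<in> set cs \<Longrightarrow> m \<le> c" using ne by (simp_all add: m_def)
    have m4: "even m" "4 \<le> m"
    proof -
      show "even m" using even_cs[OF m(1)] .
      moreover have "3 \<le> m" using cs m(1) by blast
      ultimately show "4 \<le> m" by presburger
    qed
    have "m \<le> sum_list cs" using m(1) member_le_sum_list by blast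
    then have lt: "m + 3 < 2 * (P + Q + R)" using N pos' by simp
    have odd: "odd (m + 3)" using m4 by simp
    note b = coeff_theta_series_odd_bounds[OF ev(1-3) pos'(1-3) odd]
    note b' = coeff_theta_series_odd_bounds[OF ev(4-6) pos'(4-6) odd]
    have cyc: "\<forall>c\<in>set cs. even c \<and> m \<le> c" using even_cs m by auto
    \<comment> \<open>The exponent \<open>m + 3\<close> exploits the coefficient \<open>- 4\<close>
      at \<open>s ^ 3\<close>: a shortest cycle costs 8 here, more than the bound 6, while at
      \<open>m + 1\<close> it would cost only 4.\<close>
    have "0 \<le> coeff (theta_series P Q R) (m + 3)" using b(2) m4(2) lt by simp
    also have "\<dots> = coeff (theta_series P' Q' R') (m + 3) - 8 * real (count_list cs m)
        - 4 * real (count_list cs (m + 2))"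
      unfolding series coeff_times_cycles_low(2)[OF cyc m4] b'(3,4) by simp
    also have "\<dots> \<le> 6 - 8 * real (count_list cs m)"
      using b'(1) m4 by simp
    finally have "count_list cs m = 0" by simp
    then show False using m(1) by (simp add: count_list_0_iff)
  qed
  moreover have "P = P' \<and> Q = Q' \<and> R = R'"
    using theta_series_inj[OF pos sorted] series N calculation by simp
  ultimately show ?thesis by blast
qed

theorem theta_poly_neq_dumbbell_times_cycles:
  assumes pos: "0 < P" "0 < Q" "0 < R" "0 < K" and AB: "3 \<le> A" "3 \<le> B"
    and cs: "\<forall>c\<in>set cs. 3 \<le> c" and N: "P + Q + R = A + B + K + sum_list cs"
  shows "theta_poly P Q R \<noteq> dumbbell_poly A B K * cycles_poly cs"
proof
  assume eq: "theta_poly P Q R = dumbbell_poly A B K * cycles_poly cs"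
  have pos': "0 < P" "0 < Q" "0 < R" "0 < A" "0 < B" "0 < K" using pos AB by auto
  note series = theta_series_eq_dumbbell_times_cycles[OF pos' cs N eq]
  have ev: "even P" "even Q" "even R" "even A" "even B" "even K"
    using theta_poly_eq_dumbbell_times_cycles_even[OF pos' cs N eq] by auto
  have even_cs: "even c" if "c \<in> set cs" for c
    using even_cycles[OF ev(1-3) pos'(1-3) eq that] .
  define m where "m = Min (insert A (insert B (set cs)))"
  have "m \<in> insert A (insert B (set cs))" unfolding m_def by (rule Min_in) auto
  moreover have "m \<le> c" if "c \<in> insert A (insert B (set cs))" for c
    unfolding m_def using that by (intro Min_le) auto
  ultimately have m: "m = A \<or> m = B \<or> m \<in> set cs" "m \<le> A" "m \<le> B" "\<And>c. c \<in> set cs \<Longrightarrow> m \<le> c"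
    by auto
  have m4: "even m" "4 \<le> m"
  proof -
    show "even m" using m(1) ev even_cs by auto
    moreover have "3 \<le> m" using m(1) AB cs by auto
    ultimately show "4 \<le> m" by presburger
  qed
  have lt: "m + 3 < 2 * (P + Q + R)" using N AB m(2) by simp
  note b = coeff_theta_series_odd_bounds(2)[OF ev(1-3) pos'(1-3)]
  note d = coeff_dumbbell_series_low[OF ev(4,5,6) pos(4) m(2,3) m4(2,1)]
  have d13: "coeff (dumbbell_series A B K) 1 = -2" "coeff (dumbbell_series A B K) 3 = -4"
    using d[of 1] d[of 3] m m4 pos by auto
  have cyc: "\<forall>c\<in>set cs. even c \<and> m \<le> c" using even_cs m by auto
  have 1: "0 \<le> coeff (dumbbell_series A B K) (m + 1) - 4 * real (count_list cs m)"
    using b[of "m + 1"] m4 lt coeff_times_cycles_low(1)[OF cyc m4, of "dumbbell_series A B K"] d13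
    unfolding series by simp
  have 3: "0 \<le> coeff (dumbbell_series A B K) (m + 3) - 8 * real (count_list cs m)
      - 4 * real (count_list cs (m + 2))"
    using b[of "m + 3"] m4 lt coeff_times_cycles_low(2)[OF cyc m4, of "dumbbell_series A B K"] d13
    unfolding series by simp
  have cnt: "m \<in> set cs \<Longrightarrow> 1 \<le> real (count_list cs m)"
    using count_list_0_iff[of cs m] by (cases "count_list cs m") auto
  \<comment> \<open>\<open>i\<close>, \<open>j\<close> and \<open>y\<close> record whether
    \<open>m\<close> is attained by a dumbbell cycle or an additional cycle, each of which lowers
    both coefficients. The only positive contributions, \<open>k\<close> and \<open>x\<close>, come
    from the connecting path at exponent \<open>2 * K + 3\<close>, which equals at most one of
    \<open>m + 1\<close> and \<open>m + 3\<close>.\<close>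
  define i j k x y :: real where "i = (if m = A then -2 else 0)" and "j = (if m = B then -2 else 0)"
    and "k = (if m + 1 = 2 * K + 3 then 2 else 0)" and "x = (if m + 3 = 2 * K + 3 then 2 else 0)"
    and "y = real (count_list cs m)"
  have "coeff (dumbbell_series A B K) (m + 1) = i + j + k"
    using d[of "m + 1"] m m4 by (auto simp: i_def j_def k_def)
  \<comment> \<open>Only an upper bound, since a dumbbell cycle of length \<open>m + 2\<close>
    lowers this coefficient further.\<close>
  moreover have "coeff (dumbbell_series A B K) (m + 3) \<le> i + j + x"
    using d[of "m + 3"] m m4 by (auto simp: i_def j_def x_def)
  ultimately have "0 \<le> i + j + k - 4 * y" "0 \<le> i + j + x - 8 * y"
    using 1 3 by (simp_all add: y_def)
  moreover have "k = 0 \<or> x = 0" "k \<le> 2" "x \<le> 2" by (auto simp: k_def x_def)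
  moreover have "i \<le> 0" "j \<le> 0" "0 \<le> y" by (simp_all add: i_def j_def y_def)
  moreover have "i = -2 \<or> j = -2 \<or> 1 \<le> y" using m(1) cnt by (auto simp: i_def j_def y_def)
  ultimately show False by linarith
qed

section \<open>Top coefficients and degrees\<close>

context neighborhood
begin

text \<open>Only diagonal entries have positive degree, and a bijection meets at most one for each
  common index.\<close>

lemma degree_pm_le:
  fixes k :: "'a \<Rightarrow> int"
  assumes "finite R" "finite C"
  shows "degree (pm (\<lambda>x. [:- k x, 1:]) R C) \<le> card (R \<inter> C)"
  using assms
proof (induction R arbitrary: C rule: finite_induct)
  case empty
  then show ?case
    by (cases "C = {}") (auto simp: pm_def minor_permanent_card)
next
  case (insert a R)
  let ?d = "\<lambda>x. [:- k x, 1:]"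
  have le: "degree (pm ?d R (C - {c})) \<le> card (insert a R \<inter> C)" for c
    using insert.IH[of "C - {c}"] insert.prems card_mono[of "insert a R \<inter> C" "R \<inter> (C - {c})"]
      insert.hyps by fastforce
  have "degree (if a \<in> C then ?d a * pm ?d R (C - {a}) else 0) \<le> card (insert a R \<inter> C)"
  proof (cases "a \<in> C")
    case True
    have "degree (?d a * pm ?d R (C - {a})) \<le> 1 + degree (pm ?d R (C - {a}))"
      by (rule order_trans[OF degree_mult_le]) simp
    also have "\<dots> \<le> 1 + card (R \<inter> (C - {a}))" using insert.IH[of "C - {a}"] insert.prems by simp
    also have "\<dots> = card (insert a R \<inter> C)"
    proof -
      have "insert a R \<inter> C = insert a (R \<inter> (C - {a}))" using True insert.hyps by auto
      then show ?thesis using insert.hyps by simp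
    qed
    finally show ?thesis using True by simp
  qed simp
  moreover have "degree (\<Sum>c\<in>N a. if c \<in> C then pm ?d R (C - {c}) else 0) \<le> card (insert a R \<inter> C)"
    using le by (intro degree_sum_le finite_N) auto
  ultimately show ?case
    unfolding pm_row[OF insert.hyps(1) insert.prems insert.hyps(2)] by (rule degree_add_le)
qed

lemma coeff_pm_card:
  fixes k :: "'a \<Rightarrow> int"
  assumes "finite V"
  shows "coeff (pm (\<lambda>x. [:- k x, 1:]) V V) (card V) = 1"
  using assms
proof (induction V rule: finite_induct)
  case (insert a V)
  let ?d = "\<lambda>x. [:- k x, 1:]"
  have V: "insert a V - {a} = V" using insert.hyps by auto
  have "degree (pm ?d V C) < card (insert a V)" if "finite C" for C
    using degree_pm_le[of V C k] card_mono[of V "V \<inter> C"] insert.hyps that by simp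
  then have "coeff (pm ?d V C) (card (insert a V)) = 0" if "finite C" for C
    using that by (intro coeff_eq_0)
  moreover have "coeff (pm ?d V V) (card (insert a V)) = 0" using calculation insert.hyps by blast
  ultimately have "coeff (\<Sum>c\<in>N a. if c \<in> insert a V then pm ?d V (insert a V - {c}) else 0) (card (insert a V)) = 0"
    unfolding coeff_sum using insert.hyps by (intro sum.neutral ballI) auto
  moreover have "coeff (?d a * pm ?d V V) (card (insert a V)) = 1"
    using insert \<open>coeff (pm ?d V V) (card (insert a V)) = 0\<close> by simp
  ultimately show ?case
    using insert.hyps by (subst pm_row) (simp_all only: V coeff_add finite_insert if_True insertI1 add_0_right not_False_eq_True)
qed simp

end

text \<open>Coefficients counted from the top; without the guard, truncated subtraction would return
  the constant coefficient for \<open>n < i\<close>.\<close>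

definition top_coeff :: "nat \<Rightarrow> 'b::zero poly \<Rightarrow> nat \<Rightarrow> 'b" where
  "top_coeff n p i = (if i \<le> n then coeff p (n - i) else 0)"

context neighborhood
begin

text \<open>Besides the identity, only transpositions along edges reach degree
  \<open>card V - 2\<close>. So the last of these coefficients is the second elementary symmetric
  function of the \<open>k x\<close> plus the number of edges; doubling it avoids divisions.\<close>

lemma top_coeff_pm:
  fixes k :: "'a \<Rightarrow> int"
  assumes "finite V"
  defines "d \<equiv> \<lambda>x. [:- k x, 1:]"
  shows "top_coeff (card V) (pm d V V) 0 = 1 \<and> top_coeff (card V) (pm d V V) 1 = - (\<Sum>x\<in>V. k x)
    \<and> 2 * top_coeff (card V) (pm d V V) 2
      = (\<Sum>x\<in>V. k x)\<^sup>2 - (\<Sum>x\<in>V. (k x)\<^sup>2) + (\<Sum>x\<in>V. int (card (N x \<inter> V)))"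
  using assms(1)
proof (induction V rule: finite_induct)
  case empty
  then show ?case by (simp add: top_coeff_def)
next
  case (insert a V)
  let ?n = "card V" and ?p = "pm d V V" and ?S = "N a \<inter> V"
  define s where "s = (\<Sum>c\<in>?S. \<Sum>r\<in>?S. pm d (V - {r}) (V - {c}))"
  have p: "pm d (insert a V) (insert a V) = d a * ?p + s"
  proof -
    have "(\<Sum>c\<in>N a. if c \<in> insert a V then pm d V (insert a V - {c}) else 0)
        = (\<Sum>c\<in>N a. if c \<in> V then (\<Sum>r\<in>?S. pm d (V - {r}) (V - {c})) else 0)"
    proof (intro sum.cong refl)
      fix c assume c: "c \<in> N a"
      then have "c \<noteq> a" using irrefl by blast
      then have "insert a V - {c} = insert a (V - {c})" by auto
      then show "(if c \<in> insert a V then pm d V (insert a V - {c}) else 0)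
        = (if c \<in> V then (\<Sum>r\<in>?S. pm d (V - {r}) (V - {c})) else 0)"
        using insert.hyps \<open>c \<noteq> a\<close> finite_N by (simp add: pm_col sum.inter_restrict)
    qed
    moreover have "insert a V - {a} = V" using insert.hyps by auto
    ultimately show ?thesis using insert.hyps finite_N
      by (simp add: pm_row s_def sum.inter_restrict[symmetric])
  qed
  \<comment> \<open>A minor with \<open>r \<noteq> c\<close> has lost two common indices, so it is
    invisible at degree \<open>?n - 1\<close>, where only \<open>r = c\<close> counts.\<close>
  have d2: "coeff (pm d (V - {r}) (V - {c})) i = 0"
    if "r \<in> V" "c \<in> V" "?n \<le> i \<or> r \<noteq> c \<and> ?n \<le> Suc i" for r c i
  proof -
    have e: "(V - {r}) \<inter> (V - {c}) = V - {r, c}" by auto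
    have "card (V - {r, c}) = ?n - card {r, c}"
      using that insert.hyps by (subst card_Diff_subset) auto
    moreover have "card {r, c} \<le> ?n" using that insert.hyps by (intro card_mono) auto
    moreover have "card {r, c} \<noteq> 0" by simp
    ultimately have "card ((V - {r}) \<inter> (V - {c})) < i"
      unfolding e using that by (cases "r = c") auto
    then show ?thesis using degree_pm_le[of "V - {r}" "V - {c}" k] insert.hyps
      by (intro coeff_eq_0) (auto simp: d_def)
  qed
  have s0: "coeff s i = 0" if "?n \<le> i" for i
    unfolding s_def coeff_sum using that by (intro sum.neutral ballI d2) auto
  have s1: "coeff s i = int (card ?S)" if i: "?n = Suc i" for i
  proof -
    have "(\<Sum>r\<in>?S. coeff (pm d (V - {r}) (V - {c})) i) = 1" if c: "c \<in> ?S" for c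
    proof -
      have "(\<Sum>r\<in>?S. coeff (pm d (V - {r}) (V - {c})) i)
        = coeff (pm d (V - {c}) (V - {c})) i + (\<Sum>r\<in>?S - {c}. coeff (pm d (V - {r}) (V - {c})) i)"
        using c finite_N by (intro sum.remove) auto
      also have "(\<Sum>r\<in>?S - {c}. coeff (pm d (V - {r}) (V - {c})) i) = 0"
        using c i by (intro sum.neutral ballI d2) auto
      also have "coeff (pm d (V - {c}) (V - {c})) i = 1"
        using coeff_pm_card[of "V - {c}" k] c i insert.hyps by (simp add: d_def)
      finally show ?thesis by simp
    qed
    then show ?thesis unfolding s_def coeff_sum by simp
  qed
  let ?K = "\<Sum>x\<in>V. k x"
  have deg: "(\<Sum>x\<in>insert a V. int (card (N x \<inter> insert a V)))
    = (\<Sum>x\<in>V. int (card (N x \<inter> V))) + 2 * int (card ?S)"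
  proof -
    have "N a \<inter> insert a V = ?S" using irrefl by auto
    moreover have "(\<Sum>x\<in>V. int (card (N x \<inter> insert a V)))
      = (\<Sum>x\<in>V. int (card (N x \<inter> V)) + (if x \<in> N a then 1 else 0))"
    proof (intro sum.cong refl)
      fix x assume "x \<in> V"
      have "a \<in> N x \<longleftrightarrow> x \<in> N a" using sym by blast
      then show "int (card (N x \<inter> insert a V)) = int (card (N x \<inter> V)) + (if x \<in> N a then 1 else 0)"
        using insert.hyps finite_N[of x] by auto
    qed
    moreover have "(\<Sum>x\<in>V. if x \<in> N a then 1 else (0 :: int)) = int (card ?S)"
      using insert.hyps by (simp add: sum.inter_restrict[symmetric] Int_commute)
    ultimately show ?thesis using insert.hyps by (simp add: sum.distrib)
  qed
  have co: "coeff (pm d (insert a V) (insert a V)) i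
    = - k a * coeff ?p i + (if i = 0 then 0 else coeff ?p (i - 1)) + coeff s i" for i
    unfolding p by (cases i) (simp_all add: d_def)
  have n: "coeff ?p (Suc ?n) = 0" "coeff ?p ?n = 1"
    using degree_pm_le[of V V k] coeff_pm_card[of V k] insert.hyps by (auto simp: d_def intro!: coeff_eq_0)
  consider "?n = 0" | "?n = 1" | j where "?n = Suc (Suc j)"
    by (cases ?n; cases "?n - 1") auto
  then show ?case
  proof cases
    case 1
    then have "V = {}" using insert.hyps by simp
    then have "pm d {a} {a} = d a" using p by (simp add: s_def)
    then show ?thesis using \<open>V = {}\<close> irrefl[of a] by (simp add: top_coeff_def d_def)
  next
    case 2
    then show ?thesis
      using insert s0[of 1] s0[of 2] s1[of 0] n unfolding deg
      by (simp add: top_coeff_def co power2_eq_square algebra_simps numeral_2_eq_2)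
  next
    case 3
    then show ?thesis
      using insert s0[of "Suc (Suc j)"] s0[of "Suc (Suc (Suc j))"] s1[of "Suc j"] n unfolding deg
      by (simp add: top_coeff_def co power2_eq_square algebra_simps numeral_2_eq_2)
  qed
qed

end

section \<open>Theta graphs and the Laplacian permanental polynomial\<close>

text \<open>For integers, \<open>e\<^sup>2 - e\<close> is nonnegative and vanishes only at 0 and 1.
  Equality of the two sums therefore forces each \<open>k x - 2\<close> to be 0 or 1.\<close>

lemma two_vertices_of_degree_3:
  fixes k :: "'a \<Rightarrow> nat"
  assumes "finite V" "(\<Sum>x\<in>V. int (k x) - 2) = 2" "(\<Sum>x\<in>V. (int (k x) - 2)\<^sup>2) = 2"
  obtains u v where "u \<in> V" "v \<in> V" "u \<noteq> v" "k u = 3" "k v = 3" "\<And>x. x \<in> V - {u, v} \<Longrightarrow> k x = 2"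
proof -
  let ?e = "\<lambda>x. int (k x) - 2"
  have nonneg: "0 \<le> (?e x)\<^sup>2 - ?e x" for x
  proof -
    show ?thesis
    proof (cases "1 \<le> ?e x")
      case True
      then have "?e x * 1 \<le> ?e x * ?e x" by (intro mult_left_mono) auto
      then show ?thesis by (simp add: power2_eq_square)
    next
      case False
      then show ?thesis using zero_le_power2[of "?e x"] by linarith
    qed
  qed
  have "(\<Sum>x\<in>V. (?e x)\<^sup>2 - ?e x) = 0" using assms by (simp add: sum_subtractf)
  then have "\<forall>x\<in>V. (?e x)\<^sup>2 - ?e x = 0"
    using nonneg assms(1) by (subst (asm) sum_nonneg_eq_0_iff) auto
  then have e: "?e x = 0 \<or> ?e x = 1" if "x \<in> V" for x
    using that by (force simp: power2_eq_square)
  define W where "W = {x \<in> V. k x = 3}"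
  have "(\<Sum>x\<in>V. ?e x) = (\<Sum>x\<in>V. if x \<in> W then 1 else 0)"
    using e by (intro sum.cong) (auto simp: W_def)
  also have "\<dots> = int (card (V \<inter> W))"
    using assms(1) by (simp add: sum.inter_restrict[symmetric])
  also have "V \<inter> W = W" by (auto simp: W_def)
  finally have "card W = 2" using assms(2) by simp
  then obtain u v where "W = {u, v}" "u \<noteq> v" by (auto simp: card_2_iff)
  then show ?thesis using that[of u v] e unfolding W_def by force
qed

definition nbrs :: "'a pair_pre_digraph \<Rightarrow> 'a \<Rightarrow> 'a set" where
  "nbrs G x = {w. (x, w) \<in> parcs G}"

lemma neighborhood_nbrs:
  assumes "pair_graph G"
  shows "neighborhood (nbrs G)"
proof -
  interpret pair_graph G by fact
  show ?thesis
  proof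
    show "u \<in> nbrs G w" if "w \<in> nbrs G u" for u w
      using that arcs_symmetric by (auto simp: nbrs_def)
    show "u \<notin> nbrs G u" for u
      using no_loops[of "(u, u)"] by (auto simp: nbrs_def)
    have "nbrs G u \<subseteq> snd ` parcs G" for u by (force simp: nbrs_def)
    then show "finite (nbrs G u)" for u by (rule finite_subset) simp
  qed
qed

lemma nbrs_subset:
  assumes "pair_graph G"
  shows "nbrs G x \<subseteq> pverts G"
proof -
  interpret pair_graph G by fact
  show ?thesis using arc_snd_in_verts by (force simp: nbrs_def)
qed

lemma out_degree_nbrs: "out_degree (with_proj G) x = card (nbrs G x)"
proof -
  have "out_arcs (with_proj G) x = Pair x ` nbrs G x"
    by (auto simp: out_arcs_def nbrs_def)
  then show ?thesis by (simp add: out_degree_def card_image inj_on_def)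
qed

lemma laplacian_permanental_poly_eq_pm:
  assumes "pair_graph G"
  shows "laplacian_permanental_poly G
    = neighborhood.pm (nbrs G) (\<lambda>x. [:- int (card (nbrs G x)), 1:]) (pverts G) (pverts G)"
proof -
  interpret neighborhood "nbrs G" by (rule neighborhood_nbrs[OF assms])
  have "(if u = v then [:0, 1:] else 0) - [:laplacian_matrix G u v:]
      = matrix (\<lambda>x. [:- int (card (nbrs G x)), 1:]) u v" for u v
    using irrefl[of u]
    by (auto simp: matrix_def laplacian_matrix_def degree_matrix_def adjacency_matrix_def
        out_degree_nbrs nbrs_def)
  then show ?thesis
    by (simp add: laplacian_permanental_poly_def permanent_eq_minor_permanent pm_def)
qed

section \<open>Neighborhoods in the concrete theta graph\<close>

lemma path_edges_simps:
  "path_edges [] = {}" "path_edges [x] = {}"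
  "path_edges (x # y # xs) = {(x, y), (y, x)} \<union> path_edges (y # xs)"
  by (auto simp: path_edges_def)

lemma path_edges_set: "(a, b) \<in> path_edges xs \<Longrightarrow> a \<in> set xs \<and> b \<in> set xs"
proof (induction xs)
  case (Cons x xs)
  then show ?case by (cases xs) (auto simp: path_edges_simps)
qed (simp add: path_edges_simps)

lemma path_edges_first:
  assumes "distinct (x # xs)" "xs \<noteq> []"
  shows "{w. (x, w) \<in> path_edges (x # xs)} = {hd xs}"
proof -
  obtain y ys where "xs = y # ys" using assms(2) by (cases xs) auto
  then show ?thesis using assms(1) path_edges_set[of x _ "y # ys"] by (auto simp: path_edges_simps)
qed

lemma path_edges_rev: "path_edges (rev xs) = path_edges xs"
proof -
  have "path_edges (xs @ [y]) = path_edges xs \<union> (if xs = [] then {} else {(last xs, y), (y, last xs)})"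
    for xs :: "'a list" and y
  proof (induction xs)
    case (Cons x xs)
    then show ?case by (cases xs) (auto simp: path_edges_simps)
  qed (simp add: path_edges_simps)
  note snoc = this
  show ?thesis
  proof (induction xs)
    case (Cons x xs)
    note IH = Cons.IH
    show ?case
    proof (cases xs)
      case (Cons y ys)
      then have "path_edges (rev xs @ [x]) = path_edges xs \<union> {(y, x), (x, y)}"
        using snoc[of "rev xs" x] IH by (simp add: last_rev del: rev.simps)
      then show ?thesis using Cons path_edges_simps(3)[of x y ys] by auto
    qed simp
  qed simp
qed

lemma path_edges_last:
  assumes "distinct (xs @ [x])" "xs \<noteq> []"
  shows "{w. (x, w) \<in> path_edges (xs @ [x])} = {last xs}"
  using path_edges_first[of x "rev xs"] assms path_edges_rev[of "xs @ [x]"] by (simp add: hd_rev)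

lemma thread_path_edges:
  assumes "distinct (u # as @ [v])" "\<And>a. a \<in> set as \<Longrightarrow> N a = {w. (a, w) \<in> path_edges (u # as @ [v])}"
    and "as = [] \<Longrightarrow> v \<in> N u"
  shows "thread N u as v"
  using assms
proof (induction as arbitrary: u)
  case (Cons a as)
  have pe: "path_edges (u # (a # as) @ [v]) = {(u, a), (a, u)} \<union> path_edges (a # as @ [v])"
    by (simp add: path_edges_simps)
  have "N a = {w. (a, w) \<in> path_edges (u # (a # as) @ [v])}" using Cons.prems(2) by simp
  also have "\<dots> = {u, hd (as @ [v])}"
    using path_edges_first[of a "as @ [v]"] Cons.prems(1) unfolding pe by auto
  finally have a: "N a = {u, hd (as @ [v])}" .
  have "thread N a as v"
  proof (rule Cons.IH)
    show "N b = {w. (b, w) \<in> path_edges (a # as @ [v])}" if "b \<in> set as" for b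
      using Cons.prems(1,2) that unfolding pe by auto
    show "v \<in> N a" if "as = []" using a that by simp
  qed (use Cons.prems in auto)
  then show ?case using a by simp
qed simp

lemma is_theta_theta_graph:
  assumes "\<not> (p = 0 \<and> q = 0)" "\<not> (p = 0 \<and> r = 0)" "\<not> (q = 0 \<and> r = 0)"
  shows "is_theta (nbrs (theta_graph p q r)) 0 1 [2..<p + 2] [p + 2..<p + q + 2] [p + q + 2..<p + q + r + 2]"
proof -
  define ps qs rs where "ps = [2..<p + 2]" and "qs = [p + 2..<p + q + 2]"
    and "rs = [p + q + 2..<p + q + r + 2]"
  let ?N = "nbrs (theta_graph p q r)"
  let ?P = "\<lambda>as :: nat list. path_edges (0 # as @ [1])"
  have N: "?N x = {w. (x, w) \<in> ?P ps} \<union> {w. (x, w) \<in> ?P qs} \<union> {w. (x, w) \<in> ?P rs}" for x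
    by (auto simp: nbrs_def theta_graph_def ps_def qs_def rs_def)
  have dist: "distinct (0 # 1 # ps @ qs @ rs)" by (auto simp: ps_def qs_def rs_def)
  then have d: "distinct (0 # ps @ [1])" "distinct (0 # qs @ [1])" "distinct (0 # rs @ [1])" by auto
  have first: "{w. (0, w) \<in> ?P as} = {hd (as @ [1])}" if "distinct (0 # as @ [1])" for as
    using path_edges_first[OF that] by simp
  have last: "{w. (1, w) \<in> ?P as} = {last (0 # as)}" if "distinct (0 # as @ [1])" for as
    using path_edges_last[of "0 # as" 1] that by simp
  have none: "{w. (a, w) \<in> ?P as} = {}" if "a \<notin> set (0 # as @ [1])" for a as
    using path_edges_set[of a _ "0 # as @ [1]"] that by blast
  have N0: "?N 0 = {hd (ps @ [1]), hd (qs @ [1]), hd (rs @ [1])}"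
    unfolding N first[OF d(1)] first[OF d(2)] first[OF d(3)] by auto
  have N1: "?N 1 = {last (0 # ps), last (0 # qs), last (0 # rs)}"
    unfolding N last[OF d(1)] last[OF d(2)] last[OF d(3)] by auto
  have "thread ?N 0 ps 1"
  proof (rule thread_path_edges[OF d(1)])
    fix a assume "a \<in> set ps"
    then have a: "a \<notin> set (0 # qs @ [1])" "a \<notin> set (0 # rs @ [1])" using dist by auto
    show "?N a = {w. (a, w) \<in> ?P ps}" unfolding N none[OF a(1)] none[OF a(2)] by simp
  qed (simp add: N0)
  moreover have "thread ?N 0 qs 1"
  proof (rule thread_path_edges[OF d(2)])
    fix a assume "a \<in> set qs"
    then have a: "a \<notin> set (0 # ps @ [1])" "a \<notin> set (0 # rs @ [1])" using dist by auto
    show "?N a = {w. (a, w) \<in> ?P qs}" unfolding N none[OF a(1)] none[OF a(2)] by simp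
  qed (simp add: N0)
  moreover have "thread ?N 0 rs 1"
  proof (rule thread_path_edges[OF d(3)])
    fix a assume "a \<in> set rs"
    then have a: "a \<notin> set (0 # ps @ [1])" "a \<notin> set (0 # qs @ [1])" using dist by auto
    show "?N a = {w. (a, w) \<in> ?P rs}" unfolding N none[OF a(1)] none[OF a(2)] by simp
  qed (simp add: N0)
  moreover have "\<not> (ps = [] \<and> qs = [])" "\<not> (ps = [] \<and> rs = [])" "\<not> (qs = [] \<and> rs = [])"
    using assms by (auto simp: ps_def qs_def rs_def)
  ultimately show ?thesis
    using dist N0 N1 unfolding is_theta_def ps_def qs_def rs_def by blast
qed

text \<open>Sorting leaves \<open>ps\<close> as the only list that can be empty, as the evaluation
  in \<open>pm_theta\<close> demands, and matches the sorted form in which triples of lengths are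
  compared.\<close>

lemma is_theta_sorted:
  assumes "is_theta N u v ps qs rs"
  obtains ps' qs' rs' where "is_theta N u v ps' qs' rs'" "length ps' \<le> length qs'"
    "length qs' \<le> length rs'" "set (u # v # ps' @ qs' @ rs') = set (u # v # ps @ qs @ rs)"
proof -
  have swap: "is_theta N u v xs zs ys" "is_theta N u v ys xs zs" if "is_theta N u v xs ys zs" for xs ys zs
    using that by (auto simp: is_theta_def)
  have s: "is_theta N u v ps rs qs" "is_theta N u v qs ps rs" "is_theta N u v qs rs ps"
    "is_theta N u v rs ps qs" "is_theta N u v rs qs ps"
    using assms swap by blast+
  consider "length ps \<le> length qs \<and> length qs \<le> length rs" | "length ps \<le> length rs \<and> length rs \<le> length qs"
    | "length qs \<le> length ps \<and> length ps \<le> length rs" | "length qs \<le> length rs \<and> length rs \<le> length ps"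
    | "length rs \<le> length ps \<and> length ps \<le> length qs" | "length rs \<le> length qs \<and> length qs \<le> length ps"
    by linarith
  then show ?thesis
    by cases (use that[OF assms] that[OF s(1)] that[OF s(2)] that[OF s(3)] that[OF s(4)] that[OF s(5)]
      in \<open>auto simp: Un_ac\<close>)
qed

lemma thread_card:
  assumes "thread N u as v" "distinct as" "u \<notin> set as" "v \<notin> set as" "u \<noteq> v" "a \<in> set as"
  shows "card (N a) = 2"
  using assms
proof (induction as arbitrary: u)
  case (Cons b bs)
  then show ?case by (cases bs) auto
qed simp

lemma is_theta_degrees:
  assumes "is_theta N u v ps qs rs"
  shows "card (N u) = 3" "card (N v) = 3" "\<And>a. a \<in> set (ps @ qs @ rs) \<Longrightarrow> card (N a) = 2"
proof -
  note t = assms[unfolded is_theta_def]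
  have disj: "set ps \<inter> set qs = {}" "set ps \<inter> set rs = {}" "set qs \<inter> set rs = {}"
    "u \<notin> set ps \<union> set qs \<union> set rs" "v \<notin> set ps \<union> set qs \<union> set rs"
    using t by auto
  have hd_in: "hd (xs @ [v]) \<in> insert v (set xs)" for xs by (cases xs) auto
  have hd_v: "hd (xs @ [v]) = v \<Longrightarrow> v \<notin> set xs \<Longrightarrow> xs = []" for xs by (cases xs) auto
  have last_in: "last (u # xs) \<in> insert u (set xs)" for xs by simp
  have last_u: "last (u # xs) = u \<Longrightarrow> u \<notin> set xs \<Longrightarrow> xs = []" for xs
    using last_in_set[of xs] by (cases "xs = []") auto
  have "hd (xs @ [v]) \<noteq> hd (ys @ [v])"
    if "set xs \<inter> set ys = {}" "v \<notin> set xs" "v \<notin> set ys" "\<not> (xs = [] \<and> ys = [])" for xs ys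
    using that by (cases xs; cases ys) auto
  then show "card (N u) = 3" using t disj by (auto simp: card_insert_if)
  have "last (u # xs) \<noteq> last (u # ys)"
    if "set xs \<inter> set ys = {}" "u \<notin> set xs" "u \<notin> set ys" "\<not> (xs = [] \<and> ys = [])" for xs ys
    using that by (metis disjoint_iff last_ConsL last_ConsR last_in_set)
  then have "last (u # ps) \<noteq> last (u # qs)" "last (u # ps) \<noteq> last (u # rs)" "last (u # qs) \<noteq> last (u # rs)"
    using t disj by blast+
  then show "card (N v) = 3" using t by (simp del: last.simps)
  show "card (N a) = 2" if "a \<in> set (ps @ qs @ rs)" for a
    using that t thread_card[of N u ps v a] thread_card[of N u qs v a] thread_card[of N u rs v a] by auto
qed

section \<open>Isomorphism of theta graphs with equal path lengths\<close>

lemma thread_image: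
  assumes "thread N u as v" "thread M (f u) (map f as) (f v)" "a \<in> set as"
  shows "M (f a) = f ` N a"
  using assms
proof (induction as arbitrary: u)
  case (Cons b bs)
  then show ?case by (cases bs) auto
qed simp

lemma digraph_iso_theta:
  assumes G: "pair_graph G" and H: "pair_graph H"
    and tG: "is_theta (nbrs G) u v ps qs rs" "pverts G = set (u # v # ps @ qs @ rs)"
    and tH: "is_theta (nbrs H) u' v' ps' qs' rs'" "pverts H = set (u' # v' # ps' @ qs' @ rs')"
    and len: "length ps = length ps'" "length qs = length qs'" "length rs = length rs'"
  shows "digraph_iso (with_proj G) (with_proj H)"
proof -
  interpret G: pair_graph G by fact
  interpret H: pair_graph H by fact
  let ?L = "u # v # ps @ qs @ rs" and ?L' = "u' # v' # ps' @ qs' @ rs'"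
  have d: "distinct ?L" "distinct ?L'" using tG(1) tH(1) by (simp_all add: is_theta_def)
  define f where "f x = the (map_of (zip ?L ?L') x)" for x
  have ll: "length ?L = length ?L'" using len by simp
  have "map f ?L = ?L'"
  proof (intro nth_equalityI)
    fix i assume "i < length (map f ?L)"
    then have i: "i < length ?L" by simp
    have "map_of (zip ?L ?L') (?L ! i) = Some (?L' ! i)" using map_of_zip_nth[OF ll d(1)] i ll by simp
    then have "f (?L ! i) = ?L' ! i" unfolding f_def by simp
    then show "map f ?L ! i = ?L' ! i" using i by (simp only: nth_map)
  qed (use ll in simp)
  then have f: "f u = u'" "f v = v'" "map f ps = ps'" "map f qs = qs'" "map f rs = rs'"
    using len by (auto simp: append_eq_append_conv)
  have inj: "inj_on f (pverts G)"
    using d(2) \<open>map f ?L = ?L'\<close> unfolding tG(2) by (metis distinct_map)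
  have im: "f ` pverts G = pverts H"
    using \<open>map f ?L = ?L'\<close> unfolding tG(2) tH(2) by (metis set_map)
  have hd: "hd (map f xs @ [f w]) = f (hd (xs @ [w]))" for xs w by (cases xs) auto
  have last: "last (f w # map f xs) = f (last (w # xs))" for xs w
    using last_map[of "w # xs" f] by simp
  note t = tG(1)[unfolded is_theta_def] tH(1)[unfolded is_theta_def, folded f]
  have N: "nbrs H (f x) = f ` nbrs G x" if x: "x \<in> pverts G" for x
  proof -
    consider "x = u" | "x = v" | "x \<in> set ps" | "x \<in> set qs" | "x \<in> set rs"
      using x unfolding tG(2) by auto
    then show ?thesis
    proof cases
      case 1
      then show ?thesis using t by (simp add: hd)
    next
      case 2
      then show ?thesis using t by (simp only: last) simp
    qed (use t thread_image[of "nbrs G" u _ v "nbrs H" f x] in auto)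
  qed
  have "\<forall>x\<in>pverts G. \<forall>y\<in>pverts G. (x, y) \<in> parcs G \<longleftrightarrow> (f x, f y) \<in> parcs H"
  proof (intro ballI)
    fix x y assume xy: "x \<in> pverts G" "y \<in> pverts G"
    have "(f x, f y) \<in> parcs H \<longleftrightarrow> f y \<in> f ` nbrs G x"
      using N[OF xy(1)] by (auto simp: nbrs_def)
    also have "\<dots> \<longleftrightarrow> y \<in> nbrs G x"
      using inj_on_image_mem_iff[OF inj xy(2) nbrs_subset[OF G]] .
    finally show "(x, y) \<in> parcs G \<longleftrightarrow> (f x, f y) \<in> parcs H" by (simp add: nbrs_def)
  qed
  then show ?thesis
    using digraph_iso_with_proj_iff[OF G.pair_wf_digraph_axioms H.pair_wf_digraph_axioms] inj im
    unfolding bij_betw_def by blast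
qed


lemma unital_ring_hom_pcompose: "unital_ring_hom (\<lambda>p :: int poly. p \<circ>\<^sub>p q)"
  by unfold_locales (simp_all add: pcompose_add pcompose_mult pcompose_1)

text \<open>The substitution \<open>x = y + 2\<close> turns the diagonal entries \<open>x - 2\<close> and \<open>x - 3\<close> into
  \<open>y\<close> and \<open>y - 1\<close>.\<close>

lemma pcompose_shift:
  defines "y \<equiv> [:- 2, 1:] :: int poly" and "z \<equiv> [:- 3, 1:] :: int poly"
  shows "theta_val y z P Q R \<circ>\<^sub>p [:2, 1:] = theta_poly P Q R"
    and "dumbbell_val y z A B K \<circ>\<^sub>p [:2, 1:] = dumbbell_poly A B K"
    and "prod_list (map (cycle_val y) cs) \<circ>\<^sub>p [:2, 1:] = cycles_poly cs"
proof -
  interpret unital_ring_hom "\<lambda>p :: int poly. p \<circ>\<^sub>p [:2, 1:]" by (rule unital_ring_hom_pcompose)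
  have yz: "y \<circ>\<^sub>p [:2, 1:] = X" "z \<circ>\<^sub>p [:2, 1:] = X - 1"
    by (simp_all add: y_def z_def pcompose_pCons one_pCons)
  show "theta_val y z P Q R \<circ>\<^sub>p [:2, 1:] = theta_poly P Q R"
    by (simp only: hom_theta_val yz)
  show "dumbbell_val y z A B K \<circ>\<^sub>p [:2, 1:] = dumbbell_poly A B K"
    by (simp only: hom_dumbbell_val yz)
  show "prod_list (map (cycle_val y) cs) \<circ>\<^sub>p [:2, 1:] = cycles_poly cs"
    by (simp only: hom_cycle_vals yz)
qed

section \<open>Number of vertices and degree moments read off the polynomial\<close>

lemma laplacian_permanental_poly_coeffs:
  assumes G: "pair_graph G"
  defines "p \<equiv> laplacian_permanental_poly G" and "n \<equiv> card (pverts G)"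
    and "m \<equiv> \<Sum>x\<in>pverts G. int (card (nbrs G x))"
  shows "degree p = n" and "top_coeff n p 1 = - m"
    and "2 * top_coeff n p 2 = m\<^sup>2 - (\<Sum>x\<in>pverts G. (int (card (nbrs G x)))\<^sup>2) + m"
proof -
  interpret pair_graph G by fact
  interpret neighborhood "nbrs G" by (rule neighborhood_nbrs[OF G])
  have fin: "finite (pverts G)" by simp
  let ?k = "\<lambda>x. int (card (nbrs G x))"
  have p: "p = pm (\<lambda>x. [:- ?k x, 1:]) (pverts G) (pverts G)"
    unfolding p_def by (rule laplacian_permanental_poly_eq_pm[OF G])
  have "nbrs G x \<inter> pverts G = nbrs G x" for x using nbrs_subset[OF G, of x] by blast
  then show "top_coeff n p 1 = - m"
    "2 * top_coeff n p 2 = m\<^sup>2 - (\<Sum>x\<in>pverts G. (?k x)\<^sup>2) + m"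
    using top_coeff_pm[OF fin, of ?k] unfolding p n_def m_def by simp_all
  show "degree p = n"
  proof (rule antisym)
    show "degree p \<le> n"
      unfolding p n_def using degree_pm_le[OF fin fin, of ?k] by simp
    show "n \<le> degree p"
      unfolding p n_def using coeff_pm_card[OF fin, of ?k] by (intro le_degree) simp
  qed
qed

lemma degree_moments:
  fixes G :: "'a pair_pre_digraph" and H :: "'b pair_pre_digraph"
  assumes G: "pair_graph G" and H: "pair_graph H"
    and eq: "laplacian_permanental_poly G = laplacian_permanental_poly H"
  shows "card (pverts G) = card (pverts H)"
    and "(\<Sum>x\<in>pverts G. int (card (nbrs G x)) - 2) = (\<Sum>x\<in>pverts H. int (card (nbrs H x)) - 2)"
    and "(\<Sum>x\<in>pverts G. (int (card (nbrs G x)) - 2)\<^sup>2) = (\<Sum>x\<in>pverts H. (int (card (nbrs H x)) - 2)\<^sup>2)"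
proof -
  note cG = laplacian_permanental_poly_coeffs[OF G] and cH = laplacian_permanental_poly_coeffs[OF H]
  show n: "card (pverts G) = card (pverts H)" using cG(1) cH(1) eq by simp
  have m: "(\<Sum>x\<in>pverts G. int (card (nbrs G x))) = (\<Sum>x\<in>pverts H. int (card (nbrs H x)))"
    using cG(2) cH(2) eq n by simp
  have m2: "(\<Sum>x\<in>pverts G. (int (card (nbrs G x)))\<^sup>2) = (\<Sum>x\<in>pverts H. (int (card (nbrs H x)))\<^sup>2)"
    using cG(3) cH(3) eq n m by simp
  show "(\<Sum>x\<in>pverts G. int (card (nbrs G x)) - 2) = (\<Sum>x\<in>pverts H. int (card (nbrs H x)) - 2)"
    using n m by (simp add: sum_subtractf)
  have e: "(a - 2)\<^sup>2 = a\<^sup>2 - 4 * a + 4" for a :: int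
    by (simp add: power2_eq_square algebra_simps)
  show "(\<Sum>x\<in>pverts G. (int (card (nbrs G x)) - 2)\<^sup>2) = (\<Sum>x\<in>pverts H. (int (card (nbrs H x)) - 2)\<^sup>2)"
    using n m m2 by (simp add: e sum.distrib sum_subtractf flip: sum_distrib_left)
qed

lemma (in neighborhood) pm_is_theta:
  assumes "is_theta N u v ps qs rs" "length ps \<le> length qs" "length qs \<le> length rs"
    and "\<And>a. a \<in> set (ps @ qs @ rs) \<Longrightarrow> d a = y" "d u = z" "d v = z"
  shows "pm d (set (u # v # ps @ qs @ rs)) (set (u # v # ps @ qs @ rs))
    = theta_val y z (Suc (length ps)) (Suc (length qs)) (Suc (length rs))"
proof (rule pm_theta)
  note t = assms(1)[unfolded is_theta_def]
  show "qs \<noteq> []" "rs \<noteq> []" using t assms(2,3) by auto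
  then show "ps = [] \<or> v \<notin> N u" using t by (cases ps; cases qs; cases rs) auto
qed (use assms in \<open>auto simp: is_theta_def\<close>)

theorem theorem1p2:
  fixes p q r :: nat and H :: "'a pair_pre_digraph"
  assumes "\<not> (p = 0 \<and> q = 0)" and "\<not> (p = 0 \<and> r = 0)" and "\<not> (q = 0 \<and> r = 0)"
    and "pair_graph H"
    and "laplacian_permanental_poly H = laplacian_permanental_poly (theta_graph p q r)"
  shows "digraph_iso (with_proj H) (with_proj (theta_graph p q r))"
proof -
  let ?T = "theta_graph p q r"
  let ?y = "[:- 2, 1:] :: int poly" and ?z = "[:- 3, 1:] :: int poly"
  note T = pair_graph_theta_graph[of p q r]
  interpret H: pair_graph H by fact
  interpret NT: neighborhood "nbrs ?T" by (rule neighborhood_nbrs[OF T])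
  obtain ps qs rs where th: "is_theta (nbrs ?T) 0 1 ps qs rs" "length ps \<le> length qs"
      "length qs \<le> length rs"
    and V: "set (0 # 1 # ps @ qs @ rs)
      = set (0 # 1 # [2..<p + 2] @ [p + 2..<p + q + 2] @ [p + q + 2..<p + q + r + 2])"
    using is_theta_sorted[OF is_theta_theta_graph[OF assms(1-3)]] by metis
  have VT: "pverts ?T = set (0 # 1 # ps @ qs @ rs)"
    unfolding V by (auto simp: theta_graph_def)
  note dT = is_theta_degrees[OF th(1)]
  let ?P = "Suc (length ps)" and ?Q = "Suc (length qs)" and ?R = "Suc (length rs)"
  have distT: "distinct (0 # 1 # ps @ qs @ rs)" using th(1) by (simp add: is_theta_def)
  \<comment> \<open>The three path lengths add up to the number of edges, which exceeds the number
    of vertices by one.\<close>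
  have nT: "Suc (card (pverts ?T)) = ?P + ?Q + ?R"
    unfolding VT distinct_card[OF distT] by simp
  have piT: "laplacian_permanental_poly ?T = theta_val ?y ?z ?P ?Q ?R"
    unfolding laplacian_permanental_poly_eq_pm[OF T] VT
    using dT by (intro NT.pm_is_theta[OF th]) auto
  \<comment> \<open>The identity and the square, both 0 at 0 and 1 at 1, give the value 2 for either
    moment.\<close>
  have sumT: "(\<Sum>x\<in>pverts ?T. f (int (card (nbrs ?T x)) - 2)) = 2 * f 1" if "f 0 = 0"
    for f :: "int \<Rightarrow> int"
  proof -
    have "(\<Sum>x\<in>pverts ?T. f (int (card (nbrs ?T x)) - 2)) = (\<Sum>x\<in>{0, 1}. f (int (card (nbrs ?T x)) - 2))"
      unfolding VT using dT(3) that by (intro sum.mono_neutral_right) auto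
    then show ?thesis using dT(1,2) by simp
  qed
  note moments = degree_moments[OF assms(4) T assms(5)]
  have "(\<Sum>x\<in>pverts H. int (card (nbrs H x)) - 2) = 2" "(\<Sum>x\<in>pverts H. (int (card (nbrs H x)) - 2)\<^sup>2) = 2"
    unfolding moments(2,3) using sumT[of "\<lambda>x. x"] sumT[of "\<lambda>x. x\<^sup>2"] by simp_all
  then obtain u v where uv: "u \<in> pverts H" "v \<in> pverts H" "u \<noteq> v" "card (nbrs H u) = 3" "card (nbrs H v) = 3"
    "\<And>x. x \<in> pverts H - {u, v} \<Longrightarrow> card (nbrs H x) = 2"
    using two_vertices_of_degree_3[of "pverts H" "\<lambda>x. card (nbrs H x)" thesis] by simp
  interpret cubic_pair "nbrs H" "pverts H" u v
    using neighborhood_nbrs[OF assms(4)] nbrs_subset[OF assms(4)] uv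
    by (intro cubic_pair.intro cubic_pair_axioms.intro) auto
  let ?d = "\<lambda>x. [:- int (card (nbrs H x)), 1:]"
  \<comment> \<open>\<open>U\<close> will be the vertex set of the theta graph or dumbbell through
    \<open>u\<close> and \<open>v\<close>. It is closed under neighbors, so the remaining vertices
    form a 2-regular graph, and the permanent factors.\<close>
  have rest: "\<exists>cs. (\<forall>c\<in>set cs. 3 \<le> c) \<and> card U + sum_list cs = card (pverts H)
      \<and> laplacian_permanental_poly H = pm ?d U U * prod_list (map (cycle_val ?y) cs)"
    if U: "U \<subseteq> pverts H" "u \<in> U" "v \<in> U" "\<forall>x\<in>U. nbrs H x \<subseteq> U" for U
  proof -
    let ?W = "pverts H - U"
    have "nbrs H x \<subseteq> ?W" if "x \<in> ?W" for x
      using that U(4) sym N_V[of x] by blast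
    moreover have "card (nbrs H x) = 2" if "x \<in> ?W" for x using that U deg2[of x] by auto
    moreover have "?d x = ?y" if "x \<in> ?W" for x using calculation(2)[OF that] by simp
    ultimately obtain cs where cs: "\<forall>c\<in>set cs. 3 \<le> c" "sum_list cs = card ?W"
      "pm ?d ?W ?W = prod_list (map (cycle_val ?y) cs)"
      using pm_two_regular[of ?W ?d ?y] finite_V by blast
    have "pm ?d (U \<union> ?W) (U \<union> ?W) = pm ?d U U * pm ?d ?W ?W"
      using U finite_V finite_subset[OF U(1)] by (intro pm_block) auto
    moreover have "U \<union> ?W = pverts H" using U by auto
    ultimately have "laplacian_permanental_poly H = pm ?d U U * prod_list (map (cycle_val ?y) cs)"
      unfolding laplacian_permanental_poly_eq_pm[OF assms(4)] cs(3)[symmetric] by simp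
    moreover have "card U + card ?W = card (pverts H)"
      using U(1) finite_V card_mono[OF finite_V U(1)] finite_subset[OF U(1)]
      by (simp add: card_Diff_subset)
    ultimately show ?thesis using cs by metis
  qed
  interpret sh: unital_ring_hom "\<lambda>p :: int poly. p \<circ>\<^sub>p [:2, 1:]" by (rule unital_ring_hom_pcompose)
  from theta_or_dumbbell show ?thesis
  proof (elim disjE exE conjE)
    fix ps0 qs0 rs0
    assume "is_theta (nbrs H) u v ps0 qs0 rs0" and sub0: "set (u # v # ps0 @ qs0 @ rs0) \<subseteq> pverts H"
      and closed0: "\<forall>x\<in>set (u # v # ps0 @ qs0 @ rs0). nbrs H x \<subseteq> set (u # v # ps0 @ qs0 @ rs0)"
    then obtain ps' qs' rs' where th': "is_theta (nbrs H) u v ps' qs' rs'" "length ps' \<le> length qs'"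
        "length qs' \<le> length rs'"
      and U0: "set (u # v # ps' @ qs' @ rs') = set (u # v # ps0 @ qs0 @ rs0)"
      using is_theta_sorted by metis
    let ?U = "set (u # v # ps' @ qs' @ rs')"
    let ?P' = "Suc (length ps')" and ?Q' = "Suc (length qs')" and ?R' = "Suc (length rs')"
    have U: "?U \<subseteq> pverts H" "u \<in> ?U" "v \<in> ?U" "\<forall>x\<in>?U. nbrs H x \<subseteq> ?U"
      using sub0 closed0 unfolding U0 by auto
    obtain cs where cs: "\<forall>c\<in>set cs. 3 \<le> c" "card ?U + sum_list cs = card (pverts H)"
      "laplacian_permanental_poly H = pm ?d ?U ?U * prod_list (map (cycle_val ?y) cs)"
      using rest[OF U] by blast
    have "distinct (u # v # ps' @ qs' @ rs')" using th'(1) by (simp add: is_theta_def)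
    then have cU: "Suc (card ?U) = ?P' + ?Q' + ?R'" by (subst distinct_card) auto
    have "pm ?d ?U ?U = theta_val ?y ?z ?P' ?Q' ?R'"
      using is_theta_degrees[OF th'(1)] by (intro pm_is_theta[OF th']) auto
    then have "theta_val ?y ?z ?P ?Q ?R
        = theta_val ?y ?z ?P' ?Q' ?R' * prod_list (map (cycle_val ?y) cs)"
      using cs(3) piT assms(5) by simp
    then have "theta_poly ?P ?Q ?R = theta_poly ?P' ?Q' ?R' * cycles_poly cs"
      unfolding pcompose_shift[symmetric] by (simp only: sh.hom_mult)
    moreover have "?P + ?Q + ?R = ?P' + ?Q' + ?R' + sum_list cs"
      using nT cU cs(2) moments(1) by simp
    ultimately have res: "cs = [] \<and> ?P = ?P' \<and> ?Q = ?Q' \<and> ?R = ?R'"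
      using cs(1) th th' by (intro theta_poly_eq_theta_times_cycles) auto
    \<comment> \<open>With no cycle left over, the theta graph found in \<open>H\<close> exhausts
      its vertices.\<close>
    then have "card ?U = card (pverts H)" using cs(2) by simp
    then have "pverts H = ?U" using card_subset_eq[OF finite_V U(1)] by simp
    then show ?thesis
      using res by (intro digraph_iso_theta[OF assms(4) T th'(1) _ th(1) VT]) auto
  next
    fix as bs ks
    assume db: "is_dumbbell (nbrs H) u v as bs ks" and sub: "set (u # v # ks @ as @ bs) \<subseteq> pverts H"
      and closed: "\<forall>x\<in>set (u # v # ks @ as @ bs). nbrs H x \<subseteq> set (u # v # ks @ as @ bs)"
    let ?U = "set (u # v # ks @ as @ bs)"
    let ?A = "Suc (length as)" and ?B = "Suc (length bs)" and ?K = "Suc (length ks)"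
    obtain cs where cs: "\<forall>c\<in>set cs. 3 \<le> c" "card ?U + sum_list cs = card (pverts H)"
      "laplacian_permanental_poly H = pm ?d ?U ?U * prod_list (map (cycle_val ?y) cs)"
      using rest[OF sub _ _ closed] by auto
    note d = db[unfolded is_dumbbell_def]
    have cU: "Suc (card ?U) = ?A + ?B + ?K" using d by (subst distinct_card) auto
    have "card (nbrs H x) = 2" if "x \<in> set (ks @ as @ bs)" for x
      using that d sub by (intro deg2) auto
    then have "pm ?d ?U ?U = dumbbell_val ?y ?z ?A ?B ?K"
      using d uv by (intro pm_dumbbell) auto
    then have "theta_val ?y ?z ?P ?Q ?R
        = dumbbell_val ?y ?z ?A ?B ?K * prod_list (map (cycle_val ?y) cs)"
      using cs(3) piT assms(5) by simp
    then have "theta_poly ?P ?Q ?R = dumbbell_poly ?A ?B ?K * cycles_poly cs"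
      unfolding pcompose_shift[symmetric] by (simp only: sh.hom_mult)
    moreover have "?P + ?Q + ?R = ?A + ?B + ?K + sum_list cs"
      using nT cU cs(2) moments(1) by simp
    ultimately have False
      using theta_poly_neq_dumbbell_times_cycles[of ?P ?Q ?R ?K ?A ?B cs] cs(1) d by simp
    then show ?thesis ..
  qed
qed

end
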